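(* Let $\mathscr{A}$ be a Banach $^*$-algebra with a (norm bounded) approximate unit $(e_i)_{i\in I}$, let $f,g$ be positive (hence representable) functionals on $\mathscr{A}$, and let $A,B\in\mathscr{B}(\mathscr{A};\bar{\mathscr{A}}')$ be the associated positive operators $\langle Aa,b\rangle:=f(b^*a)$, $\langle Ba,b\rangle:=g(b^*a)$, $a,b\in\mathscr{A}$. Then $$f:g=\lim_{i,I}\overline{(A:B)e_i},$$ where the limit is taken in the functional norm.
   Context: Inner products are linear in the first variable. An approximate unit is a norm bounded net $(e_i)_{i\in I}$ in $\mathscr{A}$ with $\lim_{i,I}e_ia=\lim_{i,I}ae_i=a$ for all $a\in\mathscr{A}$. Functionals. A linear functional $f$ on $\mathscr{A}$ is positive if $f(a^*a)\ge0$ for all $a$, and representable if $f(a)=(\pi(a)\zeta\mid\zeta)$, $a\in\mathscr A$, for some $^*$-representation $\pi$ of $\mathscr{A}$ by bounded operators on a Hilbert space and some vector $\zeta$. For representable positive $f,g$ let $(H_f,\pi_f,\zeta_f)$, $(H_g,\pi_g,\zeta_g)$ be the GNS-triples ($\pi_f$ a $^*$-representation on the Hilbert space $H_f$ with cyclic vector $\zeta_f$ and $f(a)=(\pi_f(a)\zeta_f\mid\zeta_f)_f$; similarly for $g$). The parallel sum $f:g$ is the representable positive functional $(f:g)(a):=((\pi_f\oplus\pi_g)(a)Q(\zeta_f\oplus0)\mid Q(\zeta_f\oplus0))$, where $Q$ is the orthogonal projection of $H_f\oplus H_g$ onto the orthogonal complement of $\{\pi_f(a)\zeta_f\oplus\pi_g(a)\zeta_g:a\in\mathscr{A}\}$;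 it satisfies $(f:g)(a^*a)=\inf\{f((a-b)^*(a-b))+g(b^*b):b\in\mathscr{A}\}$ for all $a\in\mathscr A$. Operators. For a complex Banach space $E$ (here $E=\mathscr{A}$), $\bar E'$ is the Banach space of continuous conjugate-linear functionals on $E$, $\langle\varphi,x\rangle:=\varphi(x)$, and $\mathscr{B}(E;\bar E')$ is the space of bounded linear operators $E\to\bar E'$. $A\in\mathscr{B}(E;\bar E')$ is positive if $\langle Ax,x\rangle\ge0$ for all $x\in E$. For positive $A$, $H_A$ is the Hilbert space completion of $\operatorname{ran}A$ under $(Ax\mid Ay)_A:=\langle Ax,y\rangle$; similarly $H_B$. $\bar E''$ is the antidual of $\bar E'$ and $j_E:E\to\bar E''$ is given by $j_E(x)(\varphi):=\overline{\varphi(x)}$. The bounded operators $J,\widetilde J_A:H_A\times H_B\to\bar E'$ are the continuous extensions of $J(Ax,By):=Ax+By$ and $\widetilde J_A(Ax,By):=Ax$. For bounded $S:K\to\bar E'$ with $K$ a Hilbert space, $S^*:\bar E''\to K$ is defined by $(S^*\Phi\mid\xi)_K=\Phi(S\xi)$; then $(J^*\circ j_E)(x)=(Ax,Bx)$ and $(\widetilde J_A^*\circ j_E)(x)=(Ax,0)$. With $P$ the orthogonal projection of $H_A\times H_B$ onto $\{\operatorname{ran}(J^*\circ j_E)\}^\perp$, the parallel sum of $A$ and $B$ is the positive operator $A:B:=\widetilde J_AP\widetilde J_A^*\circ j_E\in\mathscr{B}(E;\bar E')$; it satisfies $\langle(A:B)x,x\rangle=\inf\{\langle A(x-y),x-y\rangle+\langle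 By,y\rangle:y\in E\}$. For $\varphi\in\bar{\mathscr{A}}'$, $\overline{\varphi}$ denotes the linear functional $a\mapsto\overline{\langle\varphi,a\rangle}$. The functional norm of a linear functional $h$ on $\mathscr{A}$ is $\sup\{|h(a)|:\|a\|\le1\}$. *)

theory Defs
  imports "HOL-Analysis.Analysis" "HOL-Library.Function_Algebras"
begin

section \<open>Complex vector spaces, complex Banach spaces, Banach star algebras\<close>

class scaleC =
  fixes scaleC :: "complex \<Rightarrow> 'a \<Rightarrow> 'a"  (infixr "*\<^sub>C" 75)

class complex_vector = scaleC + ab_group_add +
  assumes scaleC_add_right: "c *\<^sub>C (x + y) = c *\<^sub>C x + c *\<^sub>C y"
    and scaleC_add_left: "(c + d) *\<^sub>C x = c *\<^sub>C x + d *\<^sub>C x"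
    and scaleC_scaleC: "c *\<^sub>C (d *\<^sub>C x) = (c * d) *\<^sub>C x"
    and scaleC_one: "1 *\<^sub>C x = x"

global_interpretation complex_vector:
  vector_space "scaleC :: complex \<Rightarrow> 'a \<Rightarrow> 'a::complex_vector"
  by unfold_locales
    (simp_all add: scaleC_add_right scaleC_add_left scaleC_scaleC scaleC_one)

abbreviation clinear :: "('a::complex_vector \<Rightarrow> 'b::complex_vector) \<Rightarrow> bool"
  where "clinear \<equiv> Vector_Spaces.linear scaleC scaleC"

instantiation complex :: complex_vector
begin
definition scaleC_complex :: "complex \<Rightarrow> complex \<Rightarrow> complex"
  where "scaleC_complex c x = c * x"
instance
  by standard (simp_all add: scaleC_complex_def algebra_simps)
end

instantiation "fun" :: (type, complex_vector) complex_vector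
begin
definition scaleC_fun :: "complex \<Rightarrow> ('a \<Rightarrow> 'b) \<Rightarrow> 'a \<Rightarrow> 'b"
  where "scaleC_fun c h = (\<lambda>x. c *\<^sub>C h x)"
instance
  by standard
    (simp_all add: scaleC_fun_def fun_eq_iff scaleC_add_right scaleC_add_left
      scaleC_scaleC scaleC_one)
end

instantiation prod :: (complex_vector, complex_vector) complex_vector
begin
definition scaleC_prod :: "complex \<Rightarrow> 'a \<times> 'b \<Rightarrow> 'a \<times> 'b"
  where "scaleC_prod c p = (c *\<^sub>C fst p, c *\<^sub>C snd p)"
instance
  by standard
    (simp_all add: scaleC_prod_def prod_eq_iff scaleC_add_right scaleC_add_left
      scaleC_scaleC scaleC_one)
end

class complex_normed_vector = complex_vector + real_normed_vector +
  assumes scaleR_scaleC: "r *\<^sub>R x = complex_of_real r *\<^sub>C x"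
    and norm_scaleC: "norm (c *\<^sub>C x) = cmod c * norm x"

class complex_banach = complex_normed_vector + complete_space

class complex_banach_algebra = complex_banach + real_normed_algebra +
  assumes mult_scaleC_left: "(c *\<^sub>C x) * y = c *\<^sub>C (x * y)"
    and mult_scaleC_right: "x * (c *\<^sub>C y) = c *\<^sub>C (x * y)"

text \<open>No unit is assumed, and the involution is neither assumed to be isometric nor to be
  continuous.\<close>

class banach_star_algebra = complex_banach_algebra +
  fixes star :: "'a \<Rightarrow> 'a"
  assumes star_star: "star (star x) = x"
    and star_add: "star (x + y) = star x + star y"
    and star_scaleC: "star (c *\<^sub>C x) = cnj c *\<^sub>C star x"
    and star_mult: "star (x * y) = star y * star x"


section \<open>Hilbert spaces\<close>

text \<open>The Hilbert spaces below (GNS spaces, completions of ranges) depend on terms, hence they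
  cannot be types. A Hilbert space is a linear subspace of some ambient complex vector space
  (which only supplies the linear operations) with an inner product of its own, linear in the
  first variable, for which it is complete.\<close>

record 'v hspace =
  hcarrier :: "'v set"
  hinner :: "'v \<Rightarrow> 'v \<Rightarrow> complex"

definition hnorm :: "'v hspace \<Rightarrow> 'v \<Rightarrow> real"
  where "hnorm H x = sqrt (Re (hinner H x x))"

definition hilbert_space :: "'v::complex_vector hspace \<Rightarrow> bool"
  where "hilbert_space H \<longleftrightarrow>
    complex_vector.subspace (hcarrier H) \<and>
    (\<forall>x\<in>hcarrier H. \<forall>y\<in>hcarrier H. \<forall>z\<in>hcarrier H.
      hinner H (x + y) z = hinner H x z + hinner H y z) \<and>
    (\<forall>c. \<forall>x\<in>hcarrier H. \<forall>y\<in>hcarrier H. hinner H (c *\<^sub>C x) y = c * hinner H x y) \<and>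
    (\<forall>x\<in>hcarrier H. \<forall>y\<in>hcarrier H. hinner H y x = cnj (hinner H x y)) \<and>
    (\<forall>x\<in>hcarrier H. hinner H x x \<in> \<real>\<^sub>\<ge>\<^sub>0) \<and>
    (\<forall>x\<in>hcarrier H. hinner H x x = 0 \<longrightarrow> x = 0) \<and>
    (\<forall>X. (\<forall>n::nat. X n \<in> hcarrier H) \<and>
         (\<forall>\<epsilon>>0. \<exists>N. \<forall>m\<ge>N. \<forall>n\<ge>N. hnorm H (X m - X n) < \<epsilon>) \<longrightarrow>
         (\<exists>x\<in>hcarrier H. (\<lambda>n. hnorm H (X n - x)) \<longlonglongrightarrow> 0))"

definition hdense :: "'v::complex_vector hspace \<Rightarrow> 'v set \<Rightarrow> bool"
  where "hdense H D \<longleftrightarrow>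
    D \<subseteq> hcarrier H \<and> (\<forall>x\<in>hcarrier H. \<forall>\<epsilon>>0. \<exists>d\<in>D. hnorm H (x - d) < \<epsilon>)"

definition hsum :: "'v hspace \<Rightarrow> 'w hspace \<Rightarrow> ('v \<times> 'w) hspace"
  where "hsum H K =
    \<lparr> hcarrier = hcarrier H \<times> hcarrier K,
      hinner = (\<lambda>p q. hinner H (fst p) (fst q) + hinner K (snd p) (snd q)) \<rparr>"

definition orth_compl :: "'v hspace \<Rightarrow> 'v set \<Rightarrow> 'v set"
  where "orth_compl H M = {x \<in> hcarrier H. \<forall>m\<in>M. hinner H x m = 0}"

definition orth_proj :: "'v::complex_vector hspace \<Rightarrow> 'v set \<Rightarrow> 'v \<Rightarrow> 'v"
  where "orth_proj H N x = (THE y. y \<in> N \<and> (\<forall>z\<in>N. hinner H (x - y) z = 0))"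


section \<open>Positive functionals and their parallel sum\<close>

definition positive_functional :: "('a::banach_star_algebra \<Rightarrow> complex) \<Rightarrow> bool"
  where "positive_functional f \<longleftrightarrow> clinear f \<and> (\<forall>a. f (star a * a) \<in> \<real>\<^sub>\<ge>\<^sub>0)"

definition bounded_hop :: "'v::complex_vector hspace \<Rightarrow> ('v \<Rightarrow> 'v) \<Rightarrow> bool"
  where "bounded_hop H T \<longleftrightarrow>
    (\<forall>x\<in>hcarrier H. T x \<in> hcarrier H) \<and>
    (\<forall>x\<in>hcarrier H. \<forall>y\<in>hcarrier H. T (x + y) = T x + T y) \<and>
    (\<forall>c. \<forall>x\<in>hcarrier H. T (c *\<^sub>C x) = c *\<^sub>C T x) \<and>
    (\<exists>K. \<forall>x\<in>hcarrier H. hnorm H (T x) \<le> K * hnorm H x)"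

definition star_representation ::
    "'v::complex_vector hspace \<Rightarrow> ('a::banach_star_algebra \<Rightarrow> 'v \<Rightarrow> 'v) \<Rightarrow> bool"
  where "star_representation H \<pi> \<longleftrightarrow>
    hilbert_space H \<and>
    (\<forall>a. bounded_hop H (\<pi> a)) \<and>
    (\<forall>a b. \<forall>x\<in>hcarrier H. \<pi> (a + b) x = \<pi> a x + \<pi> b x) \<and>
    (\<forall>c a. \<forall>x\<in>hcarrier H. \<pi> (c *\<^sub>C a) x = c *\<^sub>C \<pi> a x) \<and>
    (\<forall>a b. \<forall>x\<in>hcarrier H. \<pi> (a * b) x = \<pi> a (\<pi> b x)) \<and>
    (\<forall>a. \<forall>x\<in>hcarrier H. \<forall>y\<in>hcarrier H. hinner H (\<pi> a x) y = hinner H x (\<pi> (star a) y))"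

text \<open>The Hilbert spaces over which existence is asserted below have elements in
  \<open>'a \<Rightarrow> complex\<close>. This is no restriction: a representing space may be cut down to the closure
  \<open>K\<close> of the vectors \<open>\<pi> a \<zeta>\<close> (replacing \<open>\<zeta>\<close> by its projection onto \<open>K\<close>), and
  \<open>x \<mapsto> (\<lambda>a. (x | \<pi> a \<zeta>))\<close> is a linear injection of \<open>K\<close> into \<open>'a \<Rightarrow> complex\<close>.\<close>

definition representable :: "('a::banach_star_algebra \<Rightarrow> complex) \<Rightarrow> bool"
  where "representable f \<longleftrightarrow>
    (\<exists>(H :: ('a \<Rightarrow> complex) hspace) \<pi> \<zeta>.
      star_representation H \<pi> \<and> \<zeta> \<in> hcarrier H \<and> (\<forall>a. f a = hinner H (\<pi> a \<zeta>) \<zeta>))"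

definition gns_triple ::
    "('a::banach_star_algebra \<Rightarrow> complex) \<Rightarrow>
     'v::complex_vector hspace \<Rightarrow> ('a \<Rightarrow> 'v \<Rightarrow> 'v) \<Rightarrow> 'v \<Rightarrow> bool"
  where "gns_triple f H \<pi> \<zeta> \<longleftrightarrow>
    star_representation H \<pi> \<and> \<zeta> \<in> hcarrier H \<and>
    hdense H (range (\<lambda>a. \<pi> a \<zeta>)) \<and>
    (\<forall>a. f a = hinner H (\<pi> a \<zeta>) \<zeta>)"

text \<open>GNS triples are unique up to unitary equivalence, so the choice is immaterial.\<close>

definition gns ::
    "('a::banach_star_algebra \<Rightarrow> complex) \<Rightarrow>
     ('a \<Rightarrow> complex) hspace \<times> ('a \<Rightarrow> ('a \<Rightarrow> complex) \<Rightarrow> ('a \<Rightarrow> complex)) \<times> ('a \<Rightarrow> complex)"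
  where "gns f = (SOME (H, \<pi>, \<zeta>). gns_triple f H \<pi> \<zeta>)"

definition functional_parallel_sum ::
    "('a::banach_star_algebra \<Rightarrow> complex) \<Rightarrow> ('a \<Rightarrow> complex) \<Rightarrow> ('a \<Rightarrow> complex)"
  where "functional_parallel_sum f g =
    (let (H\<^sub>f, \<pi>\<^sub>f, \<zeta>\<^sub>f) = gns f;
         (H\<^sub>g, \<pi>\<^sub>g, \<zeta>\<^sub>g) = gns g;
         H = hsum H\<^sub>f H\<^sub>g;
         Q = orth_proj H (orth_compl H (range (\<lambda>a. (\<pi>\<^sub>f a \<zeta>\<^sub>f, \<pi>\<^sub>g a \<zeta>\<^sub>g))))
     in (\<lambda>a. hinner H (map_prod (\<pi>\<^sub>f a) (\<pi>\<^sub>g a) (Q (\<zeta>\<^sub>f, 0))) (Q (\<zeta>\<^sub>f, 0))))"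


section \<open>Positive operators into the antidual and their parallel sum\<close>

definition antidual :: "('e::complex_normed_vector \<Rightarrow> complex) set"
  where "antidual =
    {\<phi>. (\<forall>x y. \<phi> (x + y) = \<phi> x + \<phi> y) \<and> (\<forall>c x. \<phi> (c *\<^sub>C x) = cnj c * \<phi> x) \<and>
        continuous_on UNIV \<phi>}"

text \<open>Extended real valued, so that unbounded functionals have norm \<open>\<infinity>\<close>.\<close>

definition functional_norm :: "('e::complex_normed_vector \<Rightarrow> complex) \<Rightarrow> ereal"
  where "functional_norm \<phi> = (SUP x\<in>{x. norm x \<le> 1}. ereal (cmod (\<phi> x)))"

text \<open>The space of bounded operators from \<open>E\<close> to its antidual; \<open>\<langle>A x, y\<rangle>\<close> is \<open>A x y\<close>.\<close>

definition bounded_ops :: "('e::complex_banach \<Rightarrow> 'e \<Rightarrow> complex) set"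
  where "bounded_ops =
    {A. range A \<subseteq> antidual \<and> clinear A \<and>
        (\<exists>K. \<forall>x. functional_norm (A x) \<le> ereal (K * norm x))}"

definition positive_op :: "('e::complex_banach \<Rightarrow> 'e \<Rightarrow> complex) \<Rightarrow> bool"
  where "positive_op A \<longleftrightarrow> A \<in> bounded_ops \<and> (\<forall>x. A x x \<in> \<real>\<^sub>\<ge>\<^sub>0)"

text \<open>\<open>H\<close> is a Hilbert space completion of the pre-Hilbert space \<open>ran A\<close> with inner product
  \<open>(A x | A y) = \<langle>A x, y\<rangle>\<close>. It is unique up to a unitary that fixes \<open>ran A\<close>, so the choice in
  \<open>hspace_of\<close> is immaterial. For positive \<open>A\<close> a completion inside \<open>'e \<Rightarrow> complex\<close> exists, since
  Cauchy sequences of the pre-Hilbert space converge pointwise and, if their pointwise limit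
  is \<open>0\<close>, also converge to \<open>0\<close> in the pre-Hilbert space.\<close>

definition range_completion ::
    "('e::complex_banach \<Rightarrow> 'e \<Rightarrow> complex) \<Rightarrow> ('e \<Rightarrow> complex) hspace \<Rightarrow> bool"
  where "range_completion A H \<longleftrightarrow>
    hilbert_space H \<and> hdense H (range A) \<and> (\<forall>x y. hinner H (A x) (A y) = A x y)"

definition hspace_of ::
    "('e::complex_banach \<Rightarrow> 'e \<Rightarrow> complex) \<Rightarrow> ('e \<Rightarrow> complex) hspace"
  where "hspace_of A = (SOME H. range_completion A H)"

definition bounded_into_antidual ::
    "'v::complex_vector hspace \<Rightarrow> ('v \<Rightarrow> 'e::complex_banach \<Rightarrow> complex) \<Rightarrow> bool"
  where "bounded_into_antidual H S \<longleftrightarrow>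
    (\<forall>\<xi>\<in>hcarrier H. S \<xi> \<in> antidual) \<and>
    (\<forall>\<xi>\<in>hcarrier H. \<forall>\<eta>\<in>hcarrier H. S (\<xi> + \<eta>) = S \<xi> + S \<eta>) \<and>
    (\<forall>c. \<forall>\<xi>\<in>hcarrier H. S (c *\<^sub>C \<xi>) = c *\<^sub>C S \<xi>) \<and>
    (\<exists>K. \<forall>\<xi>\<in>hcarrier H. functional_norm (S \<xi>) \<le> ereal (K * hnorm H \<xi>))"

text \<open>Only the values on \<open>H\<^sub>A \<times> H\<^sub>B\<close> matter for the following two operators; there they are
  determined uniquely, by density.\<close>

definition J_sum ::
    "('e::complex_banach \<Rightarrow> 'e \<Rightarrow> complex) \<Rightarrow> ('e \<Rightarrow> 'e \<Rightarrow> complex) \<Rightarrow>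
     ('e \<Rightarrow> complex) \<times> ('e \<Rightarrow> complex) \<Rightarrow> 'e \<Rightarrow> complex"
  where "J_sum A B =
    (SOME S. bounded_into_antidual (hsum (hspace_of A) (hspace_of B)) S \<and>
      (\<forall>x y. S (A x, B y) = A x + B y))"

definition J_fst ::
    "('e::complex_banach \<Rightarrow> 'e \<Rightarrow> complex) \<Rightarrow> ('e \<Rightarrow> 'e \<Rightarrow> complex) \<Rightarrow>
     ('e \<Rightarrow> complex) \<times> ('e \<Rightarrow> complex) \<Rightarrow> 'e \<Rightarrow> complex"
  where "J_fst A B =
    (SOME S. bounded_into_antidual (hsum (hspace_of A) (hspace_of B)) S \<and>
      (\<forall>x y. S (A x, B y) = A x))"

text \<open>The canonical map from \<open>E\<close> into the antidual of its antidual; elements of the latter are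
  represented as functions on all of \<open>'e \<Rightarrow> complex\<close> of which only the values on
  \<open>antidual\<close> are relevant.\<close>

definition bidual_embed ::
    "'e::complex_banach \<Rightarrow> ('e \<Rightarrow> complex) \<Rightarrow> complex"
  where "bidual_embed x = (\<lambda>\<phi>. cnj (\<phi> x))"

definition hadjoint ::
    "'v hspace \<Rightarrow> ('v \<Rightarrow> 'e \<Rightarrow> complex) \<Rightarrow> (('e \<Rightarrow> complex) \<Rightarrow> complex) \<Rightarrow> 'v"
  where "hadjoint H S \<Phi> =
    (THE \<eta>. \<eta> \<in> hcarrier H \<and> (\<forall>\<xi>\<in>hcarrier H. hinner H \<eta> \<xi> = \<Phi> (S \<xi>)))"

definition operator_parallel_sum ::
    "('e::complex_banach \<Rightarrow> 'e \<Rightarrow> complex) \<Rightarrow> ('e \<Rightarrow> 'e \<Rightarrow> complex) \<Rightarrow>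
     ('e \<Rightarrow> 'e \<Rightarrow> complex)"
  where "operator_parallel_sum A B =
    (let H = hsum (hspace_of A) (hspace_of B);
         P = orth_proj H (orth_compl H (range (hadjoint H (J_sum A B) \<circ> bidual_embed)))
     in J_fst A B \<circ> P \<circ> hadjoint H (J_fst A B) \<circ> bidual_embed)"

definition assoc_op ::
    "('a::banach_star_algebra \<Rightarrow> complex) \<Rightarrow> 'a \<Rightarrow> 'a \<Rightarrow> complex"
  where "assoc_op f = (\<lambda>a b. f (star b * a))"


section \<open>Nets and approximate units\<close>

definition directed_set :: "'i set \<Rightarrow> ('i \<Rightarrow> 'i \<Rightarrow> bool) \<Rightarrow> bool"
  where "directed_set I le \<longleftrightarrow>
    I \<noteq> {} \<and>
    (\<forall>i\<in>I. le i i) \<and>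
    (\<forall>i\<in>I. \<forall>j\<in>I. \<forall>k\<in>I. le i j \<longrightarrow> le j k \<longrightarrow> le i k) \<and>
    (\<forall>i\<in>I. \<forall>j\<in>I. \<exists>k\<in>I. le i k \<and> le j k)"

text \<open>The filter of tails: convergence along it is convergence of nets indexed by \<open>I\<close>.\<close>

definition net_filter :: "'i set \<Rightarrow> ('i \<Rightarrow> 'i \<Rightarrow> bool) \<Rightarrow> 'i filter"
  where "net_filter I le = (INF i\<in>I. principal {j\<in>I. le i j})"

definition approximate_unit ::
    "'i set \<Rightarrow> ('i \<Rightarrow> 'i \<Rightarrow> bool) \<Rightarrow> ('i \<Rightarrow> 'a::banach_star_algebra) \<Rightarrow> bool"
  where "approximate_unit I le e \<longleftrightarrow>
    directed_set I le \<and>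
    (\<exists>M. \<forall>i\<in>I. norm (e i) \<le> M) \<and>
    (\<forall>a. ((\<lambda>i. e i * a) \<longlongrightarrow> a) (net_filter I le)) \<and>
    (\<forall>a. ((\<lambda>i. a * e i) \<longlongrightarrow> a) (net_filter I le))"

end

theory Submission
  imports Defs
begin

text \<open>Write \<open>q a = \<parallel>\<pi>\<^sub>f(a) \<zeta>\<^sub>f\<parallel> = f(a\<^sup>*a)\<^sup>1\<^sup>/\<^sup>2\<close>. The operators \<open>A\<close>, \<open>B\<close> and the GNS triples realize the
  same sesquilinear forms, \<open>(\<pi>\<^sub>f(a) \<zeta>\<^sub>f | \<pi>\<^sub>f(b) \<zeta>\<^sub>f) = \<langle>A a, b\<rangle>\<close>, so that
  \<open>\<langle>(A:B) x, y\<rangle> = (Q \<pi>(x) \<xi> | \<pi>(y) \<xi>)\<close> with \<open>\<xi> = \<zeta>\<^sub>f \<oplus> 0\<close>. As \<open>Q\<close> commutes with \<open>\<pi> = \<pi>\<^sub>f \<oplus> \<pi>\<^sub>g\<close>, the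
  difference of the two functionals at \<open>a\<close> is \<open>(Q \<pi>(a) \<xi> | \<pi>(e\<^sub>i) \<xi> - \<xi>)\<close>, of modulus at most
  \<open>q a \<parallel>\<pi>\<^sub>f(e\<^sub>i) \<zeta>\<^sub>f - \<zeta>\<^sub>f\<parallel>\<close>.

  The main work is automatic continuity, since the involution may be discontinuous: Ford's square
  root lemma gives \<open>q (a x)\<^sup>2 \<le> \<parallel>a\<^sup>*a\<parallel> q(x)\<^sup>2\<close>, a gliding hump argument turns this into
  \<open>q (a x) \<le> K \<parallel>a\<parallel> q(x)\<close>, and Cohen factorization then yields that \<open>q\<close> and \<open>f\<close> are bounded.\<close>

text \<open>With a discontinuous involution, \<open>star (e i)\<close> may be unbounded, and so may
  \<open>star (e i) * e i\<close>; an estimate by the norm of \<open>star a * a\<close> then says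
  nothing uniform about \<pi>(e i). Strong convergence of \<pi>(e i) \<zeta> to \<zeta> requires a
  bound on \<pi>(e i) that is linear in the norm of e i, and this is the purpose of automatic
  continuity. Continuity of f itself has another purpose: there is no unit that could serve as
  cyclic vector, so the vector is the functional b -> f (star b), and it lies in the GNS space only
  if it is bounded for q. Cohen's theorem accordingly occurs twice, with common right factors to
  bound q and, in the opposite algebra, with common left factors to bound f.

  All Hilbert spaces constructed here are completions of semidefinite forms, realised as spaces of
  antilinear functionals, in which null vectors become 0 without forming a quotient. The projections
  in the two direct sums are compared through one approximating sequence, common to both, which
  depends only on the form.\<close>

instance complex_banach \<subseteq> banach ..

lemma null_comparison:
  assumes "\<And>i. norm (h i) \<le> k i" and "(k \<longlongrightarrow> 0) F"
  shows "(h \<longlongrightarrow> 0) F"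
  using Lim_null_comparison[OF always_eventually assms(2)] assms(1) by blast

section \<open>Semi-inner products\<close>

locale semi_inner =
  fixes V :: "'v::complex_vector set" and ip :: "'v \<Rightarrow> 'v \<Rightarrow> complex"
  assumes subspace: "complex_vector.subspace V"
    and ip_add_left: "\<lbrakk>x \<in> V; y \<in> V; z \<in> V\<rbrakk> \<Longrightarrow> ip (x + y) z = ip x z + ip y z"
    and ip_scale_left: "\<lbrakk>x \<in> V; y \<in> V\<rbrakk> \<Longrightarrow> ip (c *\<^sub>C x) y = c * ip x y"
    and ip_commute: "\<lbrakk>x \<in> V; y \<in> V\<rbrakk> \<Longrightarrow> ip y x = cnj (ip x y)"
    and ip_nonneg: "x \<in> V \<Longrightarrow> ip x x \<in> \<real>\<^sub>\<ge>\<^sub>0"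
begin

definition snorm :: "'v \<Rightarrow> real"
  where "snorm x = sqrt (Re (ip x x))"

lemma zero_mem [simp]: "0 \<in> V"
  and add_mem [simp]: "\<lbrakk>x \<in> V; y \<in> V\<rbrakk> \<Longrightarrow> x + y \<in> V"
  and scale_mem [simp]: "x \<in> V \<Longrightarrow> c *\<^sub>C x \<in> V"
  and diff_mem [simp]: "\<lbrakk>x \<in> V; y \<in> V\<rbrakk> \<Longrightarrow> x - y \<in> V"
  using subspace by (auto intro: complex_vector.subspace_0 complex_vector.subspace_add
      complex_vector.subspace_scale complex_vector.subspace_diff)

lemma ip_add_right:
  "\<lbrakk>x \<in> V; y \<in> V; z \<in> V\<rbrakk> \<Longrightarrow> ip z (x + y) = ip z x + ip z y"
  using ip_commute[of "x + y" z] ip_commute[of x z] ip_commute[of y z]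
  by (simp add: ip_add_left)

lemma ip_scale_right: "\<lbrakk>x \<in> V; y \<in> V\<rbrakk> \<Longrightarrow> ip x (c *\<^sub>C y) = cnj c * ip x y"
  using ip_commute[of "c *\<^sub>C y" x] ip_commute[of y x] by (simp add: ip_scale_left)

lemma ip_diff_left:
  assumes "x \<in> V" "y \<in> V" "z \<in> V" shows "ip (x - y) z = ip x z - ip y z"
  using ip_add_left[of "x - y" y z] assms by simp

lemma ip_diff_right:
  assumes "x \<in> V" "y \<in> V" "z \<in> V" shows "ip z (x - y) = ip z x - ip z y"
  using ip_add_right[of "x - y" y z] assms by simp

lemma ip_zero_left [simp]: "x \<in> V \<Longrightarrow> ip 0 x = 0"
  using ip_scale_left[of 0 x 0] by simp

lemma ip_zero_right [simp]: "x \<in> V \<Longrightarrow> ip x 0 = 0"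
  using ip_scale_right[of x 0 0] by simp

lemma Re_ip_self_nonneg: "x \<in> V \<Longrightarrow> 0 \<le> Re (ip x x)"
  using ip_nonneg[of x] by (auto elim: nonneg_Reals_cases)

lemma snorm_nonneg [simp]: "x \<in> V \<Longrightarrow> 0 \<le> snorm x"
  unfolding snorm_def using Re_ip_self_nonneg by simp

lemma snorm_power2: "x \<in> V \<Longrightarrow> (snorm x)\<^sup>2 = Re (ip x x)"
  unfolding snorm_def using Re_ip_self_nonneg by simp

lemma ip_self: "x \<in> V \<Longrightarrow> ip x x = complex_of_real ((snorm x)\<^sup>2)"
  using ip_nonneg[of x] by (auto elim!: nonneg_Reals_cases simp: snorm_power2)

lemma snorm_zero [simp]: "snorm 0 = 0"
  by (simp add: snorm_def)

lemma snorm_scale: "x \<in> V \<Longrightarrow> snorm (c *\<^sub>C x) = cmod c * snorm x"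
proof -
  assume x: "x \<in> V"
  have "ip (c *\<^sub>C x) (c *\<^sub>C x) = (c * cnj c) * ip x x"
    using x by (simp add: ip_scale_left ip_scale_right)
  also have "\<dots> = complex_of_real ((cmod c)\<^sup>2 * (snorm x)\<^sup>2)"
    using x by (simp only: ip_self complex_norm_square of_real_mult)
  finally have "(snorm (c *\<^sub>C x))\<^sup>2 = (cmod c * snorm x)\<^sup>2"
    using x by (simp only: snorm_power2[of "c *\<^sub>C x", OF scale_mem[OF x]] power_mult_distrib Re_complex_of_real)
  then show ?thesis by (rule power2_eq_imp_eq) (use x in auto)
qed

lemma snorm_diff_power2:
  assumes "x \<in> V" "y \<in> V"
  shows "(snorm (x - t *\<^sub>C y))\<^sup>2 = (snorm x)\<^sup>2 - 2 * Re (cnj t * ip x y) + (cmod t)\<^sup>2 * (snorm y)\<^sup>2"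
proof -
  have "ip (x - t *\<^sub>C y) (x - t *\<^sub>C y) = ip x x - cnj t * ip x y - t * ip y x + t * cnj t * ip y y"
    using assms by (simp add: ip_diff_left ip_diff_right ip_scale_left ip_scale_right algebra_simps)
  moreover have "Re (t * ip y x) = Re (cnj t * ip x y)"
    using ip_commute[OF assms] by simp
  moreover have "t * cnj t = complex_of_real ((cmod t)\<^sup>2)"
    by (simp only: complex_norm_square)
  ultimately show ?thesis
    using assms by (simp add: snorm_power2)
qed

lemma cauchy_schwarz:
  assumes x: "x \<in> V" and y: "y \<in> V"
  shows "cmod (ip x y) \<le> snorm x * snorm y"
proof -
  let ?c = "ip x y"
  \<comment> \<open>Nonnegativity of the squared seminorm of x - s c y with c = ip x y and s real.
    Keeping s free avoids a division by \<open>snorm y\<close>, which may vanish for y \<noteq> 0;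
    in that case s can be taken so large that the inequality forces c = 0.\<close>
  have *: "2 * s * (cmod ?c)\<^sup>2 \<le> (snorm x)\<^sup>2 + s\<^sup>2 * (cmod ?c)\<^sup>2 * (snorm y)\<^sup>2" for s :: real
  proof -
    have "0 \<le> (snorm (x - (of_real s * ?c) *\<^sub>C y))\<^sup>2" by simp
    moreover have "cnj (of_real s * ?c) * ?c = of_real (s * (cmod ?c)\<^sup>2)"
      by (simp only: complex_norm_square of_real_mult complex_cnj_mult complex_cnj_complex_of_real mult_ac)
    then have "Re (cnj (of_real s * ?c) * ?c) = s * (cmod ?c)\<^sup>2" by (simp only: Re_complex_of_real)
    ultimately show ?thesis
      by (subst (asm) snorm_diff_power2[OF x y]) (simp add: norm_mult power_mult_distrib)
  qed
  show ?thesis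
  proof (cases "snorm y = 0")
    case True
    have "?c = 0"
    proof (rule ccontr)
      assume "?c \<noteq> 0"
      then have p: "0 < (cmod ?c)\<^sup>2" by simp
      have "2 * (((snorm x)\<^sup>2 + 1) / (cmod ?c)\<^sup>2) * (cmod ?c)\<^sup>2 \<le> (snorm x)\<^sup>2"
        using *[of "((snorm x)\<^sup>2 + 1) / (cmod ?c)\<^sup>2"] True by simp
      then have "2 * ((snorm x)\<^sup>2 + 1) \<le> (snorm x)\<^sup>2"
        using p by (simp add: \<open>?c \<noteq> 0\<close>)
      then have "2 * (snorm x)\<^sup>2 + 2 \<le> (snorm x)\<^sup>2" by (simp only: distrib_left mult_1_right)
      then show False using zero_le_power2[of "snorm x"] by linarith
    qed
    then show ?thesis using x y by simp
  next
    case False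
    then have p: "0 < (snorm y)\<^sup>2" by simp
    have "(cmod ?c)\<^sup>2 \<le> (snorm x)\<^sup>2 * (snorm y)\<^sup>2"
    proof -
      have "(1 / (snorm y)\<^sup>2)\<^sup>2 * (cmod ?c)\<^sup>2 * (snorm y)\<^sup>2 = (cmod ?c)\<^sup>2 / (snorm y)\<^sup>2"
        using False by (simp add: power2_eq_square)
      then have "(cmod ?c)\<^sup>2 / (snorm y)\<^sup>2 \<le> (snorm x)\<^sup>2"
        using *[of "1 / (snorm y)\<^sup>2"] by simp
      then show ?thesis using p by (simp only: pos_divide_le_eq)
    qed
    then have "(cmod ?c)\<^sup>2 \<le> (snorm x * snorm y)\<^sup>2" by (simp add: power_mult_distrib)
    then show ?thesis by (rule power2_le_imp_le) (use x y in auto)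
  qed
qed

lemma snorm_add_power2:
  assumes "x \<in> V" "y \<in> V"
  shows "(snorm (x + y))\<^sup>2 = (snorm x)\<^sup>2 + 2 * Re (ip x y) + (snorm y)\<^sup>2"
  using snorm_diff_power2[OF assms, of "-1"]
  by (simp add: complex_vector.scale_minus_left scaleC_one)

lemma snorm_triangle:
  assumes "x \<in> V" "y \<in> V"
  shows "snorm (x + y) \<le> snorm x + snorm y"
proof -
  have "Re (ip x y) \<le> snorm x * snorm y"
    using cauchy_schwarz[OF assms] complex_Re_le_cmod[of "ip x y"] by linarith
  then have "(snorm (x + y))\<^sup>2 \<le> (snorm x + snorm y)\<^sup>2"
    using snorm_add_power2[OF assms] by (simp add: power2_sum)
  moreover have "0 \<le> snorm x + snorm y" using assms by (intro add_nonneg_nonneg snorm_nonneg)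
  ultimately show ?thesis by (rule power2_le_imp_le)
qed

lemma snorm_minus: "x \<in> V \<Longrightarrow> snorm (- x) = snorm x"
  using snorm_scale[of x "-1"] by (simp add: complex_vector.scale_minus_left scaleC_one)

lemma snorm_minus_commute: "\<lbrakk>x \<in> V; y \<in> V\<rbrakk> \<Longrightarrow> snorm (x - y) = snorm (y - x)"
  using snorm_minus[of "x - y"] by simp

lemma snorm_triangle_diff:
  assumes "x \<in> V" "y \<in> V" "z \<in> V"
  shows "snorm (x - z) \<le> snorm (x - y) + snorm (y - z)"
  using snorm_triangle[of "x - y" "y - z"] assms by simp

lemma snorm_triangle_sub:
  assumes "x \<in> V" "y \<in> V"
  shows "snorm x \<le> snorm y + snorm (x - y)"
  using snorm_triangle[of y "x - y"] assms by simp

definition snorm_Cauchy :: "(nat \<Rightarrow> 'v) \<Rightarrow> bool"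
  where "snorm_Cauchy X \<longleftrightarrow>
    (\<forall>n. X n \<in> V) \<and> (\<forall>\<epsilon>>0. \<exists>N. \<forall>m\<ge>N. \<forall>n\<ge>N. snorm (X m - X n) < \<epsilon>)"

text \<open>The sequence minimizes \<open>\<parallel>a\<parallel>\<^sup>2 - 2 Re (\<phi> a)\<close>; the parallelogram law makes it Cauchy.\<close>

lemma riesz:
  assumes add: "\<And>x y. \<lbrakk>x \<in> V; y \<in> V\<rbrakk> \<Longrightarrow> \<phi> (x + y) = \<phi> x + \<phi> y"
    and scale: "\<And>c x. x \<in> V \<Longrightarrow> \<phi> (c *\<^sub>C x) = cnj c * \<phi> x"
    and bound: "\<And>x. x \<in> V \<Longrightarrow> cmod (\<phi> x) \<le> C * snorm x"
  obtains a where "snorm_Cauchy a" "\<And>b. b \<in> V \<Longrightarrow> (\<lambda>n. ip (a n) b) \<longlonglongrightarrow> \<phi> b"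
proof -
  define J where "J x = (snorm x)\<^sup>2 - 2 * Re (\<phi> x)" for x
  have J_ge: "- C\<^sup>2 \<le> J x" if "x \<in> V" for x
  proof -
    have "Re (\<phi> x) \<le> C * snorm x"
      using bound[OF that] complex_Re_le_cmod[of "\<phi> x"] by linarith
    moreover have "0 \<le> (snorm x - C)\<^sup>2" by simp
    ultimately show ?thesis by (simp add: J_def power2_diff algebra_simps)
  qed
  define m where "m = (INF x\<in>V. J x)"
  have bdd: "bdd_below (J ` V)" using J_ge by (auto intro!: bdd_belowI2)
  have m_le: "m \<le> J x" if "x \<in> V" for x
    unfolding m_def using bdd that by (rule cINF_lower)
  have "\<exists>x\<in>V. J x < m + inverse (real (Suc n))" for n
  proof -
    have "(INF x\<in>V. J x) < m + inverse (real (Suc n))" unfolding m_def by simp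
    then show ?thesis using cINF_less_iff[OF _ bdd] zero_mem by blast
  qed
  then obtain a where aV: "\<And>n. a n \<in> V" and a: "\<And>n. J (a n) < m + inverse (real (Suc n))"
    by metis
  have J_diff: "J (x - t *\<^sub>C y) = J x - 2 * Re (cnj t * (ip x y - \<phi> y)) + (cmod t)\<^sup>2 * (snorm y)\<^sup>2"
    if "x \<in> V" "y \<in> V" for x y t
  proof -
    have "\<phi> x = \<phi> (x - t *\<^sub>C y) + cnj t * \<phi> y"
      using add[of "x - t *\<^sub>C y" "t *\<^sub>C y"] scale[of y t] that by simp
    then have eq: "\<phi> (x - t *\<^sub>C y) = \<phi> x - cnj t * \<phi> y" by (rule eq_diff_eq[THEN iffD2, OF sym])
    show ?thesis unfolding J_def snorm_diff_power2[OF that] eq by (simp add: algebra_simps)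
  qed
  have close: "(cmod (ip (a n) b - \<phi> b))\<^sup>2 \<le> (1 + (snorm b)\<^sup>2) * inverse (real (Suc n))"
    if b: "b \<in> V" for n b
  proof -
    let ?w = "ip (a n) b - \<phi> b" and ?B = "1 + (snorm b)\<^sup>2"
    \<comment> \<open>A descent step: moving from a n along - t b lowers J by at least |w|^2 / (1 +
      |b|^2), so near-minimality makes w small. The summand 1 keeps the denominator positive on null
      vectors b.\<close>
    define t where "t = ?w / of_real ?B"
    have B: "?B > 0" by (smt (verit) zero_le_power2)
    have cn: "cmod (complex_of_real ?B) = ?B" using B by (simp only: norm_of_real abs_of_pos)
    have "cnj t * ?w = of_real ((cmod ?w)\<^sup>2) / of_real ?B"
      by (simp only: t_def complex_norm_square complex_cnj_divide complex_cnj_complex_of_real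
          times_divide_eq_left times_divide_eq_right mult.commute)
    then have 1: "Re (cnj t * ?w) = (cmod ?w)\<^sup>2 / ?B"
      by (simp only: of_real_divide[symmetric] Re_complex_of_real)
    have 2: "(cmod t)\<^sup>2 = (cmod ?w)\<^sup>2 / ?B\<^sup>2"
      unfolding t_def norm_divide cn by (simp add: power_divide)
    have "m \<le> J (a n - t *\<^sub>C b)" using aV b by (intro m_le) auto
    also have "\<dots> = J (a n) - 2 * ((cmod ?w)\<^sup>2 / ?B) + (cmod ?w)\<^sup>2 / ?B\<^sup>2 * (snorm b)\<^sup>2"
      using J_diff[OF aV b, of n t] 1 2 by simp
    also have "(cmod ?w)\<^sup>2 / ?B\<^sup>2 * (snorm b)\<^sup>2 \<le> (cmod ?w)\<^sup>2 / ?B\<^sup>2 * ?B"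
      by (intro mult_left_mono) auto
    also have "\<dots> = (cmod ?w)\<^sup>2 / ?B" using B by (simp add: power2_eq_square)
    finally have "(cmod ?w)\<^sup>2 / ?B \<le> inverse (real (Suc n))" using a[of n] by linarith
    then show ?thesis using B by (simp add: pos_divide_le_eq mult.commute)
  qed
  have Cau: "(snorm (a i - a j))\<^sup>2 \<le> 2 * (inverse (real (Suc i)) + inverse (real (Suc j)))" for i j
  proof -
    let ?d = "a i - a j"
    have d: "?d \<in> V" using aV by simp
    \<comment> \<open>Both sides are the midpoint of a i and a j. Expanding J there from both ends
      and adding gives |d|^2 / 2 = J (a i) + J (a j) - 2 J (midpoint), and J (midpoint) is at least
      m.\<close>
    have e1: "a i - (1/2) *\<^sub>C ?d = a j - (- (1/2)) *\<^sub>C ?d"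
    proof -
      have "a j - (- (1/2)) *\<^sub>C ?d = a j + (1/2) *\<^sub>C ?d"
        by (simp add: complex_vector.scale_minus_left)
      also have "\<dots> = a j + ((1/2) *\<^sub>C ?d + (1/2) *\<^sub>C ?d) - (1/2) *\<^sub>C ?d"
        by (simp only: add_diff_cancel_right' add.assoc[symmetric])
      also have "(1/2) *\<^sub>C ?d + (1/2) *\<^sub>C ?d = ?d"
        using scaleC_add_left[of "1/2" "1/2" ?d] by (simp add: scaleC_one)
      finally show ?thesis by simp
    qed
    have h: "(cmod (1/2))\<^sup>2 = 1/4" "(cmod (- (1/2)))\<^sup>2 = 1/4"
      by (auto simp add: power2_eq_square norm_divide)
    have A: "J (a i - (1/2) *\<^sub>C ?d) = J (a i) - Re (ip (a i) ?d - \<phi> ?d) + (snorm ?d)\<^sup>2 / 4"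
      using J_diff[OF aV d, of i "1/2"] unfolding h by (simp add: field_simps)
    have B: "J (a i - (1/2) *\<^sub>C ?d) = J (a j) + Re (ip (a j) ?d - \<phi> ?d) + (snorm ?d)\<^sup>2 / 4"
      using J_diff[OF aV d, of j "- (1/2)"] unfolding h e1 by (simp add: field_simps)
    have "(snorm ?d)\<^sup>2 = Re (ip (a i) ?d) - Re (ip (a j) ?d)"
      using d aV by (simp add: snorm_power2 ip_diff_left)
    then have "(snorm ?d)\<^sup>2 / 2 = J (a i) + J (a j) - 2 * J (a i - (1/2) *\<^sub>C ?d)"
      using A B by (simp add: field_simps)
    moreover have "m \<le> J (a i - (1/2) *\<^sub>C ?d)" using aV d by (intro m_le) auto
    moreover have "s \<le> 2 * (p + q)"
      if "s / 2 = A + B - 2 * C" "m \<le> C" "A < m + p" "B < m + q" for s A B C p q :: real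
      using that by argo
    ultimately show ?thesis using a[of i] a[of j] by blast
  qed
  show thesis
  proof
    show "snorm_Cauchy a"
      unfolding snorm_Cauchy_def
    proof (intro conjI allI impI)
      fix \<epsilon> :: real assume e: "0 < \<epsilon>"
      obtain N where N: "inverse (real (Suc N)) < \<epsilon>\<^sup>2 / 4"
        using reals_Archimedean[of "\<epsilon>\<^sup>2 / 4"] e by auto
      have "snorm (a i - a j) < \<epsilon>" if "N \<le> i" "N \<le> j" for i j
      proof -
        have "inverse (real (Suc i)) \<le> inverse (real (Suc N))" "inverse (real (Suc j)) \<le> inverse (real (Suc N))"
          using that by (auto intro!: le_imp_inverse_le)
        then have "(snorm (a i - a j))\<^sup>2 < \<epsilon>\<^sup>2" using Cau[of i j] N by argo
        then show ?thesis by (rule power2_less_imp_less) (use e in auto)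
      qed
      then show "\<exists>N. \<forall>m\<ge>N. \<forall>n\<ge>N. snorm (a m - a n) < \<epsilon>" by blast
    qed (use aV in auto)
    fix b assume b: "b \<in> V"
    have "(\<lambda>n. (1 + (snorm b)\<^sup>2) * inverse (real (Suc n))) \<longlonglongrightarrow> (1 + (snorm b)\<^sup>2) * 0"
      by (intro tendsto_mult tendsto_const LIMSEQ_inverse_real_of_nat)
    then have lim0: "(\<lambda>n. (1 + (snorm b)\<^sup>2) * inverse (real (Suc n))) \<longlonglongrightarrow> 0" by (simp only: mult_zero_right)
    have "(\<lambda>n. (cmod (ip (a n) b - \<phi> b))\<^sup>2) \<longlonglongrightarrow> 0"
      by (rule null_comparison[OF _ lim0]) (use close[OF b] in \<open>simp only: real_norm_def abs_power2\<close>)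
    then have "(\<lambda>n. sqrt ((cmod (ip (a n) b - \<phi> b))\<^sup>2)) \<longlonglongrightarrow> sqrt 0"
      by (rule tendsto_real_sqrt)
    then have "(\<lambda>n. ip (a n) b - \<phi> b) \<longlonglongrightarrow> 0" by (simp add: tendsto_norm_zero_iff)
    then show "(\<lambda>n. ip (a n) b) \<longlonglongrightarrow> \<phi> b" by (rule LIM_zero_cancel)
  qed
qed

section \<open>Cauchy sequences for the seminorm\<close>

lemma snorm_Cauchy_bounded:
  assumes "snorm_Cauchy X"
  obtains M where "0 \<le> M" "\<And>n. snorm (X n) \<le> M"
proof -
  have XV: "\<And>n. X n \<in> V" using assms by (simp add: snorm_Cauchy_def)
  obtain N where N: "\<And>m n. N \<le> m \<Longrightarrow> N \<le> n \<Longrightarrow> snorm (X m - X n) < 1"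
    using assms unfolding snorm_Cauchy_def by (meson zero_less_one)
  define M where "M = Max (insert 1 ((\<lambda>n. snorm (X n)) ` {..N})) + 1"
  have "1 \<le> Max (insert 1 ((\<lambda>n. snorm (X n)) ` {..N}))" by (intro Max_ge) auto
  then have "0 \<le> M" by (simp add: M_def)
  moreover have "snorm (X n) \<le> M" for n
  proof (cases "n \<le> N")
    case True
    then have "snorm (X n) \<le> Max (insert 1 ((\<lambda>n. snorm (X n)) ` {..N}))" by (intro Max_ge) auto
    then show ?thesis by (simp add: M_def)
  next
    case False
    have "snorm (X n) \<le> snorm (X N) + snorm (X n - X N)" using XV by (intro snorm_triangle_sub)
    moreover have "snorm (X N) \<le> Max (insert 1 ((\<lambda>n. snorm (X n)) ` {..N}))" by (intro Max_ge) auto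
    ultimately show ?thesis using N[of n N] False by (simp add: M_def)
  qed
  ultimately show thesis using that by blast
qed

lemma snorm_Cauchy_ip_convergent:
  assumes X: "snorm_Cauchy X" and Y: "snorm_Cauchy Y"
  shows "convergent (\<lambda>n. ip (X n) (Y n))"
proof -
  have XV: "\<And>n. X n \<in> V" and YV: "\<And>n. Y n \<in> V" using X Y by (auto simp: snorm_Cauchy_def)
  obtain M where M: "0 \<le> M" "\<And>n. snorm (X n) \<le> M" using snorm_Cauchy_bounded[OF X] by metis
  obtain L where L: "0 \<le> L" "\<And>n. snorm (Y n) \<le> L" using snorm_Cauchy_bounded[OF Y] by metis
  have "Cauchy (\<lambda>n. ip (X n) (Y n))"
  proof (rule metric_CauchyI)
    fix e :: real assume e: "0 < e"
    define d where "d = e / (M + L + 1)"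
    have d: "0 < d" and dM: "d * (M + L) < e" using e M(1) L(1) by (auto simp: d_def field_simps)
    obtain N1 where N1: "\<And>m n. N1 \<le> m \<Longrightarrow> N1 \<le> n \<Longrightarrow> snorm (X m - X n) < d"
      using X d unfolding snorm_Cauchy_def by meson
    obtain N2 where N2: "\<And>m n. N2 \<le> m \<Longrightarrow> N2 \<le> n \<Longrightarrow> snorm (Y m - Y n) < d"
      using Y d unfolding snorm_Cauchy_def by meson
    have "dist (ip (X m) (Y m)) (ip (X n) (Y n)) < e" if "max N1 N2 \<le> m" "max N1 N2 \<le> n" for m n
    proof -
      have "ip (X m) (Y m) - ip (X n) (Y n) = ip (X m - X n) (Y m) + ip (X n) (Y m - Y n)"
        using XV YV by (simp add: ip_diff_left ip_diff_right)
      then have "dist (ip (X m) (Y m)) (ip (X n) (Y n))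
          \<le> cmod (ip (X m - X n) (Y m)) + cmod (ip (X n) (Y m - Y n))"
        by (simp add: dist_norm norm_triangle_ineq)
      also have "\<dots> \<le> snorm (X m - X n) * snorm (Y m) + snorm (X n) * snorm (Y m - Y n)"
        using XV YV by (intro add_mono cauchy_schwarz) auto
      also have "\<dots> \<le> d * L + M * d"
        using N1[of m n] N2[of m n] that M L XV YV d
        by (intro add_mono mult_mono) (auto simp: less_imp_le)
      also have "\<dots> < e" using dM by (simp add: algebra_simps)
      finally show ?thesis .
    qed
    then show "\<exists>N. \<forall>m\<ge>N. \<forall>n\<ge>N. dist (ip (X m) (Y m)) (ip (X n) (Y n)) < e" by blast
  qed
  then show ?thesis by (simp add: Cauchy_convergent_iff)
qed

text \<open>Split (X n | X n) as (X n | X n - X N) + (X n | X N): the first term is small by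
  boundedness and the Cauchy property, the second by weak convergence with N fixed. Hence a Cauchy
  sequence is determined up to null sequences by the functional it induces, which allows the
  completion to be a space of functionals.\<close>

lemma snorm_Cauchy_weak_null:
  assumes X: "snorm_Cauchy X" and weak: "\<And>b. b \<in> V \<Longrightarrow> (\<lambda>n. ip (X n) b) \<longlonglongrightarrow> 0"
  shows "(\<lambda>n. snorm (X n)) \<longlonglongrightarrow> 0"
proof (rule LIMSEQ_I)
  fix e :: real assume e: "0 < e"
  have XV: "\<And>n. X n \<in> V" using X by (auto simp: snorm_Cauchy_def)
  obtain M where M: "0 \<le> M" "\<And>n. snorm (X n) \<le> M" using snorm_Cauchy_bounded[OF X] by metis
  define d where "d = e\<^sup>2 / (2 * (M + 1))"
  have d: "0 < d" and dM: "d * M \<le> e\<^sup>2 / 2" using e M(1) by (auto simp: d_def field_simps)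
  obtain N1 where N1: "\<And>m n. N1 \<le> m \<Longrightarrow> N1 \<le> n \<Longrightarrow> snorm (X m - X n) < d"
    using X d unfolding snorm_Cauchy_def by meson
  obtain N2 where N2: "\<And>n. N2 \<le> n \<Longrightarrow> cmod (ip (X n) (X N1)) < e\<^sup>2 / 2"
    using LIMSEQ_D[OF weak[OF XV, of N1], of "e\<^sup>2 / 2"] e by auto
  have "norm (snorm (X n) - 0) < e" if n: "max N1 N2 \<le> n" for n
  proof -
    have "(snorm (X n))\<^sup>2 = Re (ip (X n) (X n - X N1)) + Re (ip (X n) (X N1))"
      using XV by (simp add: snorm_power2 ip_diff_right)
    also have "\<dots> \<le> snorm (X n) * snorm (X n - X N1) + cmod (ip (X n) (X N1))"
      using cauchy_schwarz[OF XV diff_mem[OF XV XV], of n n N1]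
        complex_Re_le_cmod[of "ip (X n) (X n - X N1)"] complex_Re_le_cmod[of "ip (X n) (X N1)"]
      by linarith
    also have "snorm (X n) * snorm (X n - X N1) \<le> M * d"
      using M N1[of n N1] n XV by (intro mult_mono) (auto simp: less_imp_le)
    finally have "(snorm (X n))\<^sup>2 < e\<^sup>2" using dM N2[of n] n by (simp add: mult.commute)
    then show ?thesis using e XV by (simp add: power2_less_imp_less)
  qed
  then show "\<exists>N. \<forall>n\<ge>N. norm (snorm (X n) - 0) < e" by blast
qed

lemma snorm_tendsto_ip:
  assumes XV: "\<And>n. X n \<in> V" and x: "x \<in> V" and lim: "(\<lambda>n. snorm (X n - x)) \<longlonglongrightarrow> 0" and y: "y \<in> V"
  shows "(\<lambda>n. ip (X n) y) \<longlonglongrightarrow> ip x y"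
proof -
  have "(\<lambda>n. snorm (X n - x) * snorm y) \<longlonglongrightarrow> 0 * snorm y"
    by (intro tendsto_mult lim tendsto_const)
  then have lim0: "(\<lambda>n. snorm (X n - x) * snorm y) \<longlonglongrightarrow> 0" by simp
  have "norm (ip (X n) y - ip x y) \<le> snorm (X n - x) * snorm y" for n
    using cauchy_schwarz[of "X n - x" y] ip_diff_left[OF XV x y] XV x y by simp
  then have "(\<lambda>n. ip (X n) y - ip x y) \<longlonglongrightarrow> 0" by (rule null_comparison[OF _ lim0])
  then show ?thesis by (rule LIM_zero_cancel)
qed

end

text \<open>Hermitian symmetry comes from polarization: the imaginary parts of D at (x + y, x + y)
  and at (x + \<i> y, x + \<i> y) vanish, which yields the imaginary and the real part of D y x =
  cnj (D x y).\<close>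

lemma positive_sesquilinear_semi_inner:
  fixes D :: "'e::complex_vector \<Rightarrow> 'e \<Rightarrow> complex"
  assumes add_left: "\<And>x y z. D (x + y) z = D x z + D y z"
    and add_right: "\<And>x y z. D z (x + y) = D z x + D z y"
    and scale_left: "\<And>c x y. D (c *\<^sub>C x) y = c * D x y"
    and scale_right: "\<And>c x y. D x (c *\<^sub>C y) = cnj c * D x y"
    and nonneg: "\<And>x. D x x \<in> \<real>\<^sub>\<ge>\<^sub>0"
  shows "semi_inner UNIV D"
proof
  show "D y x = cnj (D x y)" for x y
  proof -
    have Im0: "Im (D z z) = 0" for z using nonneg[of z] by (auto elim: nonneg_Reals_cases)
    have "Im (D (x + y) (x + y)) = Im (D x y) + Im (D y x)" by (simp add: add_left add_right Im0)
    moreover have "Im (D (x + \<i> *\<^sub>C y) (x + \<i> *\<^sub>C y)) = Re (D y x) - Re (D x y)"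
      by (simp add: add_left add_right scale_left scale_right Im0)
    ultimately show ?thesis by (simp add: Im0 complex_eq_iff)
  qed
qed (use assms in auto)

lemma hilbert_space_semi_inner:
  assumes "hilbert_space H"
  shows "semi_inner (hcarrier H) (hinner H)"
proof -
  note H1 = assms[unfolded hilbert_space_def, THEN conjunct1]
    and H' = assms[unfolded hilbert_space_def, THEN conjunct2]
  note H2 = H'[THEN conjunct1, rule_format] and H'' = H'[THEN conjunct2]
  note H3 = H''[THEN conjunct1, rule_format] and H4 = H''[THEN conjunct2, THEN conjunct1, rule_format]
    and H5 = H''[THEN conjunct2, THEN conjunct2, THEN conjunct1, rule_format]
  show ?thesis by (rule semi_inner.intro) (fact H1 H2 H3 H4 H5)+
qed

lemma hnorm_eq_snorm:
  assumes "hilbert_space H"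
  shows "hnorm H = semi_inner.snorm (hinner H)"
  using semi_inner.snorm_def[OF hilbert_space_semi_inner[OF assms]] by (auto simp: hnorm_def)

lemma hilbert_space_definite:
  assumes "hilbert_space H" "x \<in> hcarrier H" "hnorm H x = 0"
  shows "x = 0"
proof -
  interpret semi_inner "hcarrier H" "hinner H" using assms by (simp add: hilbert_space_semi_inner)
  have "hinner H x x = 0" using assms ip_self[of x] hnorm_eq_snorm[OF assms(1)] by simp
  then show ?thesis using assms unfolding hilbert_space_def by blast
qed

lemma hilbert_space_complete:
  assumes H: "hilbert_space H" and "semi_inner.snorm_Cauchy (hcarrier H) (hinner H) X"
  obtains x where "x \<in> hcarrier H" "(\<lambda>n. hnorm H (X n - x)) \<longlonglongrightarrow> 0"
proof -
  interpret semi_inner "hcarrier H" "hinner H" using assms by (simp add: hilbert_space_semi_inner)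
  have "(\<forall>n. X n \<in> hcarrier H) \<and>
         (\<forall>\<epsilon>>0. \<exists>N. \<forall>m\<ge>N. \<forall>n\<ge>N. hnorm H (X m - X n) < \<epsilon>)"
    using assms(2) unfolding snorm_Cauchy_def hnorm_eq_snorm[OF H] by blast
  then have "\<exists>x\<in>hcarrier H. (\<lambda>n. hnorm H (X n - x)) \<longlonglongrightarrow> 0"
    using H unfolding hilbert_space_def by blast
  then show thesis using that by blast
qed

lemma hilbert_space_eqI:
  assumes "hilbert_space H" "x \<in> hcarrier H" "y \<in> hcarrier H"
    and "\<And>z. z \<in> hcarrier H \<Longrightarrow> hinner H x z = hinner H y z"
  shows "x = y"
proof -
  interpret semi_inner "hcarrier H" "hinner H" using assms by (simp add: hilbert_space_semi_inner)
  have "hinner H (x - y) (x - y) = 0" using assms by (simp add: ip_diff_left)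
  then have "x - y = 0" using assms diff_mem unfolding hilbert_space_def by blast
  then show ?thesis by simp
qed

section \<open>Completion of a semi-inner product space\<close>

locale semi_inner_space = semi_inner UNIV ip
  for ip :: "'v::complex_vector \<Rightarrow> 'v \<Rightarrow> complex"
begin

definition represents :: "(nat \<Rightarrow> 'v) \<Rightarrow> ('v \<Rightarrow> complex) \<Rightarrow> bool"
  where "represents a \<phi> \<longleftrightarrow> snorm_Cauchy a \<and> (\<forall>b. (\<lambda>n. ip (a n) b) \<longlonglongrightarrow> \<phi> b)"

text \<open>A point is the functional b -> lim ip (a n) b of a Cauchy sequence instead of a class of
  sequences. Thus x becomes \<open>ip x\<close>, and for ip = A the range of A lies in the
  completion literally. The inner product uses arbitrary representatives;
  \<open>represents_inner\<close> removes the choice.\<close>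

definition completion :: "('v \<Rightarrow> complex) hspace"
  where "completion =
    \<lparr> hcarrier = {\<phi>. \<exists>a. represents a \<phi>},
      hinner = (\<lambda>\<phi> \<psi>. lim (\<lambda>n. ip ((SOME a. represents a \<phi>) n) ((SOME b. represents b \<psi>) n))) \<rparr>"

lemma mem_completion_iff: "\<phi> \<in> hcarrier completion \<longleftrightarrow> (\<exists>a. represents a \<phi>)"
  by (simp add: completion_def)

lemma snorm_Cauchy_add:
  assumes "snorm_Cauchy a" "snorm_Cauchy b"
  shows "snorm_Cauchy (\<lambda>n. a n + b n)"
  unfolding snorm_Cauchy_def
proof (intro conjI allI impI)
  fix \<epsilon> :: real assume "0 < \<epsilon>"
  then have e: "0 < \<epsilon> / 2" by simp
  obtain N1 where N1: "\<And>m n. N1 \<le> m \<Longrightarrow> N1 \<le> n \<Longrightarrow> snorm (a m - a n) < \<epsilon> / 2"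
    using assms(1) e unfolding snorm_Cauchy_def by meson
  obtain N2 where N2: "\<And>m n. N2 \<le> m \<Longrightarrow> N2 \<le> n \<Longrightarrow> snorm (b m - b n) < \<epsilon> / 2"
    using assms(2) e unfolding snorm_Cauchy_def by meson
  have "snorm ((a m + b m) - (a n + b n)) < \<epsilon>" if "max N1 N2 \<le> m" "max N1 N2 \<le> n" for m n
  proof -
    have "(a m + b m) - (a n + b n) = (a m - a n) + (b m - b n)" by simp
    then have "snorm ((a m + b m) - (a n + b n)) \<le> snorm (a m - a n) + snorm (b m - b n)"
      by (metis snorm_triangle UNIV_I)
    then show ?thesis using N1[of m n] N2[of m n] that by simp
  qed
  then show "\<exists>N. \<forall>m\<ge>N. \<forall>n\<ge>N. snorm ((a m + b m) - (a n + b n)) < \<epsilon>" by blast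
qed simp

lemma snorm_Cauchy_map:
  assumes "snorm_Cauchy a" and diff: "\<And>x y. T (x - y) = T x - T y"
    and bound: "\<And>x. snorm (T x) \<le> C * snorm x"
  shows "snorm_Cauchy (\<lambda>n. T (a n))"
  unfolding snorm_Cauchy_def
proof (intro conjI allI impI)
  fix \<epsilon> :: real assume \<epsilon>: "0 < \<epsilon>"
  have C: "0 < \<bar>C\<bar> + 1" by simp
  obtain N where N: "\<And>m n. N \<le> m \<Longrightarrow> N \<le> n \<Longrightarrow> snorm (a m - a n) < \<epsilon> / (\<bar>C\<bar> + 1)"
    using assms(1) divide_pos_pos[OF \<epsilon> C] unfolding snorm_Cauchy_def by meson
  have "snorm (T (a m) - T (a n)) < \<epsilon>" if "N \<le> m" "N \<le> n" for m n
  proof -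
    have "snorm (T (a m) - T (a n)) \<le> C * snorm (a m - a n)" using bound[of "a m - a n"] by (simp add: diff)
    also have "\<dots> \<le> (\<bar>C\<bar> + 1) * snorm (a m - a n)" by (intro mult_right_mono) auto
    also have "\<dots> < \<epsilon>" using N[OF that] C by (simp add: pos_less_divide_eq mult.commute)
    finally show ?thesis .
  qed
  then show "\<exists>N. \<forall>m\<ge>N. \<forall>n\<ge>N. snorm (T (a m) - T (a n)) < \<epsilon>" by blast
qed simp

lemma represents_add:
  "\<lbrakk>represents a \<phi>; represents b \<psi>\<rbrakk> \<Longrightarrow> represents (\<lambda>n. a n + b n) (\<phi> + \<psi>)"
  by (auto simp: represents_def snorm_Cauchy_add ip_add_left intro!: tendsto_add)

lemma represents_scale: "represents a \<phi> \<Longrightarrow> represents (\<lambda>n. c *\<^sub>C a n) (c *\<^sub>C \<phi>)"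
  using snorm_Cauchy_map[of a "(*\<^sub>C) c" "cmod c"]
  by (simp add: represents_def ip_scale_left scaleC_fun_def scaleC_complex_def tendsto_mult_left
      complex_vector.scale_right_diff_distrib snorm_scale)

lemma represents_diff:
  assumes "represents a \<phi>" "represents b \<psi>"
  shows "represents (\<lambda>n. a n - b n) (\<phi> - \<psi>)"
  using represents_add[OF assms(1) represents_scale[OF assms(2), of "-1"]]
  by (simp add: complex_vector.scale_minus_left scaleC_one)

lemma represents_const: "represents (\<lambda>_. x) (ip x)"
  by (auto simp: represents_def snorm_Cauchy_def)

lemma represents_Cauchy: "represents a \<phi> \<Longrightarrow> snorm_Cauchy a"
  by (simp add: represents_def)

lemma represents_zero_snorm:
  "represents a 0 \<Longrightarrow> (\<lambda>n. snorm (a n)) \<longlonglongrightarrow> 0"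
  by (rule snorm_Cauchy_weak_null) (simp_all add: represents_def)

text \<open>Two sequences with the same functional differ by a sequence with functional 0, which is
  null in the seminorm by \<open>snorm_Cauchy_weak_null\<close>; so their inner products have the
  same limit.\<close>

lemma represents_inner:
  assumes a: "represents a \<phi>" and b: "represents b \<psi>"
  shows "(\<lambda>n. ip (a n) (b n)) \<longlonglongrightarrow> hinner completion \<phi> \<psi>"
proof -
  define a' b' where "a' = (SOME a. represents a \<phi>)" and "b' = (SOME b. represents b \<psi>)"
  have a': "represents a' \<phi>" unfolding a'_def by (rule someI[of "\<lambda>a. represents a \<phi>", OF a])
  have b': "represents b' \<psi>" unfolding b'_def by (rule someI[of "\<lambda>a. represents a \<psi>", OF b])
  have lim: "(\<lambda>n. ip (a' n) (b' n)) \<longlonglongrightarrow> hinner completion \<phi> \<psi>"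
    using snorm_Cauchy_ip_convergent[OF represents_Cauchy[OF a'] represents_Cauchy[OF b']]
    by (simp add: completion_def a'_def b'_def convergent_LIMSEQ_iff)
  obtain B where B: "0 \<le> B" "\<And>n. snorm (b n) \<le> B"
    using snorm_Cauchy_bounded[OF represents_Cauchy[OF b]] by metis
  obtain A where A: "0 \<le> A" "\<And>n. snorm (a' n) \<le> A"
    using snorm_Cauchy_bounded[OF represents_Cauchy[OF a']] by metis
  have 1: "(\<lambda>n. snorm (a n - a' n)) \<longlonglongrightarrow> 0" and 2: "(\<lambda>n. snorm (b n - b' n)) \<longlonglongrightarrow> 0"
    using represents_diff[OF a a'] represents_diff[OF b b'] by (simp_all add: represents_zero_snorm)
  have lim0: "(\<lambda>n. snorm (a n - a' n) * B + A * snorm (b n - b' n)) \<longlonglongrightarrow> 0"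
    using tendsto_add[OF tendsto_mult[OF 1 tendsto_const[of B]] tendsto_mult[OF tendsto_const[of A] 2]]
    by simp
  have "norm (ip (a n) (b n) - ip (a' n) (b' n)) \<le> snorm (a n - a' n) * B + A * snorm (b n - b' n)" for n
  proof -
    have "ip (a n) (b n) - ip (a' n) (b' n) = ip (a n - a' n) (b n) + ip (a' n) (b n - b' n)"
      by (simp add: ip_diff_left ip_diff_right)
    then have "norm (ip (a n) (b n) - ip (a' n) (b' n))
        \<le> cmod (ip (a n - a' n) (b n)) + cmod (ip (a' n) (b n - b' n))"
      by (simp add: norm_triangle_ineq)
    also have "\<dots> \<le> snorm (a n - a' n) * snorm (b n) + snorm (a' n) * snorm (b n - b' n)"
      by (intro add_mono cauchy_schwarz) auto
    also have "\<dots> \<le> snorm (a n - a' n) * B + A * snorm (b n - b' n)"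
      using A B by (intro add_mono mult_left_mono mult_right_mono) auto
    finally show ?thesis .
  qed
  then have "(\<lambda>n. ip (a n) (b n) - ip (a' n) (b' n)) \<longlonglongrightarrow> 0" by (rule null_comparison[OF _ lim0])
  from tendsto_add[OF this lim] show ?thesis by simp
qed

lemma represents_hnorm:
  assumes "represents a \<phi>"
  shows "(\<lambda>n. snorm (a n)) \<longlonglongrightarrow> hnorm completion \<phi>"
  unfolding hnorm_def snorm_def
  by (intro tendsto_real_sqrt tendsto_Re represents_inner assms)

text \<open>The reproducing property of a space with kernel \<open>ip\<close>. Definiteness of the
  inner product and antilinearity of the elements are read off from it.\<close>

lemma completion_inner_left:
  assumes "\<phi> \<in> hcarrier completion"
  shows "hinner completion \<phi> (ip b) = \<phi> b"
proof -
  obtain a where a: "represents a \<phi>" using assms by (auto simp: mem_completion_iff)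
  have "(\<lambda>n. ip (a n) b) \<longlonglongrightarrow> hinner completion \<phi> (ip b)"
    using represents_inner[OF a represents_const] .
  moreover have "(\<lambda>n. ip (a n) b) \<longlonglongrightarrow> \<phi> b" using a by (simp add: represents_def)
  ultimately show ?thesis by (rule LIMSEQ_unique)
qed

lemma ip_mem_completion: "ip x \<in> hcarrier completion"
  using represents_const by (auto simp: mem_completion_iff)

lemma completion_semi_inner: "semi_inner (hcarrier completion) (hinner completion)"
proof
  show "complex_vector.subspace (hcarrier completion)"
  proof (rule complex_vector.subspaceI)
    have "ip 0 = 0" by (simp add: fun_eq_iff)
    then show "0 \<in> hcarrier completion"
      using represents_const[of 0] unfolding mem_completion_iff by metis
  qed (auto simp: mem_completion_iff dest: represents_add represents_scale)
next
  fix x y z assume "x \<in> hcarrier completion" "y \<in> hcarrier completion" "z \<in> hcarrier completion"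
  then obtain a b c where abc: "represents a x" "represents b y" "represents c z"
    by (auto simp: mem_completion_iff)
  have "(\<lambda>n. ip (a n + b n) (c n)) \<longlonglongrightarrow> hinner completion (x + y) z"
    using abc by (intro represents_inner represents_add)
  moreover have "(\<lambda>n. ip (a n + b n) (c n)) \<longlonglongrightarrow> hinner completion x z + hinner completion y z"
    using abc by (simp add: ip_add_left tendsto_add represents_inner)
  ultimately show "hinner completion (x + y) z = hinner completion x z + hinner completion y z"
    by (rule LIMSEQ_unique)
next
  fix c x y assume "x \<in> hcarrier completion" "y \<in> hcarrier completion"
  then obtain a b where ab: "represents a x" "represents b y" by (auto simp: mem_completion_iff)
  have "(\<lambda>n. ip (c *\<^sub>C a n) (b n)) \<longlonglongrightarrow> hinner completion (c *\<^sub>C x) y"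
    using ab by (intro represents_inner represents_scale)
  moreover have "(\<lambda>n. ip (c *\<^sub>C a n) (b n)) \<longlonglongrightarrow> c * hinner completion x y"
    using ab by (simp add: ip_scale_left tendsto_mult_left represents_inner)
  ultimately show "hinner completion (c *\<^sub>C x) y = c * hinner completion x y"
    by (rule LIMSEQ_unique)
next
  fix x y assume "x \<in> hcarrier completion" "y \<in> hcarrier completion"
  then obtain a b where ab: "represents a x" "represents b y" by (auto simp: mem_completion_iff)
  have "(\<lambda>n. ip (b n) (a n)) \<longlonglongrightarrow> hinner completion y x" using ab by (intro represents_inner)
  moreover have "(\<lambda>n. cnj (ip (a n) (b n))) \<longlonglongrightarrow> cnj (hinner completion x y)"
    using ab by (intro tendsto_cnj represents_inner)
  then have "(\<lambda>n. ip (b n) (a n)) \<longlonglongrightarrow> cnj (hinner completion x y)"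
    by (simp flip: ip_commute)
  ultimately show "hinner completion y x = cnj (hinner completion x y)" by (rule LIMSEQ_unique)
next
  fix x assume "x \<in> hcarrier completion"
  then obtain a where a: "represents a x" by (auto simp: mem_completion_iff)
  show "hinner completion x x \<in> \<real>\<^sub>\<ge>\<^sub>0"
    by (rule closed_sequentially[OF closed_nonneg_Reals_complex _ represents_inner[OF a a]])
      (simp add: ip_nonneg)
qed

lemma completion_dense: "hdense completion (range ip)"
  unfolding hdense_def
proof (intro conjI ballI allI impI)
  show "range ip \<subseteq> hcarrier completion" using ip_mem_completion by auto
  fix \<phi> \<epsilon> assume "\<phi> \<in> hcarrier completion" and \<epsilon>: "(0::real) < \<epsilon>"
  then obtain a where a: "represents a \<phi>" by (auto simp: mem_completion_iff)
  obtain N where N: "\<And>m n. N \<le> m \<Longrightarrow> N \<le> n \<Longrightarrow> snorm (a m - a n) < \<epsilon> / 2"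
    using represents_Cauchy[OF a] \<epsilon> unfolding snorm_Cauchy_def by (meson half_gt_zero)
  have "(\<lambda>n. snorm (a n - a N)) \<longlonglongrightarrow> hnorm completion (\<phi> - ip (a N))"
    by (intro represents_hnorm represents_diff a represents_const)
  then have "hnorm completion (\<phi> - ip (a N)) \<le> \<epsilon> / 2"
    by (rule LIMSEQ_le_const2) (use N in \<open>auto intro!: exI[of _ N] less_imp_le\<close>)
  then show "\<exists>d\<in>range ip. hnorm completion (\<phi> - d) < \<epsilon>" using \<epsilon> by (intro bexI[of _ "ip (a N)"]) auto
qed

lemma completion_hilbert: "hilbert_space completion"
proof -
  interpret C: semi_inner "hcarrier completion" "hinner completion" by (rule completion_semi_inner)
  have hC: "hnorm completion x = C.snorm x" for x by (simp add: hnorm_def C.snorm_def)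
  have definite: "x = 0" if x: "x \<in> hcarrier completion" and 0: "hinner completion x x = 0" for x
  proof
    fix b
    have "C.snorm x = 0" using 0 by (simp add: C.snorm_def)
    then have "hinner completion x (ip b) = 0"
      using C.cauchy_schwarz[OF x ip_mem_completion, of b] by simp
    then show "x b = 0 b" using completion_inner_left[OF x] by simp
  qed
  have complete: "\<exists>x\<in>hcarrier completion. (\<lambda>n. hnorm completion (X n - x)) \<longlonglongrightarrow> 0"
    if X: "\<And>n::nat. X n \<in> hcarrier completion"
      and Cau: "\<And>\<epsilon>. 0 < \<epsilon> \<Longrightarrow> \<exists>N. \<forall>m\<ge>N. \<forall>n\<ge>N. hnorm completion (X m - X n) < \<epsilon>" for X
  proof -
    \<comment> \<open>Diagonal choice: X n is replaced by an embedded vector at distance less than 1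
      / (n + 1). These vectors form a Cauchy sequence in the original space, and its functional is
      the limit of X.\<close>
    have "\<exists>a. hnorm completion (X n - ip a) < inverse (real (Suc n))" for n
      using completion_dense X[of n] unfolding hdense_def
      by (metis (no_types, lifting) imageE inverse_positive_iff_positive of_nat_0_less_iff zero_less_Suc)
    then obtain a where a: "\<And>n. C.snorm (X n - ip (a n)) < inverse (real (Suc n))"
      unfolding hC by metis
    have snorm_ip: "C.snorm (ip x - ip y) = snorm (x - y)" for x y
    proof -
      have "represents (\<lambda>_. x - y) (ip x - ip y)"
        using represents_diff[OF represents_const represents_const] .
      from represents_hnorm[OF this] show ?thesis by (simp add: hC LIMSEQ_const_iff)
    qed
    have "snorm_Cauchy a"
      unfolding snorm_Cauchy_def
    proof (intro conjI allI impI)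
      fix \<epsilon> :: real assume \<epsilon>: "0 < \<epsilon>"
      obtain N1 where N1: "\<And>m n. N1 \<le> m \<Longrightarrow> N1 \<le> n \<Longrightarrow> C.snorm (X m - X n) < \<epsilon> / 3"
        using Cau[of "\<epsilon> / 3"] \<epsilon> unfolding hC by auto
      obtain N2 where N2: "inverse (real (Suc N2)) < \<epsilon> / 3"
        using reals_Archimedean[of "\<epsilon> / 3"] \<epsilon> by auto
      have small: "C.snorm (X n - ip (a n)) < \<epsilon> / 3" if "N2 \<le> n" for n
      proof -
        have "inverse (real (Suc n)) \<le> inverse (real (Suc N2))"
          using that by (intro le_imp_inverse_le) auto
        then show ?thesis using a[of n] N2 by linarith
      qed
      have "snorm (a m - a n) < \<epsilon>" if mn: "max N1 N2 \<le> m" "max N1 N2 \<le> n" for m n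
      proof -
        have "snorm (a m - a n) \<le> C.snorm (ip (a m) - X m) + C.snorm (X m - ip (a n))"
          unfolding snorm_ip[symmetric] by (intro C.snorm_triangle_diff X ip_mem_completion)
        moreover have "C.snorm (X m - ip (a n)) \<le> C.snorm (X m - X n) + C.snorm (X n - ip (a n))"
          by (intro C.snorm_triangle_diff X ip_mem_completion)
        moreover have "C.snorm (ip (a m) - X m) = C.snorm (X m - ip (a m))"
          by (intro C.snorm_minus_commute X ip_mem_completion)
        moreover have "N1 \<le> m" "N1 \<le> n" "N2 \<le> m" "N2 \<le> n" using mn by auto
        ultimately show ?thesis using N1[of m n] small[of m] small[of n] by linarith
      qed
      then show "\<exists>N. \<forall>m\<ge>N. \<forall>n\<ge>N. snorm (a m - a n) < \<epsilon>" by blast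
    qed simp
    define \<phi> where "\<phi> b = lim (\<lambda>n. ip (a n) b)" for b
    have rep: "represents a \<phi>"
      unfolding represents_def
    proof (intro conjI allI)
      fix b
      have "snorm_Cauchy (\<lambda>_. b)" using represents_const represents_Cauchy by blast
      from snorm_Cauchy_ip_convergent[OF \<open>snorm_Cauchy a\<close> this]
      show "(\<lambda>n. ip (a n) b) \<longlonglongrightarrow> \<phi> b" by (simp add: \<phi>_def convergent_LIMSEQ_iff)
    qed (fact)
    then have \<phi>: "\<phi> \<in> hcarrier completion" by (auto simp: mem_completion_iff)
    have "(\<lambda>n. C.snorm (X n - \<phi>)) \<longlonglongrightarrow> 0"
    proof (rule LIMSEQ_I)
      fix \<epsilon> :: real assume \<epsilon>: "0 < \<epsilon>"
      obtain N1 where N1: "\<And>m n. N1 \<le> m \<Longrightarrow> N1 \<le> n \<Longrightarrow> snorm (a m - a n) < \<epsilon> / 3"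
        using \<open>snorm_Cauchy a\<close> \<epsilon> unfolding snorm_Cauchy_def by (meson divide_pos_pos zero_less_numeral)
      obtain N2 where N2: "inverse (real (Suc N2)) < \<epsilon> / 3"
        using reals_Archimedean[of "\<epsilon> / 3"] \<epsilon> by auto
      have "norm (C.snorm (X n - \<phi>) - 0) < \<epsilon>" if n: "max N1 N2 \<le> n" for n
      proof -
        have "(\<lambda>k. snorm (a k - a n)) \<longlonglongrightarrow> hnorm completion (\<phi> - ip (a n))"
          by (intro represents_hnorm represents_diff rep represents_const)
        then have "hnorm completion (\<phi> - ip (a n)) \<le> \<epsilon> / 3"
          by (rule LIMSEQ_le_const2) (use N1 n in \<open>auto intro!: exI[of _ N1] less_imp_le\<close>)
        then have 1: "C.snorm (ip (a n) - \<phi>) \<le> \<epsilon> / 3"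
          unfolding hC by (simp add: C.snorm_minus_commute[OF ip_mem_completion \<phi>])
        have "inverse (real (Suc n)) \<le> inverse (real (Suc N2))"
          using n by (intro le_imp_inverse_le) auto
        then have 2: "C.snorm (X n - ip (a n)) < \<epsilon> / 3" using a[of n] N2 by linarith
        have "C.snorm (X n - \<phi>) \<le> C.snorm (X n - ip (a n)) + C.snorm (ip (a n) - \<phi>)"
          by (intro C.snorm_triangle_diff X ip_mem_completion \<phi>)
        then show ?thesis using 1 2 \<epsilon> X \<phi> by simp
      qed
      then show "\<exists>N. \<forall>n\<ge>N. norm (C.snorm (X n - \<phi>) - 0) < \<epsilon>" by blast
    qed
    then show ?thesis using \<phi> by (auto simp: hC)
  qed
  show ?thesis
    unfolding hilbert_space_def
    using C.subspace C.ip_add_left C.ip_scale_left C.ip_commute C.ip_nonneg definite complete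
    by (intro conjI allI ballI impI) (blast | simp)+
qed

lemma completion_inner: "hinner completion (ip x) (ip y) = ip x y"
  by (simp add: completion_inner_left ip_mem_completion)

text \<open>This is the Riesz theorem for the completion. The GNS cyclic vector enters in this way,
  although no element of the algebra need represent it.\<close>

lemma bounded_mem_completion:
  assumes "\<And>x y. \<phi> (x + y) = \<phi> x + \<phi> y" "\<And>c x. \<phi> (c *\<^sub>C x) = cnj c * \<phi> x"
    and "\<And>x. cmod (\<phi> x) \<le> C * snorm x"
  shows "\<phi> \<in> hcarrier completion"
proof -
  obtain a where "snorm_Cauchy a" "\<And>b. (\<lambda>n. ip (a n) b) \<longlonglongrightarrow> \<phi> b"
    using riesz[of \<phi> C] assms by auto
  then show ?thesis by (auto simp: mem_completion_iff represents_def)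
qed

end

section \<open>Direct sums and orthogonal projections\<close>

lemma hcarrier_hsum [simp]: "hcarrier (hsum H K) = hcarrier H \<times> hcarrier K"
  and hinner_hsum [simp]: "hinner (hsum H K) p q = hinner H (fst p) (fst q) + hinner K (snd p) (snd q)"
  by (simp_all add: hsum_def)

lemma hnorm_hsum:
  assumes "hilbert_space H" "hilbert_space K" "p \<in> hcarrier (hsum H K)"
  shows "hnorm (hsum H K) p = sqrt ((hnorm H (fst p))\<^sup>2 + (hnorm K (snd p))\<^sup>2)"
proof -
  interpret H: semi_inner "hcarrier H" "hinner H" using assms by (simp add: hilbert_space_semi_inner)
  interpret K: semi_inner "hcarrier K" "hinner K" using assms by (simp add: hilbert_space_semi_inner)
  have "fst p \<in> hcarrier H" "snd p \<in> hcarrier K" using assms by auto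
  then show ?thesis using H.Re_ip_self_nonneg K.Re_ip_self_nonneg by (simp add: hnorm_def)
qed

lemma hilbert_space_hsum:
  fixes H :: "'v::complex_vector hspace" and K :: "'w::complex_vector hspace"
  assumes H: "hilbert_space H" and K: "hilbert_space K"
  shows "hilbert_space (hsum H K)"
proof -
  interpret H: semi_inner "hcarrier H" "hinner H" using H by (rule hilbert_space_semi_inner)
  interpret K: semi_inner "hcarrier K" "hinner K" using K by (rule hilbert_space_semi_inner)
  have hH: "hnorm H x = H.snorm x" and hK: "hnorm K y = K.snorm y" for x y
    by (simp_all add: hnorm_def H.snorm_def K.snorm_def)
  interpret S: semi_inner "hcarrier (hsum H K)" "hinner (hsum H K)"
  proof
    show "complex_vector.subspace (hcarrier (hsum H K))"
      by (rule complex_vector.subspaceI) (auto simp: scaleC_prod_def zero_prod_def)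
    fix x y assume "x \<in> hcarrier (hsum H K)" "y \<in> hcarrier (hsum H K)"
    then show "hinner (hsum H K) y x = cnj (hinner (hsum H K) x y)"
      using H.ip_commute[of "fst x" "fst y"] K.ip_commute[of "snd x" "snd y"] by auto
  next
    fix x assume "x \<in> hcarrier (hsum H K)"
    then show "hinner (hsum H K) x x \<in> \<real>\<^sub>\<ge>\<^sub>0"
      using H.ip_nonneg[of "fst x"] K.ip_nonneg[of "snd x"]
      by (auto simp: complex_nonneg_Reals_iff)
  qed (auto simp: H.ip_add_left K.ip_add_left H.ip_scale_left K.ip_scale_left scaleC_prod_def
      algebra_simps)
  have definite: "x = 0" if x: "x \<in> hcarrier (hsum H K)" and 0: "hinner (hsum H K) x x = 0" for x
  proof -
    have m: "fst x \<in> hcarrier H" "snd x \<in> hcarrier K" using x by auto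
    have "Re (hinner H (fst x) (fst x)) + Re (hinner K (snd x) (snd x)) = 0"
      using arg_cong[OF 0, of Re] by simp
    then have "H.snorm (fst x) = 0" "K.snorm (snd x) = 0"
      using H.Re_ip_self_nonneg[OF m(1)] K.Re_ip_self_nonneg[OF m(2)]
      by (simp_all add: H.snorm_def K.snorm_def)
    then have "fst x = 0" "snd x = 0"
      using hilbert_space_definite[OF H m(1)] hilbert_space_definite[OF K m(2)] by (simp_all add: hH hK)
    then show ?thesis by (simp add: prod_eq_iff)
  qed
  have complete: "\<exists>x\<in>hcarrier (hsum H K). (\<lambda>n. hnorm (hsum H K) (X n - x)) \<longlonglongrightarrow> 0"
    if X: "\<And>n::nat. X n \<in> hcarrier (hsum H K)"
      and Cau: "\<And>\<epsilon>. 0 < \<epsilon> \<Longrightarrow> \<exists>N. \<forall>m\<ge>N. \<forall>n\<ge>N. hnorm (hsum H K) (X m - X n) < \<epsilon>" for X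
  proof -
    have Xm: "fst (X n) \<in> hcarrier H" "snd (X n) \<in> hcarrier K" for n using X[of n] by auto
    have comp: "H.snorm (fst d) \<le> hnorm (hsum H K) d \<and> K.snorm (snd d) \<le> hnorm (hsum H K) d"
      if "d \<in> hcarrier (hsum H K)" for d
      unfolding hnorm_hsum[OF H K that] hH hK by (simp add: real_le_rsqrt)
    have XD: "X m - X n \<in> hcarrier (hsum H K)" for m n using X by (intro S.diff_mem)
    have "H.snorm_Cauchy (\<lambda>n. fst (X n))"
      unfolding H.snorm_Cauchy_def
    proof (intro conjI allI impI)
      fix \<epsilon> :: real assume "0 < \<epsilon>"
      then obtain N where "\<forall>m\<ge>N. \<forall>n\<ge>N. hnorm (hsum H K) (X m - X n) < \<epsilon>" using Cau by blast
      then show "\<exists>N. \<forall>m\<ge>N. \<forall>n\<ge>N. H.snorm (fst (X m) - fst (X n)) < \<epsilon>"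
        unfolding fst_diff[symmetric] using comp[OF XD] by (meson le_less_trans)
    qed (rule Xm)
    then obtain x where x: "x \<in> hcarrier H" "(\<lambda>n. hnorm H (fst (X n) - x)) \<longlonglongrightarrow> 0"
      using hilbert_space_complete[OF H] by metis
    have "K.snorm_Cauchy (\<lambda>n. snd (X n))"
      unfolding K.snorm_Cauchy_def
    proof (intro conjI allI impI)
      fix \<epsilon> :: real assume "0 < \<epsilon>"
      then obtain N where "\<forall>m\<ge>N. \<forall>n\<ge>N. hnorm (hsum H K) (X m - X n) < \<epsilon>" using Cau by blast
      then show "\<exists>N. \<forall>m\<ge>N. \<forall>n\<ge>N. K.snorm (snd (X m) - snd (X n)) < \<epsilon>"
        unfolding snd_diff[symmetric] using comp[OF XD] by (meson le_less_trans)
    qed (rule Xm)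
    then obtain y where y: "y \<in> hcarrier K" "(\<lambda>n. hnorm K (snd (X n) - y)) \<longlonglongrightarrow> 0"
      using hilbert_space_complete[OF K] by metis
    have mem: "(x, y) \<in> hcarrier (hsum H K)" using x y by simp
    have "(\<lambda>n. sqrt ((hnorm H (fst (X n) - x))\<^sup>2 + (hnorm K (snd (X n) - y))\<^sup>2)) \<longlonglongrightarrow> sqrt (0\<^sup>2 + 0\<^sup>2)"
      by (intro tendsto_intros x y)
    then have "(\<lambda>n. hnorm (hsum H K) (X n - (x, y))) \<longlonglongrightarrow> 0"
      by (simp add: hnorm_hsum[OF H K S.diff_mem[OF X mem]])
    then show ?thesis using mem by blast
  qed
  show ?thesis
    unfolding hilbert_space_def
    using S.subspace S.ip_add_left S.ip_scale_left S.ip_commute S.ip_nonneg definite complete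
    by (intro conjI allI ballI impI) (blast | simp del: hinner_hsum hcarrier_hsum)+
qed

lemma orth_proj_eqI:
  assumes H: "hilbert_space H" and x: "x \<in> hcarrier H"
    and y: "y \<in> orth_compl H M" and orth: "\<And>z. z \<in> orth_compl H M \<Longrightarrow> hinner H (x - y) z = 0"
    and M: "M \<subseteq> hcarrier H"
  shows "orth_proj H (orth_compl H M) x = y"
  unfolding orth_proj_def
proof (rule the_equality)
  interpret semi_inner "hcarrier H" "hinner H" using H by (rule hilbert_space_semi_inner)
  show "y \<in> orth_compl H M \<and> (\<forall>z\<in>orth_compl H M. hinner H (x - y) z = 0)" using y orth by blast
  fix y' assume y': "y' \<in> orth_compl H M \<and> (\<forall>z\<in>orth_compl H M. hinner H (x - y') z = 0)"
  have m: "y \<in> hcarrier H" "y' \<in> hcarrier H" using y y' by (auto simp: orth_compl_def)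
  have d: "y - y' \<in> orth_compl H M"
    using y y' M m by (auto simp: orth_compl_def ip_diff_left subset_iff)
  have "y - y' = (x - y') - (x - y)" by simp
  then have "hinner H (y - y') (y - y') = hinner H (x - y') (y - y') - hinner H (x - y) (y - y')"
    using x m ip_diff_left[of "x - y'" "x - y" "y - y'"] by simp
  then have "snorm (y - y') = 0" using y' orth d by (simp add: snorm_def)
  then have "y - y' = 0"
    using hilbert_space_definite[OF H diff_mem[OF m]] hnorm_eq_snorm[OF H] by simp
  then show "y' = y" by simp
qed

text \<open>The limit k of T (z n) lies in the closure of ran T, hence is orthogonal to the
  complement, while the weak condition makes x - k orthogonal to ran T. So x = k + (x - k) is the
  orthogonal decomposition.\<close>

lemma orth_proj_range:
  fixes T :: "'e \<Rightarrow> 'v::complex_vector"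
  assumes H: "hilbert_space H" and T: "\<And>x. T x \<in> hcarrier H" and x: "x \<in> hcarrier H"
    and Cau: "semi_inner.snorm_Cauchy (hcarrier H) (hinner H) (\<lambda>n. T (z n))"
    and weak: "\<And>w. (\<lambda>n. hinner H (T (z n)) (T w)) \<longlonglongrightarrow> hinner H x (T w)"
  obtains k where "k \<in> hcarrier H" "(\<lambda>n. hnorm H (T (z n) - k)) \<longlonglongrightarrow> 0"
    "orth_proj H (orth_compl H (range T)) x = x - k" "x - k \<in> orth_compl H (range T)"
    "\<And>y. y \<in> orth_compl H (range T) \<Longrightarrow> hinner H k y = 0"
proof -
  interpret semi_inner "hcarrier H" "hinner H" using H by (rule hilbert_space_semi_inner)
  obtain k where k: "k \<in> hcarrier H" "(\<lambda>n. hnorm H (T (z n) - k)) \<longlonglongrightarrow> 0"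
    using hilbert_space_complete[OF H Cau] by metis
  have k_lim: "(\<lambda>n. hinner H (T (z n)) y) \<longlonglongrightarrow> hinner H k y" if "y \<in> hcarrier H" for y
    using snorm_tendsto_ip[OF T k(1) _ that] k(2) by (simp add: hnorm_eq_snorm[OF H])
  have "hinner H k (T w) = hinner H x (T w)" for w
    by (rule LIMSEQ_unique[OF k_lim[OF T] weak])
  then have mem: "x - k \<in> orth_compl H (range T)"
    using x k T by (auto simp: orth_compl_def ip_diff_left)
  have orth: "hinner H k y = 0" if y: "y \<in> orth_compl H (range T)" for y
  proof -
    have yH: "y \<in> hcarrier H" using y by (simp add: orth_compl_def)
    have "hinner H (T w) y = 0" for w
      using y ip_commute[OF yH T[of w]] by (auto simp: orth_compl_def)
    then have "(\<lambda>n. 0) \<longlonglongrightarrow> hinner H k y" using k_lim[OF yH] by simp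
    then show ?thesis by (simp add: LIMSEQ_const_iff)
  qed
  have "orth_proj H (orth_compl H (range T)) x = x - k"
    by (rule orth_proj_eqI[OF H x mem]) (use orth T in auto)
  then show thesis using that k mem orth by blast
qed

section \<open>Inner products pulled back along a linear map\<close>

lemma pullback_semi_inner:
  fixes T :: "'e::complex_vector \<Rightarrow> 'v::complex_vector"
  assumes H: "hilbert_space H" and T: "\<And>x. T x \<in> hcarrier H"
    and T_add: "\<And>x y. T (x + y) = T x + T y" and T_scale: "\<And>c x. T (c *\<^sub>C x) = c *\<^sub>C T x"
  shows "semi_inner UNIV (\<lambda>x y. hinner H (T x) (T y))"
proof -
  interpret semi_inner "hcarrier H" "hinner H" using H by (rule hilbert_space_semi_inner)
  show ?thesis
    by unfold_locales
      (auto simp: T T_add T_scale ip_add_left ip_scale_left ip_nonneg intro!: ip_commute)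
qed

text \<open>The pulled back form on the domain of T is in general neither definite nor complete, and
  \<open>riesz\<close> is stated for such forms. It supplies the sequence z for
  \<open>orth_proj_range\<close> before anything is known about convergence of T (z n).\<close>

lemma pullback_riesz:
  fixes T :: "'e::complex_vector \<Rightarrow> 'v::complex_vector"
  assumes H: "hilbert_space H" and T: "\<And>x. T x \<in> hcarrier H"
    and T_add: "\<And>x y. T (x + y) = T x + T y" and T_scale: "\<And>c x. T (c *\<^sub>C x) = c *\<^sub>C T x"
    and x: "x \<in> hcarrier H"
  obtains z where "semi_inner.snorm_Cauchy UNIV (\<lambda>x y. hinner H (T x) (T y)) z"
    "\<And>w. (\<lambda>n. hinner H (T (z n)) (T w)) \<longlonglongrightarrow> hinner H x (T w)"
proof -
  interpret semi_inner "hcarrier H" "hinner H" using H by (rule hilbert_space_semi_inner)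
  interpret D: semi_inner UNIV "\<lambda>x y. hinner H (T x) (T y)"
    by (rule pullback_semi_inner[OF H T T_add T_scale])
  have "cmod (hinner H x (T w)) \<le> snorm x * D.snorm w" for w
    using cauchy_schwarz[OF x T] by (simp add: snorm_def D.snorm_def)
  moreover have "hinner H x (T (v + w)) = hinner H x (T v) + hinner H x (T w)"
    and "hinner H x (T (c *\<^sub>C w)) = cnj c * hinner H x (T w)" for v w c
    by (simp_all add: T_add T_scale ip_add_right ip_scale_right T x)
  ultimately obtain z where "D.snorm_Cauchy z"
    "\<And>w. (\<lambda>n. hinner H (T (z n)) (T w)) \<longlonglongrightarrow> hinner H x (T w)"
    using D.riesz[of "\<lambda>w. hinner H x (T w)" "snorm x"] by (metis UNIV_I)
  then show thesis by (rule that)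
qed

lemma pullback_Cauchy:
  fixes T :: "'e::complex_vector \<Rightarrow> 'v::complex_vector"
  assumes H: "hilbert_space H" and T: "\<And>x. T x \<in> hcarrier H"
    and T_add: "\<And>x y. T (x + y) = T x + T y" and T_scale: "\<And>c x. T (c *\<^sub>C x) = c *\<^sub>C T x"
    and z: "semi_inner.snorm_Cauchy UNIV (\<lambda>x y. hinner H (T x) (T y)) z"
  shows "semi_inner.snorm_Cauchy (hcarrier H) (hinner H) (\<lambda>n. T (z n))"
proof -
  interpret semi_inner "hcarrier H" "hinner H" using H by (rule hilbert_space_semi_inner)
  interpret D: semi_inner UNIV "\<lambda>x y. hinner H (T x) (T y)"
    by (rule pullback_semi_inner[OF H T T_add T_scale])
  have T_diff: "T x - T y = T (x - y)" for x y
    using T_add[of "x - y" y] by simp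
  have "D.snorm x = snorm (T x)" for x by (simp add: snorm_def D.snorm_def)
  then show ?thesis using z T by (simp add: snorm_Cauchy_def D.snorm_Cauchy_def T_diff)
qed

lemma orth_proj_range_mem:
  fixes T :: "'e::complex_vector \<Rightarrow> 'v::complex_vector"
  assumes H: "hilbert_space H" and T: "\<And>x. T x \<in> hcarrier H"
    and T_add: "\<And>x y. T (x + y) = T x + T y" and T_scale: "\<And>c x. T (c *\<^sub>C x) = c *\<^sub>C T x"
    and x: "x \<in> hcarrier H"
  shows "orth_proj H (orth_compl H (range T)) x \<in> orth_compl H (range T)"
    and "y \<in> orth_compl H (range T) \<Longrightarrow>
      hinner H (x - orth_proj H (orth_compl H (range T)) x) y = 0"
proof -
  obtain z where z: "semi_inner.snorm_Cauchy UNIV (\<lambda>x y. hinner H (T x) (T y)) z"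
    "\<And>w. (\<lambda>n. hinner H (T (z n)) (T w)) \<longlonglongrightarrow> hinner H x (T w)"
    using pullback_riesz[OF assms] by metis
  obtain k where k: "orth_proj H (orth_compl H (range T)) x = x - k" "x - k \<in> orth_compl H (range T)"
    "\<And>y. y \<in> orth_compl H (range T) \<Longrightarrow> hinner H k y = 0"
    using orth_proj_range[where T = T and z = z, OF H T x pullback_Cauchy[OF H T T_add T_scale z(1)] z(2)] by metis
  then show "orth_proj H (orth_compl H (range T)) x \<in> orth_compl H (range T)"
    and "y \<in> orth_compl H (range T) \<Longrightarrow> hinner H (x - orth_proj H (orth_compl H (range T)) x) y = 0"
    by auto
qed

text \<open>Projections onto \<open>(ran T)\<^sup>\<bottom>\<close> depend only on inner products: the approximants \<open>T (z n)\<close> of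
  \<open>x - P x\<close> are determined by the form \<open>(T x | T y)\<close> and the functional \<open>(x | T y)\<close>.\<close>

lemma orth_proj_range_transfer:
  fixes T :: "'e::complex_vector \<Rightarrow> 'v::complex_vector" and T' :: "'e \<Rightarrow> 'w::complex_vector"
  assumes H: "hilbert_space H" and T: "\<And>x. T x \<in> hcarrier H"
    and T_add: "\<And>x y. T (x + y) = T x + T y" and T_scale: "\<And>c x. T (c *\<^sub>C x) = c *\<^sub>C T x"
    and H': "hilbert_space H'" and T': "\<And>x. T' x \<in> hcarrier H'"
    and T'_add: "\<And>x y. T' (x + y) = T' x + T' y" and T'_scale: "\<And>c x. T' (c *\<^sub>C x) = c *\<^sub>C T' x"
    and x: "x \<in> hcarrier H" "x' \<in> hcarrier H'" and y: "y \<in> hcarrier H" "y' \<in> hcarrier H'"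
    and TT: "\<And>v w. hinner H (T v) (T w) = hinner H' (T' v) (T' w)"
    and xT: "\<And>w. hinner H x (T w) = hinner H' x' (T' w)"
    and Ty: "\<And>w. hinner H (T w) y = hinner H' (T' w) y'"
    and xy: "hinner H x y = hinner H' x' y'"
  shows "hinner H (orth_proj H (orth_compl H (range T)) x) y =
    hinner H' (orth_proj H' (orth_compl H' (range T')) x') y'"
proof -
  interpret semi_inner "hcarrier H" "hinner H" using H by (rule hilbert_space_semi_inner)
  interpret H': semi_inner "hcarrier H'" "hinner H'" using H' by (rule hilbert_space_semi_inner)
  obtain z where z: "semi_inner.snorm_Cauchy UNIV (\<lambda>x y. hinner H (T x) (T y)) z"
    "\<And>w. (\<lambda>n. hinner H (T (z n)) (T w)) \<longlonglongrightarrow> hinner H x (T w)"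
    using pullback_riesz[OF H T T_add T_scale x(1)] by metis
  have z': "semi_inner.snorm_Cauchy UNIV (\<lambda>x y. hinner H' (T' x) (T' y)) z"
    "\<And>w. (\<lambda>n. hinner H' (T' (z n)) (T' w)) \<longlonglongrightarrow> hinner H' x' (T' w)"
    using z by (simp_all add: TT xT)
  obtain k where k: "k \<in> hcarrier H" "(\<lambda>n. hnorm H (T (z n) - k)) \<longlonglongrightarrow> 0"
    "orth_proj H (orth_compl H (range T)) x = x - k"
    using orth_proj_range[where T = T and z = z, OF H T x(1) pullback_Cauchy[OF H T T_add T_scale z(1)] z(2)] by metis
  obtain k' where k': "k' \<in> hcarrier H'" "(\<lambda>n. hnorm H' (T' (z n) - k')) \<longlonglongrightarrow> 0"
    "orth_proj H' (orth_compl H' (range T')) x' = x' - k'"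
    using orth_proj_range[where T = T' and z = z, OF H' T' x(2) pullback_Cauchy[OF H' T' T'_add T'_scale z'(1)] z'(2)] by metis
  have "(\<lambda>n. hinner H (T (z n)) y) \<longlonglongrightarrow> hinner H k y"
    using snorm_tendsto_ip[OF T k(1) _ y(1)] k(2) by (simp add: hnorm_eq_snorm[OF H])
  moreover have "(\<lambda>n. hinner H' (T' (z n)) y') \<longlonglongrightarrow> hinner H' k' y'"
    using H'.snorm_tendsto_ip[OF T' k'(1) _ y(2)] k'(2) by (simp add: hnorm_eq_snorm[OF H'])
  ultimately have "hinner H k y = hinner H' k' y'" unfolding Ty by (rule LIMSEQ_unique)
  then show ?thesis using k k' x y xy by (simp add: ip_diff_left H'.ip_diff_left)
qed

section \<open>The parallel sum of operators\<close>

lemma antilinear_continuous: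
  fixes \<phi> :: "'e::complex_normed_vector \<Rightarrow> complex"
  assumes "\<And>x y. \<phi> (x + y) = \<phi> x + \<phi> y" "\<And>c x. \<phi> (c *\<^sub>C x) = cnj c * \<phi> x"
    and "\<And>x. cmod (\<phi> x) \<le> C * norm x"
  shows "continuous_on UNIV \<phi>"
proof -
  have "bounded_linear \<phi>"
    by (rule bounded_linear_intro[of _ C]) (use assms in \<open>auto simp: scaleR_scaleC scaleR_conv_of_real mult.commute\<close>)
  then show ?thesis by (rule linear_continuous_on)
qed

lemma functional_norm_le:
  fixes \<phi> :: "'e::complex_normed_vector \<Rightarrow> complex"
  assumes "\<And>x. cmod (\<phi> x) \<le> C * norm x" and "0 \<le> C"
  shows "functional_norm \<phi> \<le> ereal C"
  unfolding functional_norm_def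
proof (rule SUP_least)
  fix x :: 'e assume "x \<in> {x. norm x \<le> 1}"
  then have "C * norm x \<le> C * 1" using assms(2) by (intro mult_left_mono) auto
  then show "ereal (cmod (\<phi> x)) \<le> ereal C" using assms(1)[of x] by simp
qed

lemma functional_norm_leD:
  fixes \<phi> :: "'e::complex_normed_vector \<Rightarrow> complex"
  assumes le: "functional_norm \<phi> \<le> ereal C" and scale: "\<And>c x. cmod (\<phi> (c *\<^sub>C x)) = cmod c * cmod (\<phi> x)"
  shows "cmod (\<phi> x) \<le> C * norm x"
proof (cases "x = 0")
  case True
  then show ?thesis using scale[of 0 x] by simp
next
  case False
  let ?c = "complex_of_real (1 / norm x)"
  have "norm (?c *\<^sub>C x) = 1"
    unfolding norm_scaleC norm_of_real using False by simp
  then have "ereal (cmod (\<phi> (?c *\<^sub>C x))) \<le> functional_norm \<phi>"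
    unfolding functional_norm_def by (intro SUP_upper) simp
  then have "cmod (\<phi> (?c *\<^sub>C x)) \<le> C" using le by (meson ereal_less_eq(3) order_trans)
  then have "1 / norm x * cmod (\<phi> x) \<le> C" unfolding scale norm_of_real by simp
  then show ?thesis using False by (simp add: field_simps)
qed

lemma antidualD:
  assumes "\<phi> \<in> antidual"
  shows "\<phi> (x + y) = \<phi> x + \<phi> y" "\<phi> (c *\<^sub>C x) = cnj c * \<phi> x"
  using assms by (simp_all add: antidual_def)

text \<open>Both \<open>J_sum\<close> and \<open>J_fst\<close> are of this form, with W the adjoint
  composed with the canonical embedding: W x = (A x, B x) and W x = (A x, 0). The lemma shows that
  the operators selected by choice exist.\<close>

lemma inner_bounded_into_antidual:
  fixes W :: "'e::complex_banach \<Rightarrow> 'v::complex_vector"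
  assumes H: "hilbert_space H" and W: "\<And>x. W x \<in> hcarrier H"
    and W_add: "\<And>x y. W (x + y) = W x + W y" and W_scale: "\<And>c x. W (c *\<^sub>C x) = c *\<^sub>C W x"
    and bound: "\<And>x. hnorm H (W x) \<le> C * norm x" and C: "0 \<le> C"
  shows "bounded_into_antidual H (\<lambda>\<xi> b. hinner H \<xi> (W b))"
proof -
  interpret semi_inner "hcarrier H" "hinner H" using H by (rule hilbert_space_semi_inner)
  have le: "cmod (hinner H \<xi> (W b)) \<le> C * hnorm H \<xi> * norm b" if \<xi>: "\<xi> \<in> hcarrier H" for \<xi> b
  proof -
    have "cmod (hinner H \<xi> (W b)) \<le> snorm \<xi> * snorm (W b)" by (intro cauchy_schwarz \<xi> W)
    also have "\<dots> \<le> snorm \<xi> * (C * norm b)"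
      using bound[of b] \<xi> by (intro mult_left_mono) (auto simp: hnorm_eq_snorm[OF H])
    finally show ?thesis by (simp add: hnorm_eq_snorm[OF H] mult_ac)
  qed
  show ?thesis
    unfolding bounded_into_antidual_def
  proof (intro conjI ballI allI)
    fix \<xi> assume \<xi>: "\<xi> \<in> hcarrier H"
    have "continuous_on UNIV (\<lambda>b. hinner H \<xi> (W b))"
      by (rule antilinear_continuous[OF _ _ le[OF \<xi>]])
        (simp_all add: W W_add W_scale \<xi> ip_add_right ip_scale_right)
    then show "(\<lambda>b. hinner H \<xi> (W b)) \<in> antidual"
      by (simp add: antidual_def W W_add W_scale \<xi> ip_add_right ip_scale_right)
  next
    show "\<exists>K. \<forall>\<xi>\<in>hcarrier H. functional_norm (\<lambda>b. hinner H \<xi> (W b)) \<le> ereal (K * hnorm H \<xi>)"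
      using C le by (intro exI[of _ C] ballI functional_norm_le) (auto simp: hnorm_eq_snorm[OF H])
  qed (auto simp: fun_eq_iff scaleC_fun_def scaleC_complex_def ip_add_left ip_scale_left W)
qed

text \<open>Density and boundedness leave only one continuous extension, so the operators selected
  by choice agree with their explicit formulas on the whole Hilbert space.\<close>

lemma bounded_into_antidual_eq:
  fixes S S' :: "'v::complex_vector \<Rightarrow> 'e::complex_banach \<Rightarrow> complex"
  assumes H: "hilbert_space H" and S: "bounded_into_antidual H S" and S': "bounded_into_antidual H S'"
    and dense: "hdense H D" and eq: "\<And>d. d \<in> D \<Longrightarrow> S d = S' d" and \<xi>: "\<xi> \<in> hcarrier H"
  shows "S \<xi> = S' \<xi>"
proof
  fix b
  interpret semi_inner "hcarrier H" "hinner H" using H by (rule hilbert_space_semi_inner)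
  have bnd: "\<exists>K. \<forall>\<xi>\<in>hcarrier H. cmod (R \<xi> b) \<le> K * hnorm H \<xi> * norm b"
    if R: "bounded_into_antidual H R" for R :: "'v \<Rightarrow> 'e \<Rightarrow> complex"
  proof -
    obtain K where "\<forall>\<xi>\<in>hcarrier H. functional_norm (R \<xi>) \<le> ereal (K * hnorm H \<xi>)"
      using R by (auto simp: bounded_into_antidual_def)
    moreover have "cmod (R \<xi> (c *\<^sub>C x)) = cmod c * cmod (R \<xi> x)" if "\<xi> \<in> hcarrier H" for \<xi> c x
      using R that antidualD(2)[of "R \<xi>" c x] by (simp add: bounded_into_antidual_def norm_mult)
    ultimately show ?thesis using functional_norm_leD by blast
  qed
  obtain K where K: "\<And>\<xi>. \<xi> \<in> hcarrier H \<Longrightarrow> cmod (S \<xi> b) \<le> K * hnorm H \<xi> * norm b"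
    using bnd[OF S] by blast
  obtain K' where K': "\<And>\<xi>. \<xi> \<in> hcarrier H \<Longrightarrow> cmod (S' \<xi> b) \<le> K' * hnorm H \<xi> * norm b"
    using bnd[OF S'] by blast
  define L where "L = (\<bar>K\<bar> + \<bar>K'\<bar>) * norm b"
  have L: "0 \<le> L" by (simp add: L_def)
  have diff: "R (\<xi> - d) = R \<xi> - R d" if R: "bounded_into_antidual H R" and d: "d \<in> hcarrier H"
    for R :: "'v \<Rightarrow> 'e \<Rightarrow> complex" and d
  proof -
    have "\<xi> - d \<in> hcarrier H" using \<xi> d by simp
    then have "R ((\<xi> - d) + d) = R (\<xi> - d) + R d" using R d unfolding bounded_into_antidual_def by blast
    then show ?thesis by (simp add: eq_diff_eq)
  qed
  have "cmod (S \<xi> b - S' \<xi> b) \<le> 0 + \<epsilon>" if \<epsilon>: "0 < \<epsilon>" for \<epsilon>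
  proof -
    obtain d where d: "d \<in> D" "hnorm H (\<xi> - d) < \<epsilon> / (L + 1)"
      using dense \<xi> \<epsilon> L unfolding hdense_def by (metis add_nonneg_pos divide_pos_pos zero_less_one)
    have dH: "d \<in> hcarrier H" using d dense by (auto simp: hdense_def)
    have n0: "0 \<le> hnorm H (\<xi> - d)" using \<xi> dH by (simp add: hnorm_eq_snorm[OF H])
    have "S \<xi> b - S' \<xi> b = S (\<xi> - d) b - S' (\<xi> - d) b"
      using diff[OF S dH] diff[OF S' dH] eq[OF d(1)] by simp
    then have "cmod (S \<xi> b - S' \<xi> b) \<le> cmod (S (\<xi> - d) b) + cmod (S' (\<xi> - d) b)"
      by (simp add: norm_triangle_ineq4)
    also have "\<dots> \<le> K * hnorm H (\<xi> - d) * norm b + K' * hnorm H (\<xi> - d) * norm b"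
      using \<xi> dH by (intro add_mono K K') auto
    also have "\<dots> \<le> \<bar>K\<bar> * hnorm H (\<xi> - d) * norm b + \<bar>K'\<bar> * hnorm H (\<xi> - d) * norm b"
      using n0 by (intro add_mono mult_right_mono) auto
    also have "\<dots> = L * hnorm H (\<xi> - d)" by (simp add: L_def algebra_simps)
    also have "\<dots> \<le> L * (\<epsilon> / (L + 1))" using d L by (intro mult_left_mono) auto
    also have "\<dots> \<le> \<epsilon>" using L \<epsilon> by (simp add: field_simps)
    finally show ?thesis by simp
  qed
  then have "cmod (S \<xi> b - S' \<xi> b) \<le> 0" by (rule field_le_epsilon)
  then show "S \<xi> b = S' \<xi> b" by simp
qed

lemma hadjoint_bidual_embed:
  assumes H: "hilbert_space H" and W: "\<And>x. W x \<in> hcarrier H"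
    and S: "\<And>\<xi> b. \<xi> \<in> hcarrier H \<Longrightarrow> S \<xi> b = hinner H \<xi> (W b)"
  shows "hadjoint H S (bidual_embed x) = W x"
proof -
  interpret semi_inner "hcarrier H" "hinner H" using H by (rule hilbert_space_semi_inner)
  show ?thesis
    unfolding hadjoint_def
  proof (rule the_equality)
    have *: "hinner H (W x) \<xi> = bidual_embed x (S \<xi>)" if "\<xi> \<in> hcarrier H" for \<xi>
      using that S ip_commute[OF that W] by (simp add: bidual_embed_def)
    then show "W x \<in> hcarrier H \<and> (\<forall>\<xi>\<in>hcarrier H. hinner H (W x) \<xi> = bidual_embed x (S \<xi>))"
      using W by blast
    fix \<eta> assume "\<eta> \<in> hcarrier H \<and> (\<forall>\<xi>\<in>hcarrier H. hinner H \<eta> \<xi> = bidual_embed x (S \<xi>))"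
    then show "\<eta> = W x" using * W by (intro hilbert_space_eqI[OF H]) auto
  qed
qed

lemma positive_opE:
  assumes "positive_op A"
  obtains K where "0 \<le> K" "\<And>x y. cmod (A x y) \<le> K * norm x * norm y"
    "\<And>x y z. A (x + y) z = A x z + A y z" "\<And>c x y. A (c *\<^sub>C x) y = c * A x y"
    "semi_inner UNIV A"
proof -
  have A: "range A \<subseteq> antidual" "clinear A" and pos: "\<And>x. A x x \<in> \<real>\<^sub>\<ge>\<^sub>0"
    using assms by (auto simp: positive_op_def bounded_ops_def)
  interpret A: Vector_Spaces.linear scaleC scaleC A by (rule A(2))
  obtain K where K: "\<And>x. functional_norm (A x) \<le> ereal (K * norm x)"
    using assms by (auto simp: positive_op_def bounded_ops_def)
  have Aad: "A x \<in> antidual" for x using A(1) by auto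
  have add: "A (x + y) z = A x z + A y z" and scale: "A (c *\<^sub>C x) z = c * A x z" for x y z c
    by (simp_all add: A.add A.scale scaleC_fun_def scaleC_complex_def)
  have "cmod (A x y) \<le> \<bar>K\<bar> * norm x * norm y" for x y
  proof -
    have "cmod (A x y) \<le> K * norm x * norm y"
      by (rule functional_norm_leD[OF K]) (simp add: antidualD(2)[OF Aad] norm_mult)
    also have "\<dots> \<le> \<bar>K\<bar> * norm x * norm y" by (intro mult_right_mono) auto
    finally show ?thesis .
  qed
  moreover have "semi_inner UNIV A"
    by (rule positive_sesquilinear_semi_inner)
      (simp_all only: add scale antidualD[OF Aad] pos)
  ultimately show thesis using that[of "\<bar>K\<bar>"] add scale by simp
qed

lemma range_completion_hspace_of:
  assumes "positive_op A"
  shows "range_completion A (hspace_of A)"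
proof -
  have "semi_inner UNIV A" by (rule positive_opE[OF assms])
  then interpret semi_inner_space A by (rule semi_inner_space.intro)
  have "range_completion A completion"
    by (simp add: range_completion_def completion_hilbert completion_dense completion_inner)
  then show ?thesis unfolding hspace_of_def by (rule someI)
qed

text \<open>Once the chosen operators are inner products with T y = (A y, B y) and W y = (A y, 0),
  their adjoints are x -> T x and x -> W x, and evaluating \<open>J_fst\<close> at y means taking
  the inner product with W y.\<close>

lemma operator_parallel_sum_eq:
  fixes A B :: "'e::complex_banach \<Rightarrow> 'e \<Rightarrow> complex"
  assumes A: "positive_op A" and B: "positive_op B"
  defines "H \<equiv> hsum (hspace_of A) (hspace_of B)"
  shows "operator_parallel_sum A B x y =
    hinner H (orth_proj H (orth_compl H (range (\<lambda>x. (A x, B x)))) (A x, 0)) (A y, 0)"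
proof -
  have RA: "hilbert_space (hspace_of A)" "hdense (hspace_of A) (range A)"
    "\<And>x y. hinner (hspace_of A) (A x) (A y) = A x y"
    using range_completion_hspace_of[OF A] by (auto simp: range_completion_def)
  have RB: "hilbert_space (hspace_of B)" "hdense (hspace_of B) (range B)"
    "\<And>x y. hinner (hspace_of B) (B x) (B y) = B x y"
    using range_completion_hspace_of[OF B] by (auto simp: range_completion_def)
  have mA: "A x \<in> hcarrier (hspace_of A)" for x using RA(2) by (auto simp: hdense_def)
  have mB: "B x \<in> hcarrier (hspace_of B)" for x using RB(2) by (auto simp: hdense_def)
  interpret HA: semi_inner "hcarrier (hspace_of A)" "hinner (hspace_of A)"
    using RA(1) by (rule hilbert_space_semi_inner)
  interpret HB: semi_inner "hcarrier (hspace_of B)" "hinner (hspace_of B)"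
    using RB(1) by (rule hilbert_space_semi_inner)
  have H: "hilbert_space H" unfolding H_def by (rule hilbert_space_hsum[OF RA(1) RB(1)])
  obtain K where K: "0 \<le> K" "\<And>x y. cmod (A x y) \<le> K * norm x * norm y"
    and A_add: "\<And>x y z. A (x + y) z = A x z + A y z" and A_scale: "\<And>c x y. A (c *\<^sub>C x) y = c * A x y"
    by (rule positive_opE[OF A]) blast
  obtain L where L: "0 \<le> L" "\<And>x y. cmod (B x y) \<le> L * norm x * norm y"
    and B_add: "\<And>x y z. B (x + y) z = B x z + B y z" and B_scale: "\<And>c x y. B (c *\<^sub>C x) y = c * B x y"
    by (rule positive_opE[OF B]) blast
  define W where "W x = (A x, 0 :: 'e \<Rightarrow> complex)" for x
  define T where "T x = (A x, B x)" for x
  have W: "W x \<in> hcarrier H" and T: "T x \<in> hcarrier H" for x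
    using mA mB by (simp_all add: W_def T_def H_def)
  have W_lin: "W (x + y) = W x + W y" "W (c *\<^sub>C x) = c *\<^sub>C W x"
    and T_lin: "T (x + y) = T x + T y" "T (c *\<^sub>C x) = c *\<^sub>C T x" for x y c
    by (auto simp add: W_def T_def A_add A_scale B_add B_scale scaleC_prod_def
        scaleC_fun_def scaleC_complex_def intro!: ext)
  have T_bound: "hnorm H (T x) \<le> sqrt (K + L) * norm x" for x
  proof -
    have "Re (A x x) + Re (B x x) \<le> K * norm x * norm x + L * norm x * norm x"
      using K(2)[of x x] L(2)[of x x] complex_Re_le_cmod[of "A x x"] complex_Re_le_cmod[of "B x x"]
      by linarith
    then have "Re (hinner H (T x) (T x)) \<le> (K + L) * (norm x)\<^sup>2"
      by (simp add: H_def T_def RA(3) RB(3) power2_eq_square algebra_simps)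
    then have "hnorm H (T x) \<le> sqrt ((K + L) * (norm x)\<^sup>2)" by (simp add: hnorm_def)
    then show ?thesis by (simp add: real_sqrt_mult)
  qed
  have W_bound: "hnorm H (W x) \<le> sqrt (K + L) * norm x" for x
  proof -
    have "hnorm H (W x) \<le> hnorm H (T x)"
      using HB.Re_ip_self_nonneg[OF mB, of x] by (simp add: hnorm_def H_def T_def W_def)
    then show ?thesis using T_bound[of x] by linarith
  qed
  have KL: "0 \<le> sqrt (K + L)" using K L by simp
  have SW: "bounded_into_antidual H (\<lambda>\<xi> b. hinner H \<xi> (W b))"
    by (rule inner_bounded_into_antidual[OF H W W_lin W_bound KL])
  have ST: "bounded_into_antidual H (\<lambda>\<xi> b. hinner H \<xi> (T b))"
    by (rule inner_bounded_into_antidual[OF H T T_lin T_bound KL])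
  have W_eq: "(\<lambda>b. hinner H (A x, B y) (W b)) = A x" for x y
    by (simp add: H_def W_def RA(3) mB)
  have T_eq: "(\<lambda>b. hinner H (A x, B y) (T b)) = A x + B y" for x y
    by (simp add: H_def T_def RA(3) RB(3) fun_eq_iff)
  have Jf: "bounded_into_antidual H (J_fst A B) \<and> (\<forall>x y. J_fst A B (A x, B y) = A x)"
    unfolding J_fst_def H_def[symmetric]
    by (rule someI[of "\<lambda>S. bounded_into_antidual H S \<and> (\<forall>x y. S (A x, B y) = A x)"
          "\<lambda>\<xi> b. hinner H \<xi> (W b)"])
      (simp only: SW W_eq simp_thms)
  have Js: "bounded_into_antidual H (J_sum A B) \<and> (\<forall>x y. J_sum A B (A x, B y) = A x + B y)"
    unfolding J_sum_def H_def[symmetric]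
    by (rule someI[of "\<lambda>S. bounded_into_antidual H S \<and> (\<forall>x y. S (A x, B y) = A x + B y)"
          "\<lambda>\<xi> b. hinner H \<xi> (T b)"])
      (simp only: ST T_eq simp_thms)
  have dense: "hdense H {(A x, B y) | x y. True}"
    unfolding hdense_def
  proof (intro conjI ballI allI impI)
    show "{(A x, B y) | x y. True} \<subseteq> hcarrier H" using mA mB by (auto simp: H_def)
    fix p \<epsilon> assume p: "p \<in> hcarrier H" and \<epsilon>: "(0::real) < \<epsilon>"
    then have p': "fst p \<in> hcarrier (hspace_of A)" "snd p \<in> hcarrier (hspace_of B)"
      by (auto simp: H_def)
    have e2: "0 < \<epsilon> / 2" using \<epsilon> by simp
    obtain x where x: "hnorm (hspace_of A) (fst p - A x) < \<epsilon> / 2"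
      using RA(2) p'(1) e2 unfolding hdense_def by blast
    obtain y where y: "hnorm (hspace_of B) (snd p - B y) < \<epsilon> / 2"
      using RB(2) p'(2) e2 unfolding hdense_def by blast
    have m: "p - (A x, B y) \<in> hcarrier (hsum (hspace_of A) (hspace_of B))"
      using p' mA mB by (auto simp: mem_Times_iff)
    have nn: "0 \<le> hnorm (hspace_of A) (fst p - A x)" "0 \<le> hnorm (hspace_of B) (snd p - B y)"
      using p' mA mB by (simp_all add: hnorm_eq_snorm[OF RA(1)] hnorm_eq_snorm[OF RB(1)])
    have "hnorm H (p - (A x, B y)) \<le> hnorm (hspace_of A) (fst p - A x) + hnorm (hspace_of B) (snd p - B y)"
      unfolding H_def hnorm_hsum[OF RA(1) RB(1) m] fst_diff snd_diff fst_conv snd_conv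
      by (rule sqrt_sum_squares_le_sum[OF nn])
    then have "hnorm H (p - (A x, B y)) < \<epsilon>" using x y by linarith
    then show "\<exists>d\<in>{(A x, B y) | x y. True}. hnorm H (p - d) < \<epsilon>" by blast
  qed
  have Jf_eq: "J_fst A B \<xi> b = hinner H \<xi> (W b)" if "\<xi> \<in> hcarrier H" for \<xi> b
  proof -
    have "J_fst A B \<xi> = (\<lambda>b. hinner H \<xi> (W b))"
    proof (rule bounded_into_antidual_eq[OF H conjunct1[OF Jf] SW dense _ that])
      fix d assume "d \<in> {(A x, B y) | x y. True}"
      then obtain x y where d: "d = (A x, B y)" by blast
      show "J_fst A B d = (\<lambda>b. hinner H d (W b))" unfolding d W_eq using Jf by blast
    qed
    then show ?thesis by simp
  qed
  have Js_eq: "J_sum A B \<xi> b = hinner H \<xi> (T b)" if "\<xi> \<in> hcarrier H" for \<xi> b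
  proof -
    have "J_sum A B \<xi> = (\<lambda>b. hinner H \<xi> (T b))"
    proof (rule bounded_into_antidual_eq[OF H conjunct1[OF Js] ST dense _ that])
      fix d assume "d \<in> {(A x, B y) | x y. True}"
      then obtain x y where d: "d = (A x, B y)" by blast
      show "J_sum A B d = (\<lambda>b. hinner H d (T b))" unfolding d T_eq using Js by blast
    qed
    then show ?thesis by simp
  qed
  have adj: "hadjoint H (J_fst A B) (bidual_embed x) = W x" "hadjoint H (J_sum A B) (bidual_embed x) = T x" for x
    using hadjoint_bidual_embed[OF H W Jf_eq] hadjoint_bidual_embed[OF H T Js_eq] by auto
  have rng: "range (hadjoint H (J_sum A B) \<circ> bidual_embed) = range T"
    using adj(2) by (simp add: o_def)
  have "orth_proj H (orth_compl H (range T)) (W x) \<in> hcarrier H"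
    using orth_proj_range_mem(1)[OF H T T_lin W] by (simp add: orth_compl_def)
  then have "operator_parallel_sum A B x y =
      hinner H (orth_proj H (orth_compl H (range T)) (W x)) (W y)"
    unfolding operator_parallel_sum_def H_def[symmetric] Let_def rng
    by (simp add: adj Jf_eq)
  then show ?thesis by (simp add: T_def[abs_def] W_def)
qed

section \<open>Spectral theory in a non-unital Banach algebra\<close>

text \<open>Inverse of \<open>p - y\<close> in the corner \<open>pAp\<close>, whose unit is the idempotent \<open>p\<close>.\<close>

definition corner_inverse :: "'a::ring \<Rightarrow> 'a \<Rightarrow> 'a \<Rightarrow> bool"
  where "corner_inverse p y \<phi> \<longleftrightarrow>
    p * \<phi> = \<phi> \<and> \<phi> * p = \<phi> \<and> \<phi> * (p - y) = p \<and> (p - y) * \<phi> = p"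

lemma corner_inverse_unique:
  assumes "corner_inverse p y \<phi>" "corner_inverse p y \<psi>"
  shows "\<phi> = \<psi>"
proof -
  have "\<phi> = \<phi> * ((p - y) * \<psi>)" using assms by (simp add: corner_inverse_def)
  also have "\<dots> = \<phi> * (p - y) * \<psi>" by (simp only: mult.assoc)
  also have "\<dots> = \<psi>" using assms by (simp add: corner_inverse_def)
  finally show ?thesis .
qed

text \<open>Partial fractions: 1 / (1 - y^2) is the mean of 1 / (1 - y) and 1 / (1 + y), with p as
  unit.\<close>

lemma corner_inverse_square:
  fixes p y :: "'a::real_normed_algebra"
  assumes pp: "p * p = p" and y: "p * y = y" "y * p = y"
    and a: "corner_inverse p y a" and b: "corner_inverse p (- y) b"
  shows "corner_inverse p (y * y) ((1/2) *\<^sub>R (a + b))"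
proof -
  have fac: "p - y * y = (p - y) * (p + y)" "p - y * y = (p + y) * (p - y)"
    using pp y by (simp_all add: algebra_simps)
  have A: "a * (p - y * y) = p + y"
  proof -
    have "a * (p - y * y) = a * (p - y) * (p + y)" by (simp only: fac mult.assoc)
    then show ?thesis using a pp y by (simp add: corner_inverse_def distrib_left)
  qed
  have A': "(p - y * y) * a = p + y"
  proof -
    have "(p - y * y) * a = (p + y) * ((p - y) * a)" by (simp only: fac(2) mult.assoc)
    then show ?thesis using a pp y by (simp add: corner_inverse_def distrib_right)
  qed
  have B: "b * (p - y * y) = p - y"
  proof -
    have "b * (p - y * y) = b * (p + y) * (p - y)" by (simp only: fac(2) mult.assoc)
    then show ?thesis using b pp y by (simp add: corner_inverse_def right_diff_distrib)
  qed
  have B': "(p - y * y) * b = p - y"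
  proof -
    have "(p - y * y) * b = (p - y) * ((p + y) * b)" by (simp only: fac(1) mult.assoc)
    then show ?thesis using b pp y by (simp add: corner_inverse_def left_diff_distrib)
  qed
  have two: "(1/2) *\<^sub>R ((p + y) + (p - y)) = p"
    by (simp flip: scaleR_2)
  show ?thesis
    using a b unfolding corner_inverse_def
    by (simp add: distrib_left[of _ a b] distrib_right[of a b] A A' B B' two del: add_diff_eq)
qed

lemma power_two_power_tendsto_0:
  fixes c :: real
  assumes "0 \<le> c" "c < 1"
  shows "(\<lambda>k. c ^ (2 ^ k)) \<longlonglongrightarrow> 0"
proof -
  have "strict_mono (\<lambda>k::nat. (2::nat) ^ k)" by (rule strict_monoI) simp
  from LIMSEQ_subseq_LIMSEQ[OF LIMSEQ_realpow_zero[OF assms] this]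
  show ?thesis by (simp add: o_def)
qed

text \<open>The power x^(2^k), formed by squaring alone: the algebra has no unit, and averaging over
  \<plusminus>z produces exactly these exponents.\<close>

definition iter_square :: "nat \<Rightarrow> 'a::times \<Rightarrow> 'a"
  where "iter_square k x = ((\<lambda>x. x * x) ^^ k) x"

lemma iter_square_0 [simp]: "iter_square 0 x = x"
  and iter_square_Suc [simp]: "iter_square (Suc k) x = iter_square k x * iter_square k x"
  by (simp_all add: iter_square_def)

lemma norm_iter_square_le: "norm (iter_square k x) \<le> norm x ^ (2 ^ k)"
  for x :: "'a::real_normed_algebra"
proof (induction k)
  case (Suc k)
  have "norm (iter_square (Suc k) x) \<le> norm (iter_square k x) * norm (iter_square k x)"
    by (simp add: norm_mult_ineq)
  also have "\<dots> \<le> norm x ^ (2 ^ k) * norm x ^ (2 ^ k)" using Suc by (intro mult_mono) auto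
  finally show ?case by (simp add: power_add[symmetric] mult_2)
qed simp

lemma idempotent_norm_ge_1:
  fixes p :: "'a::real_normed_algebra"
  assumes "p * p = p" "p \<noteq> 0"
  shows "1 \<le> norm p"
  using norm_mult_ineq[of p p] assms by simp

text \<open>The resolvent identity is \<phi> z - \<phi> w = (z - w) \<phi> z s \<phi> w. As the norm
  of \<phi> z is not controlled in advance, the identity serves first to absorb half of it, so that
  norm (\<phi> z) \<le> 2 norm (\<phi> w) near w.\<close>

lemma corner_resolvent_continuous:
  fixes p s :: "'a::complex_banach_algebra" and \<phi> :: "complex \<Rightarrow> 'a"
  assumes pp: "p * p = p" and ps: "p * s = s" "s * p = s"
    and inv: "\<And>z. corner_inverse p (z *\<^sub>C s) (\<phi> z)"
  shows "continuous_on UNIV \<phi>"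
proof -
  have res: "\<phi> z - \<phi> w = (z - w) *\<^sub>C (\<phi> z * s * \<phi> w)" for z w
  proof -
    have "\<phi> z - \<phi> w = \<phi> z * ((p - w *\<^sub>C s) * \<phi> w) - (\<phi> z * (p - z *\<^sub>C s)) * \<phi> w"
      using inv[of z] inv[of w] by (simp add: corner_inverse_def)
    also have "\<dots> = z *\<^sub>C (\<phi> z * s * \<phi> w) - w *\<^sub>C (\<phi> z * s * \<phi> w)"
      by (simp add: algebra_simps mult_scaleC_left mult_scaleC_right)
    finally show ?thesis by (simp add: complex_vector.scale_left_diff_distrib)
  qed
  have "isCont \<phi> w" for w
  proof -
    define K where "K = norm s * norm (\<phi> w) + 1"
    have K: "0 < K" by (simp add: K_def add_nonneg_pos)
    have le: "norm (\<phi> z - \<phi> w) \<le> cmod (z - w) * norm (\<phi> z) * K" for z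
    proof -
      have "norm (\<phi> z - \<phi> w) = cmod (z - w) * norm (\<phi> z * s * \<phi> w)"
        by (simp add: res norm_scaleC)
      also have "norm (\<phi> z * s * \<phi> w) \<le> norm (\<phi> z) * norm s * norm (\<phi> w)"
        by (meson mult_right_mono norm_ge_zero norm_mult_ineq order_trans)
      also have "\<dots> \<le> norm (\<phi> z) * K" by (simp add: K_def mult.assoc mult_left_mono)
      finally show ?thesis by (simp add: mult_left_mono mult.assoc)
    qed
    have ev: "norm (\<phi> z - \<phi> w) \<le> 2 * norm (\<phi> w) * K * cmod (z - w)" if z: "cmod (z - w) < 1 / (2 * K)" for z
    proof -
      have h: "cmod (z - w) * K \<le> 1/2" using z K by (simp add: field_simps)
      have "norm (\<phi> z) \<le> norm (\<phi> w) + norm (\<phi> z - \<phi> w)" by (rule norm_triangle_sub)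
      also have "\<dots> \<le> norm (\<phi> w) + (cmod (z - w) * K) * norm (\<phi> z)"
        using le[of z] by (simp add: mult_ac)
      also have "(cmod (z - w) * K) * norm (\<phi> z) \<le> 1/2 * norm (\<phi> z)"
        using h by (intro mult_right_mono) auto
      finally have n: "norm (\<phi> z) \<le> 2 * norm (\<phi> w)" by simp
      have "norm (\<phi> z - \<phi> w) \<le> cmod (z - w) * (2 * norm (\<phi> w)) * K"
        using le[of z] n K by (meson less_imp_le mult_left_mono mult_right_mono norm_ge_zero order_trans)
      then show ?thesis by (simp add: mult_ac)
    qed
    have "((\<lambda>z. \<phi> z - \<phi> w) \<longlongrightarrow> 0) (at w)"
    proof (rule Lim_null_comparison)
      show "\<forall>\<^sub>F z in at w. norm (\<phi> z - \<phi> w) \<le> 2 * norm (\<phi> w) * K * cmod (z - w)"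
        using K ev by (auto simp: eventually_at dist_norm intro!: exI[of _ "1 / (2 * K)"])
      have "((\<lambda>z. 2 * norm (\<phi> w) * K * cmod (z - w)) \<longlongrightarrow> 2 * norm (\<phi> w) * K * cmod (w - w)) (at w)"
        by (intro tendsto_intros)
      then show "((\<lambda>z. 2 * norm (\<phi> w) * K * cmod (z - w)) \<longlongrightarrow> 0) (at w)" by simp
    qed
    then show ?thesis by (simp add: isCont_def LIM_zero_iff)
  qed
  then show ?thesis by (simp add: continuous_at_imp_continuous_on)
qed

text \<open>The spectrum of an invertible element \<open>s\<close> of \<open>pAp\<close> is not empty. Rickart's argument: if
  all \<open>\<phi> z = (p - z s)\<^sup>-\<^sup>1\<close> exist, then averaging over \<open>\<plusminus>z\<close> gives \<open>(p - z\<^sup>2 s\<^sup>2)\<^sup>-\<^sup>1\<close>, so the modulus of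
  continuity of \<open>\<phi>\<close> is inherited by \<open>(p - (z s)^(2^k))\<^sup>-\<^sup>1\<close>, uniformly in \<open>k\<close>. Hence the
  set of radii \<open>r\<close> with \<open>(r s)^(2^k) \<longlonglongrightarrow> 0\<close> has no finite supremum.\<close>

lemma corner_spectrum_nonempty:
  fixes p s :: "'a::complex_banach_algebra"
  assumes pp: "p * p = p" and p0: "p \<noteq> 0" and ps: "p * s = s" "s * p = s"
    and s_inv: "\<rho> * s = p" "\<rho> * p = \<rho>"
    and res: "\<And>z. \<exists>\<phi>. corner_inverse p (z *\<^sub>C s) \<phi>"
  shows False
proof -
  define S where "S k = iter_square k s" for k
  have pS: "p * S k = S k" "S k * p = S k" for k
  proof (induction k)
    case (Suc k)
    have "p * S (Suc k) = (p * S k) * S k" by (simp add: S_def mult.assoc)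
    then show "p * S (Suc k) = S (Suc k)" using Suc by (simp add: S_def)
    have "S (Suc k) * p = S k * (S k * p)" by (simp add: S_def mult.assoc)
    then show "S (Suc k) * p = S (Suc k)" using Suc by (simp add: S_def)
  qed (use ps in \<open>simp_all add: S_def\<close>)
  have sq: "corner_inverse p ((w * w) *\<^sub>C S (Suc k)) ((1/2) *\<^sub>R (c + d))"
    if "corner_inverse p (w *\<^sub>C S k) c" "corner_inverse p ((- w) *\<^sub>C S k) d" for k w c d
  proof -
    have "corner_inverse p ((w *\<^sub>C S k) * (w *\<^sub>C S k)) ((1/2) *\<^sub>R (c + d))"
      using that pS by (intro corner_inverse_square pp)
        (simp_all add: mult_scaleC_left mult_scaleC_right complex_vector.scale_minus_left)
    then show ?thesis
      by (simp add: S_def mult_scaleC_left mult_scaleC_right scaleC_scaleC)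
  qed
  have ex: "\<exists>\<phi>. corner_inverse p (z *\<^sub>C S k) \<phi>" for k z
  proof (induction k arbitrary: z)
    case 0 then show ?case using res by (simp add: S_def)
  next
    case (Suc k)
    obtain a b where "corner_inverse p (csqrt z *\<^sub>C S k) a" "corner_inverse p ((- csqrt z) *\<^sub>C S k) b"
      using Suc by metis
    from sq[OF this] show ?case by (auto simp flip: power2_eq_square)
  qed
  \<comment> \<open>At level k + 1 both inverses are means of inverses at level k, taken at the two
    square roots, so the same \<epsilon> survives each step. The parameters match because T y is a
    square root of t^(2^(k+1)) z.\<close>
  have unif: "norm (\<phi> - \<psi>) \<le> \<epsilon>"
    if base: "\<And>z \<phi> \<psi>. \<lbrakk>cmod z = r; corner_inverse p (z *\<^sub>C s) \<phi>;
        corner_inverse p ((of_real t * z) *\<^sub>C s) \<psi>\<rbrakk> \<Longrightarrow> norm (\<phi> - \<psi>) \<le> \<epsilon>"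
      and z: "cmod z = r ^ (2 ^ k)" and r: "0 \<le> r"
      and \<phi>: "corner_inverse p (z *\<^sub>C S k) \<phi>"
      and \<psi>: "corner_inverse p ((of_real (t ^ (2 ^ k)) * z) *\<^sub>C S k) \<psi>"
    for r t \<epsilon> k z \<phi> \<psi>
    using z \<phi> \<psi>
  proof (induction k arbitrary: z \<phi> \<psi>)
    case 0 then show ?case using base by (simp add: S_def)
  next
    case (Suc k)
    define y where "y = csqrt z"
    define T where "T = complex_of_real (t ^ (2 ^ k))"
    have TT: "complex_of_real (t ^ (2 ^ Suc k)) = T * T"
      by (simp add: T_def power_add[symmetric] mult_2 flip: of_real_mult)
    have yy: "y * y = z" by (simp add: y_def power2_eq_square[symmetric])
    have cy: "cmod y = r ^ (2 ^ k)"
    proof -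
      have "(cmod y)\<^sup>2 = (r ^ (2 ^ k))\<^sup>2"
        using Suc.prems(1) yy by (metis norm_mult power2_eq_square power_Suc power_add power_mult mult.commute)
      then show ?thesis by (rule power2_eq_imp_eq) (use r in auto)
    qed
    obtain a b where ab: "corner_inverse p (y *\<^sub>C S k) a" "corner_inverse p ((- y) *\<^sub>C S k) b"
      using ex by metis
    obtain a' b' where ab': "corner_inverse p ((T * y) *\<^sub>C S k) a'" "corner_inverse p ((T * (- y)) *\<^sub>C S k) b'"
      using ex by metis
    have "\<phi> = (1/2) *\<^sub>R (a + b)"
      using sq[OF ab] Suc.prems(2) yy by (auto intro: corner_inverse_unique)
    moreover have "\<psi> = (1/2) *\<^sub>R (a' + b')"
    proof (rule corner_inverse_unique)
      show "corner_inverse p ((T * y * (T * y)) *\<^sub>C S (Suc k)) ((1/2) *\<^sub>R (a' + b'))"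
        using sq[of "T * y" k a' b'] ab' by simp
      have "complex_of_real (t ^ (2 ^ Suc k)) * z = T * y * (T * y)"
        unfolding TT yy[symmetric] by (simp only: mult_ac)
      then show "corner_inverse p ((T * y * (T * y)) *\<^sub>C S (Suc k)) \<psi>"
        using Suc.prems(3) by simp
    qed
    ultimately have "\<phi> - \<psi> = (1/2) *\<^sub>R ((a - a') + (b - b'))" by (simp add: algebra_simps)
    then have "norm (\<phi> - \<psi>) \<le> 1/2 * (norm (a - a') + norm (b - b'))"
      using norm_triangle_ineq[of "a - a'" "b - b'"] by simp
    moreover have "norm (a - a') \<le> \<epsilon>"
      using Suc.IH[OF cy ab(1)] ab'(1) by (simp add: T_def)
    moreover have "norm (b - b') \<le> \<epsilon>"
      using Suc.IH[of "- y", OF _ ab(2)] cy ab'(2) by (simp add: T_def)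
    ultimately show ?case by simp
  qed
  define \<alpha> where "\<alpha> k = norm (S k)" for k
  \<comment> \<open>With the spectral radius read as the limit of norm (s^(2^k))^(1/2^k), the
    supremum of \<open>R\<close> is its reciprocal.\<close>
  define R where "R = {r. 0 \<le> r \<and> (\<lambda>k. r ^ (2 ^ k) * \<alpha> k) \<longlonglongrightarrow> 0}"
  have p1: "1 \<le> norm p" using pp p0 by (rule idempotent_norm_ge_1)
  define r\<^sub>0 where "r\<^sub>0 = 1 / (2 * (norm s + 1))"
  have r\<^sub>0: "0 < r\<^sub>0" unfolding r\<^sub>0_def by (simp add: add_nonneg_pos)
  have r\<^sub>0_R: "r\<^sub>0 \<in> R"
  proof -
    have le: "r\<^sub>0 * norm s \<le> 1/2"
    proof -
      have "norm s \<le> 1/2 * (2 * (norm s + 1))" by simp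
      moreover have "0 < 2 * (norm s + 1)" by (simp add: add_nonneg_pos)
      ultimately show ?thesis by (simp only: r\<^sub>0_def pos_divide_le_eq times_divide_eq_left mult_1_left)
    qed
    have "norm (r\<^sub>0 ^ (2 ^ k) * \<alpha> k) \<le> (1/2) ^ (2 ^ k)" for k
    proof -
      have "r\<^sub>0 ^ (2 ^ k) * \<alpha> k \<le> r\<^sub>0 ^ (2 ^ k) * norm s ^ (2 ^ k)"
        unfolding \<alpha>_def S_def using r\<^sub>0 by (intro mult_left_mono norm_iter_square_le) auto
      also have "\<dots> = (r\<^sub>0 * norm s) ^ (2 ^ k)" by (simp add: power_mult_distrib)
      also have "\<dots> \<le> (1/2) ^ (2 ^ k)" using le r\<^sub>0 by (intro power_mono) auto
      finally show ?thesis using r\<^sub>0 by (simp add: \<alpha>_def)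
    qed
    then have "(\<lambda>k. r\<^sub>0 ^ (2 ^ k) * \<alpha> k) \<longlonglongrightarrow> 0"
      by (rule null_comparison) (rule power_two_power_tendsto_0, auto)
    then show ?thesis using r\<^sub>0 by (simp add: R_def)
  qed
  \<comment> \<open>Powers of the left inverse \<rho> keep r^(2^k) norm (s^(2^k)) at least 1 as soon
    as r \<ge> norm \<rho>. For nilpotent s the set \<open>R\<close> would be unbounded.\<close>
  have R_le: "r \<le> norm \<rho>" if "r \<in> R" for r
  proof (rule ccontr)
    assume "\<not> r \<le> norm \<rho>"
    then have r: "norm \<rho> \<le> r" by simp
    have inv: "iter_square k \<rho> * S k = p \<and> iter_square k \<rho> * p = iter_square k \<rho>" for k
    proof (induction k)
      case 0 then show ?case using s_inv by (simp add: S_def)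
    next
      case (Suc k)
      have "iter_square (Suc k) \<rho> * S (Suc k) = iter_square k \<rho> * (iter_square k \<rho> * S k) * S k"
        by (simp add: S_def mult.assoc)
      then show ?case using Suc by (simp add: mult.assoc)
    qed
    have "1 \<le> r ^ (2 ^ k) * \<alpha> k" for k
    proof -
      have "1 \<le> norm (iter_square k \<rho> * S k)" using inv p1 by simp
      also have "\<dots> \<le> norm (iter_square k \<rho>) * \<alpha> k" unfolding \<alpha>_def by (rule norm_mult_ineq)
      also have "\<dots> \<le> norm \<rho> ^ (2 ^ k) * \<alpha> k"
        by (intro mult_right_mono norm_iter_square_le) (simp add: \<alpha>_def)
      also have "\<dots> \<le> r ^ (2 ^ k) * \<alpha> k"
        using r by (intro mult_right_mono power_mono) (auto simp: \<alpha>_def)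
      finally show ?thesis .
    qed
    then have "1 \<le> (0::real)"
      using that by (intro LIMSEQ_le_const[of "\<lambda>k. r ^ (2 ^ k) * \<alpha> k"]) (auto simp: R_def)
    then show False by simp
  qed
  define r where "r = Sup R"
  have bdd: "bdd_above R" by (rule bdd_aboveI[of _ "norm \<rho>"]) (rule R_le)
  have le_r: "x \<le> r" if "x \<in> R" for x unfolding r_def using that bdd by (rule cSup_upper)
  have r_pos: "0 < r" using le_r[OF r\<^sub>0_R] r\<^sub>0 by linarith
  define \<phi> where "\<phi> z = (SOME \<phi>. corner_inverse p (z *\<^sub>C s) \<phi>)" for z
  have \<phi>: "corner_inverse p (z *\<^sub>C s) (\<phi> z)" for z
    unfolding \<phi>_def by (rule someI_ex) (rule res)
  have "uniformly_continuous_on (cball 0 (2 * r)) \<phi>"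
    using corner_resolvent_continuous[OF pp ps \<phi>]
    by (intro compact_uniformly_continuous) (auto intro: continuous_on_subset)
  then obtain d where d: "0 < d"
    and d8: "\<And>z w. \<lbrakk>z \<in> cball 0 (2 * r); w \<in> cball 0 (2 * r); dist w z < d\<rbrakk> \<Longrightarrow> dist (\<phi> w) (\<phi> z) < 1/8"
    unfolding uniformly_continuous_on_def by (metis zero_less_divide_1_iff zero_less_numeral)
  obtain r\<^sub>1 where r1: "r\<^sub>1 \<in> R" "r - d/4 < r\<^sub>1"
    using less_cSup_iff[of R "r - d/4"] bdd r\<^sub>0_R d unfolding r_def by fastforce
  have r1': "0 \<le> r\<^sub>1" "r\<^sub>1 \<le> r" using r1 le_r by (auto simp: R_def)
  \<comment> \<open>\<open>r\<^sub>1\<close> lies in \<open>R\<close> just below r, and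
    \<open>r\<^sub>2\<close> lies just above r, hence outside \<open>R\<close>. They differ by less
    than d, so uniform continuity compares the inverses at both radii; the cap r / 2 keeps
    \<open>r\<^sub>2\<close> inside the disc of radius 2 r.\<close>
  define r\<^sub>2 where "r\<^sub>2 = r + min (d/4) (r/2)"
  have r2: "r < r\<^sub>2" "r\<^sub>2 \<le> 2 * r" "r\<^sub>2 - r\<^sub>1 < d" using d r_pos r1 by (auto simp: r\<^sub>2_def min_def)
  define t where "t = r\<^sub>1 / r\<^sub>2"
  have tr: "t * r\<^sub>2 = r\<^sub>1" using r2 r_pos by (simp add: t_def)
  have t: "0 \<le> t" "t \<le> 1" using r1' r2 r_pos by (auto simp: t_def)
  have base: "norm (\<xi> - \<psi>) \<le> 1/8"
    if "cmod z = r\<^sub>2" "corner_inverse p (z *\<^sub>C s) \<xi>" "corner_inverse p ((of_real t * z) *\<^sub>C s) \<psi>"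
    for z \<xi> \<psi>
  proof -
    have "\<xi> = \<phi> z" "\<psi> = \<phi> (of_real t * z)" using that \<phi> by (auto intro: corner_inverse_unique)
    moreover have "z - of_real t * z = of_real (1 - t) * z" by (simp add: algebra_simps)
    then have "dist z (of_real t * z) = (1 - t) * r\<^sub>2"
      using that(1) t unfolding dist_norm by (simp only: norm_mult norm_of_real abs_of_nonneg diff_ge_0_iff_ge)
    then have "dist z (of_real t * z) < d" using r2 tr by (simp add: algebra_simps)
    moreover have "cmod (of_real t * z) = r\<^sub>1" using that(1) t tr by (simp add: norm_mult)
    ultimately show ?thesis
      using d8[of "of_real t * z" z] that(1) r1' r2 r_pos by (simp add: dist_norm)
  qed
  have "\<forall>\<^sub>F k in sequentially. r\<^sub>1 ^ (2 ^ k) * \<alpha> k < 1 / (16 * norm p)"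
    using r1(1) p1 by (intro order_tendstoD(2)[of _ 0]) (auto simp: R_def)
  \<comment> \<open>At radius \<open>r\<^sub>1\<close> the element \<open>y\<^sub>1\<close> tends to
    0, so its inverse \<psi> is within 1/8 of p, and the uniform estimate puts \<xi> within 1/8 +
    1/8 = 1/4 of p. Solving (p - \<open>y\<^sub>2\<close>) \<xi> = p for \<open>y\<^sub>2\<close>
    bounds its norm by (1/4) / (1 - 1/4) = 1/3.\<close>
  then have ev: "\<forall>\<^sub>F k in sequentially. r\<^sub>2 ^ (2 ^ k) * \<alpha> k \<le> 1/3"
  proof eventually_elim
    case (elim k)
    define y\<^sub>1 where "y\<^sub>1 = (of_real (t ^ (2 ^ k)) * of_real (r\<^sub>2 ^ (2 ^ k))) *\<^sub>C S k"
    define y\<^sub>2 where "y\<^sub>2 = complex_of_real (r\<^sub>2 ^ (2 ^ k)) *\<^sub>C S k"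
    obtain \<xi> \<psi> where \<xi>: "corner_inverse p y\<^sub>2 \<xi>" and \<psi>: "corner_inverse p y\<^sub>1 \<psi>"
      unfolding y\<^sub>1_def y\<^sub>2_def using ex by metis
    have near: "norm (\<xi> - \<psi>) \<le> 1/8"
      using unif[of r\<^sub>2 t "1/8", OF base _ _ \<xi>[unfolded y\<^sub>2_def] \<psi>[unfolded y\<^sub>1_def]] r2 r_pos
      by (simp add: norm_power)
    have ny1: "norm y\<^sub>1 = r\<^sub>1 ^ (2 ^ k) * \<alpha> k"
    proof -
      have "t ^ (2 ^ k) * r\<^sub>2 ^ (2 ^ k) = r\<^sub>1 ^ (2 ^ k)" using tr by (simp add: power_mult_distrib[symmetric])
      then have "y\<^sub>1 = of_real (r\<^sub>1 ^ (2 ^ k)) *\<^sub>C S k" unfolding y\<^sub>1_def by (simp only: of_real_mult[symmetric])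
      then show ?thesis using r1' by (simp add: norm_scaleC \<alpha>_def norm_power)
    qed
    have ny2: "norm y\<^sub>2 = r\<^sub>2 ^ (2 ^ k) * \<alpha> k"
      using r2 r_pos by (simp add: y\<^sub>2_def norm_scaleC \<alpha>_def norm_power)
    have small: "norm y\<^sub>1 * norm p < 1/16"
    proof -
      have "norm y\<^sub>1 * norm p < 1 / (16 * norm p) * norm p"
        unfolding ny1 using elim p1 by (intro mult_strict_right_mono) auto
      then show ?thesis using p0 by simp
    qed
    then have "norm y\<^sub>1 < 1/2"
      using mult_left_mono[OF p1, of "norm y\<^sub>1"] by simp
    have \<psi>p: "\<psi> - p = \<psi> * y\<^sub>1" proof -
      have "\<psi> * (p - y\<^sub>1) = p" "\<psi> * p = \<psi>" using \<psi> by (auto simp: corner_inverse_def)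
      then have "\<psi> - \<psi> * y\<^sub>1 = p" by (simp only: right_diff_distrib)
      then show ?thesis by (simp add: algebra_simps)
    qed
    have "norm \<psi> \<le> norm p + norm (\<psi> - p)" by (rule norm_triangle_sub)
    also have "norm (\<psi> - p) \<le> norm \<psi> * norm y\<^sub>1" unfolding \<psi>p by (rule norm_mult_ineq)
    also have "\<dots> \<le> norm \<psi> * (1/2)" using \<open>norm y\<^sub>1 < 1/2\<close> by (intro mult_left_mono) auto
    finally have "norm \<psi> \<le> 2 * norm p" by simp
    then have "norm \<psi> * norm y\<^sub>1 \<le> 2 * norm p * norm y\<^sub>1" by (intro mult_right_mono) auto
    then have "norm \<psi> * norm y\<^sub>1 \<le> 2 * (norm y\<^sub>1 * norm p)" by (simp only: mult_ac)
    then have "norm (\<psi> - p) \<le> 1/8"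
      using norm_mult_ineq[of \<psi> y\<^sub>1] small unfolding \<psi>p by linarith
    then have e: "norm (\<xi> - p) \<le> 1/4"
      using near norm_triangle_ineq[of "\<xi> - \<psi>" "\<psi> - p"] by simp
    have py: "y\<^sub>2 * p = y\<^sub>2" using pS by (simp add: y\<^sub>2_def mult_scaleC_left)
    have "(p - y\<^sub>2) * \<xi> = p" "p * \<xi> = \<xi>" using \<xi> by (auto simp: corner_inverse_def)
    then have "\<xi> - y\<^sub>2 * \<xi> = p" by (simp only: left_diff_distrib)
    then have "y\<^sub>2 * (\<xi> - p) = (\<xi> - p) - y\<^sub>2"
      using py by (simp add: right_diff_distrib) (simp add: algebra_simps)
    then have "y\<^sub>2 = (\<xi> - p) - y\<^sub>2 * (\<xi> - p)" by simp
    then have "norm y\<^sub>2 \<le> norm (\<xi> - p) + norm (y\<^sub>2 * (\<xi> - p))"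
      using norm_triangle_ineq4[of "\<xi> - p" "y\<^sub>2 * (\<xi> - p)"] by simp
    also have "norm (y\<^sub>2 * (\<xi> - p)) \<le> norm y\<^sub>2 * norm (\<xi> - p)" by (rule norm_mult_ineq)
    also have "\<dots> \<le> norm y\<^sub>2 * (1/4)" using e by (intro mult_left_mono) auto
    finally have "norm y\<^sub>2 \<le> 1/3" using e by simp
    then show ?case by (simp add: ny2)
  qed
  \<comment> \<open>Boundedness at \<open>r\<^sub>2\<close> becomes decay at every smaller radius,
    in particular at one that still exceeds r.\<close>
  define r\<^sub>3 where "r\<^sub>3 = (r + r\<^sub>2) / 2"
  have r3: "r < r\<^sub>3" "r\<^sub>3 < r\<^sub>2" using r2 by (auto simp: r\<^sub>3_def)
  have "(\<lambda>k. r\<^sub>3 ^ (2 ^ k) * \<alpha> k) \<longlonglongrightarrow> 0"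
  proof (rule Lim_null_comparison)
    show "\<forall>\<^sub>F k in sequentially. norm (r\<^sub>3 ^ (2 ^ k) * \<alpha> k) \<le> (r\<^sub>3 / r\<^sub>2) ^ (2 ^ k)"
      using ev
    proof eventually_elim
      case (elim k)
      have "r\<^sub>3 ^ (2 ^ k) * \<alpha> k = (r\<^sub>3 / r\<^sub>2) ^ (2 ^ k) * (r\<^sub>2 ^ (2 ^ k) * \<alpha> k)"
        using r2 r_pos by (simp add: power_divide)
      also have "\<dots> \<le> (r\<^sub>3 / r\<^sub>2) ^ (2 ^ k) * 1"
        using elim r2 r3 r_pos by (intro mult_left_mono) auto
      finally show ?case using r3 r_pos by (simp add: \<alpha>_def)
    qed
    show "(\<lambda>k. (r\<^sub>3 / r\<^sub>2) ^ (2 ^ k)) \<longlonglongrightarrow> 0"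
      using r2 r3 r_pos by (intro power_two_power_tendsto_0) auto
  qed
  then have "r\<^sub>3 \<in> R" using r3 r_pos by (simp add: R_def)
  then show False using le_r r3 by fastforce
qed

section \<open>Automatic continuity and Cohen factorization\<close>

lemma unbounded_homogeneous:
  fixes q :: "'a::real_normed_vector \<Rightarrow> real"
  assumes hom: "\<And>r x. q (r *\<^sub>R x) = \<bar>r\<bar> * q x"
    and unb: "\<not> (\<exists>K. \<forall>x. q x \<le> K * norm x)" and \<epsilon>: "0 < \<epsilon>"
  obtains x where "norm x \<le> \<epsilon>" "L \<le> q x"
proof -
  obtain x where x: "L / \<epsilon> * norm x < q x" using unb by (meson not_le)
  have "x \<noteq> 0" using x hom[of 0 0] by auto
  then have nx: "0 < norm x" by simp
  show thesis
  proof
    show "norm ((\<epsilon> / norm x) *\<^sub>R x) \<le> \<epsilon>" using nx \<epsilon> by simp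
    have "L \<le> \<epsilon> / norm x * q x" using x nx \<epsilon> by (simp add: field_simps)
    then show "L \<le> q ((\<epsilon> / norm x) *\<^sub>R x)" using nx \<epsilon> by (simp add: hom)
  qed
qed

lemma star_zero [simp]: "star (0::'a::banach_star_algebra) = 0"
  using star_scaleC[of 0 "0::'a"] by simp

lemma star_minus: "star (- x) = - star (x::'a::banach_star_algebra)"
  using star_add[of x "- x"] by (simp add: eq_neg_iff_add_eq_0 add.commute)

lemma star_diff: "star (x - y) = star x - star (y::'a::banach_star_algebra)"
  using star_add[of x "- y"] by (simp add: star_minus)

lemma star_sum: "star (sum h A) = (\<Sum>i\<in>A. star (h i :: 'a::banach_star_algebra))"
  by (induction A rule: infinite_finite_induct) (simp_all add: star_add)

text \<open>Gliding hump: the summands \<open>a n\<close> are chosen so small that the hypothesis bounds \<open>N\<close>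
  on all tails of \<open>\<Sum>n. a n\<close>, although the involution need not be continuous.\<close>

lemma involution_seminorm_bounded:
  fixes N :: "'a::banach_star_algebra \<Rightarrow> real"
  assumes nonneg: "\<And>x. 0 \<le> N x"
    and triangle: "\<And>x y. N (x + y) \<le> N x + N y"
    and scale: "\<And>c x. N (c *\<^sub>C x) = cmod c * N x"
    and star_bound: "\<And>x. (N x)\<^sup>2 \<le> norm (star x) * norm x"
  shows "\<exists>K. \<forall>x. N x \<le> K * norm x"
proof (rule ccontr)
  assume unb: "\<not> ?thesis"
  have hom: "N (r *\<^sub>R x) = \<bar>r\<bar> * N x" for r x by (simp add: scaleR_scaleC scale)
  have "\<forall>\<epsilon> L. \<exists>x. 0 < \<epsilon> \<longrightarrow> norm x \<le> \<epsilon> \<and> L \<le> N x"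
    using unbounded_homogeneous[of N, OF hom unb] by metis
  then obtain pick where pick: "\<And>\<epsilon> L. 0 < \<epsilon> \<Longrightarrow> norm (pick \<epsilon> L) \<le> \<epsilon> \<and> L \<le> N (pick \<epsilon> L)"
    by metis
  \<comment> \<open>The state (S, M) holds the sums of norm (star (a k)) and of N (a k) over the
    elements chosen so far. The next element is small against 1 + S, which pays for the growth of
    the stars, while its N exceeds M by at least n.\<close>
  define st :: "nat \<Rightarrow> real \<times> real" where
    "st = rec_nat (0, 0) (\<lambda>n (S, M). let x = pick ((1/2) ^ n / (1 + S)) (real n + M)
                                     in (S + norm (star x), M + N x))"
  define S M where "S n = fst (st n)" and "M n = snd (st n)" for n
  define a where "a n = pick ((1/2) ^ n / (1 + S n)) (real n + M n)" for n
  have S0: "S 0 = 0" "M 0 = 0" by (simp_all add: S_def M_def st_def)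
  have SSuc: "S (Suc n) = S n + norm (star (a n))" "M (Suc n) = M n + N (a n)" for n
    by (simp_all add: S_def M_def a_def st_def case_prod_unfold Let_def)
  have S_eq: "S n = (\<Sum>k<n. norm (star (a k)))" "M n = (\<Sum>k<n. N (a k))" for n
    by (induction n) (simp_all add: S0 SSuc)
  have S_nonneg: "0 \<le> S n" for n by (simp add: S_eq sum_nonneg)
  have S_mono: "S m \<le> S n" if "m \<le> n" for m n
    unfolding S_eq using that by (intro sum_mono2) auto
  have eps: "0 < (1/2) ^ n / (1 + S n)" for n using S_nonneg[of n] by simp
  have a_norm: "norm (a n) \<le> (1/2) ^ n / (1 + S n)" and a_N: "real n + M n \<le> N (a n)" for n
    using pick[OF eps] unfolding a_def by auto
  have a_tail: "norm (a (k + n)) \<le> (1/2) ^ k * ((1/2) ^ n / (1 + S n))" for k n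
  proof -
    have "norm (a (k + n)) \<le> (1/2) ^ (k + n) / (1 + S (k + n))" by (rule a_norm)
    also have "\<dots> \<le> (1/2) ^ (k + n) / (1 + S n)"
      using S_nonneg[of n] S_mono[of n "k + n"] by (intro divide_left_mono mult_pos_pos) auto
    finally show ?thesis by (simp add: power_add)
  qed
  have "summable a"
    by (rule summable_comparison_test'[of "\<lambda>k. (1/2) ^ k * ((1/2) ^ 0 / (1 + S 0))" 0])
      (use a_tail[of _ 0] in \<open>auto intro!: summable_mult2 summable_geometric\<close>)
  define s where "s = suminf a"
  define P where "P n = (\<Sum>k<n. a k)" for n
  have tail_norm: "norm (s - P n) \<le> 2 * ((1/2) ^ n / (1 + S n))" for n
  proof -
    have "s - P n = (\<Sum>k. a (k + n))"
      unfolding s_def P_def using suminf_minus_initial_segment[OF \<open>summable a\<close>, of n] by simp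
    also have "norm \<dots> \<le> (\<Sum>k. (1/2) ^ k * ((1/2) ^ n / (1 + S n)))"
      by (intro norm_suminf_le a_tail summable_mult2 summable_geometric) simp
    also have "\<dots> = (\<Sum>k. (1/2) ^ k) * ((1/2) ^ n / (1 + S n))"
      by (intro suminf_mult2[symmetric] summable_geometric) simp
    also have "(\<Sum>k. (1/2::real) ^ k) = 2" by (subst suminf_geometric) auto
    finally show ?thesis .
  qed
  \<comment> \<open>The star cannot be taken termwise in an infinite sum, so the tail is written as
    s minus a partial sum. Its star has norm at most norm (star s) + S n, and the tail itself
    contributes a factor 2 / (1 + S n) that compensates S n.\<close>
  have tail_N: "(N (s - P n))\<^sup>2 \<le> 2 * (norm (star s) + 1)" for n
  proof -
    have "norm (star (s - P n)) \<le> norm (star s) + norm (\<Sum>k<n. star (a k))"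
      unfolding P_def by (simp add: star_diff star_sum norm_triangle_ineq4)
    also have "norm (\<Sum>k<n. star (a k)) \<le> S n" unfolding S_eq by (rule norm_sum)
    finally have 1: "norm (star (s - P n)) \<le> norm (star s) + S n" by simp
    have "2 * ((1/2) ^ n / (1 + S n)) \<le> 2 / (1 + S n)"
      using S_nonneg[of n] by (simp add: divide_right_mono power_le_one)
    then have 2: "norm (s - P n) \<le> 2 / (1 + S n)" using tail_norm[of n] by linarith
    have "(N (s - P n))\<^sup>2 \<le> (norm (star s) + S n) * (2 / (1 + S n))"
      using star_bound[of "s - P n"] mult_mono[OF 1 2] S_nonneg[of n] by simp
    also have "\<dots> \<le> ((norm (star s) + 1) * (1 + S n)) * (2 / (1 + S n))"
      using S_nonneg[of n] by (intro mult_right_mono) (auto simp: algebra_simps)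
    also have "\<dots> = 2 * (norm (star s) + 1)" using S_nonneg[of n] by simp
    finally show ?thesis .
  qed
  have N_neg: "N (- x) = N x" for x
    using scale[of "-1" x] by (simp add: complex_vector.scale_minus_left scaleC_one)
  have N0: "N 0 = 0" using scale[of 0 0] by simp
  \<comment> \<open>Here a n = s - P n - (s - P (n + 1)). The right side has N at most N s + M n +
    constant, the left side at least n + M n, so n would stay bounded.\<close>
  have "real n \<le> N s + sqrt (2 * (norm (star s) + 1))" for n
  proof -
    have "N (P n) \<le> M n"
      unfolding P_def S_eq
    proof (induction n)
      case (Suc n)
      then show ?case using triangle[of "\<Sum>k<n. a k" "a n"] by simp
    qed (simp add: N0)
    moreover have "N (s - P (Suc n)) \<le> sqrt (2 * (norm (star s) + 1))"
      using tail_N by (rule real_le_rsqrt)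
    moreover have "N (a n) \<le> N s + (N (P n) + N (s - P (Suc n)))"
    proof -
      have eq: "a n = s + (- (P n) + - (s - P (Suc n)))" by (simp add: P_def)
      have "N (a n) \<le> N s + N (- (P n) + - (s - P (Suc n)))" by (subst eq) (rule triangle)
      also have "N (- (P n) + - (s - P (Suc n))) \<le> N (P n) + N (s - P (Suc n))"
        using triangle[of "- (P n)" "- (s - P (Suc n))"] unfolding N_neg .
      finally show ?thesis by simp
    qed
    ultimately show ?thesis using a_N[of n] by linarith
  qed
  then show False using reals_Archimedean2 by (meson not_le)
qed

lemma convergent_if_summable_steps:
  fixes X :: "nat \<Rightarrow> 'a::banach"
  assumes "\<And>n. n \<ge> N \<Longrightarrow> norm (X (Suc n) - X n) \<le> c n" and "summable c"
  shows "convergent X"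
proof -
  have "summable (\<lambda>n. X (Suc n) - X n)"
    by (rule summable_comparison_test'[OF assms(2,1)])
  then have "convergent (\<lambda>n. \<Sum>k<n. X (Suc k) - X k)" by (simp add: summable_iff_convergent)
  then have "convergent (\<lambda>n. X n - X 0)" by (simp add: sum_lessThan_telescope)
  then have "convergent (\<lambda>n. (X n - X 0) + X 0)" by (intro convergent_add convergent_const)
  then show ?thesis by simp
qed

text \<open>The factor \<open>z\<close> is the limit of the products \<open>u\<^sub>n \<cdots> u\<^sub>1\<close> of the elements
  \<open>u\<^sub>n = (1 - \<delta>) + \<delta> e\<^sub>n\<close> of the unitization, and \<open>y k\<close> is the limit of \<open>a k u\<^sub>1\<^sup>-\<^sup>1 \<cdots> u\<^sub>n\<^sup>-\<^sup>1\<close>. The product is a parameter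
  since the result is needed for the opposite algebra as well.\<close>

lemma cohen_factorization:
  fixes m :: "'a::banach \<Rightarrow> 'a \<Rightarrow> 'a" and a :: "nat \<Rightarrow> 'a"
  assumes bil: "bounded_bilinear m"
    and assoc: "\<And>x y z. m (m x y) z = m x (m y z)"
    and norm_m: "\<And>x y. norm (m x y) \<le> norm x * norm y"
    and M: "0 \<le> M"
    and unit: "\<And>F \<epsilon>. \<lbrakk>finite F; 0 < \<epsilon>\<rbrakk> \<Longrightarrow>
      \<exists>e. norm e \<le> M \<and> (\<forall>x\<in>F. norm (m e x - x) \<le> \<epsilon> \<and> norm (m x e - x) \<le> \<epsilon>)"
    and a: "\<And>n. norm (a n) \<le> (1/4) ^ n"
  obtains y z where "\<And>n. a n = m (y n) z" "\<And>n. norm (y n) \<le> 3"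
proof -
  interpret m: bounded_bilinear m by (rule bil)
  \<comment> \<open>For norm e \<le> M this makes y -> \<delta> (y - y e) a contraction with factor
    \<delta> (1 + M) = 1/2. Right multiplication by (1 - \<delta>) + \<delta> e is then invertible,
    and \<open>sol b e\<close> below is b times the inverse, found inside the algebra by a fixed
    point.\<close>
  define \<delta> where "\<delta> = 1 / (2 * (M + 1))"
  have \<delta>: "0 < \<delta>" "\<delta> \<le> 1/2" "\<delta> * (1 + M) = 1/2" using M by (auto simp: \<delta>_def field_simps)
  have diff_le: "norm (x - m x e) \<le> (1 + M) * norm x" if "norm e \<le> M" for x e
  proof -
    have "norm (x - m x e) \<le> norm x + norm x * norm e"
      using norm_triangle_ineq4[of x "m x e"] norm_m[of x e] by linarith
    also have "norm x * norm e \<le> norm x * M" using that by (intro mult_left_mono) auto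
    finally show ?thesis by (simp add: algebra_simps)
  qed
  have sol_ex: "\<exists>y. b = (1 - \<delta>) *\<^sub>R y + \<delta> *\<^sub>R m y e" if True: "norm e \<le> M" for b e
  proof -
    have "\<exists>!y. b + \<delta> *\<^sub>R (y - m y e) = y"
    proof (rule banach_fix_type[of "1/2"])
      show "\<forall>x y. dist (b + \<delta> *\<^sub>R (x - m x e)) (b + \<delta> *\<^sub>R (y - m y e)) \<le> 1/2 * dist x y"
      proof (intro allI)
        fix x y
        have "(b + \<delta> *\<^sub>R (x - m x e)) - (b + \<delta> *\<^sub>R (y - m y e)) = \<delta> *\<^sub>R ((x - y) - m (x - y) e)"
          by (simp add: m.diff_left algebra_simps)
        then have "dist (b + \<delta> *\<^sub>R (x - m x e)) (b + \<delta> *\<^sub>R (y - m y e)) = \<delta> * norm ((x - y) - m (x - y) e)"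
          unfolding dist_norm using \<delta> by simp
        also have "\<dots> \<le> \<delta> * ((1 + M) * norm (x - y))"
          using \<delta> diff_le[OF True] by (intro mult_left_mono) auto
        also have "\<dots> = 1/2 * dist x y" using \<delta>(3) by (simp only: mult.assoc[symmetric] dist_norm)
        finally show "dist (b + \<delta> *\<^sub>R (x - m x e)) (b + \<delta> *\<^sub>R (y - m y e)) \<le> 1/2 * dist x y" .
      qed
    qed auto
    then obtain y where "b + \<delta> *\<^sub>R (y - m y e) = y" by blast
    then have "b = y - \<delta> *\<^sub>R (y - m y e)" by (simp only: eq_diff_eq)
    then have "b = (1 - \<delta>) *\<^sub>R y + \<delta> *\<^sub>R m y e" by (simp add: algebra_simps)
    then show ?thesis by blast
  qed
  define sol where "sol b e = (SOME y. b = (1 - \<delta>) *\<^sub>R y + \<delta> *\<^sub>R m y e)" for b e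
  have sol: "b = (1 - \<delta>) *\<^sub>R sol b e + \<delta> *\<^sub>R m (sol b e) e" if "norm e \<le> M" for b e
    unfolding sol_def by (rule someI_ex) (rule sol_ex[OF that])
  have sol_eq: "sol b e - b = \<delta> *\<^sub>R (sol b e - m (sol b e) e)" if "norm e \<le> M" for b e
    using sol[OF that, of b] by (simp add: algebra_simps)
  have sol_norm: "norm (sol b e) \<le> 2 * norm b" if e: "norm e \<le> M" for b e
  proof -
    have "norm (sol b e) \<le> norm b + norm (sol b e - b)" by (rule norm_triangle_sub)
    also have "norm (sol b e - b) \<le> \<delta> * ((1 + M) * norm (sol b e))"
      unfolding sol_eq[OF e] using \<delta> diff_le[OF e] by simp
    also have "\<dots> = 1/2 * norm (sol b e)" using \<delta>(3) by (simp only: mult.assoc[symmetric])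
    finally show ?thesis by simp
  qed
  \<comment> \<open>In the fixed point equation for w = sol b e - b half of norm w is absorbed, so
    solving moves b no further than multiplication by e does.\<close>
  have sol_diff: "norm (sol b e - b) \<le> norm (m b e - b)" if e: "norm e \<le> M" for b e
  proof -
    let ?w = "sol b e - b"
    have "?w = \<delta> *\<^sub>R (b - m b e) + \<delta> *\<^sub>R (?w - m ?w e)"
      using sol_eq[OF e, of b] by (simp add: m.diff_left algebra_simps)
    then have "norm ?w \<le> norm (\<delta> *\<^sub>R (b - m b e)) + norm (\<delta> *\<^sub>R (?w - m ?w e))"
      by (metis norm_triangle_ineq)
    also have "norm (\<delta> *\<^sub>R (b - m b e)) \<le> 1/2 * norm (m b e - b)"
      unfolding norm_scaleR norm_minus_commute[of "m b e"] using \<delta> by (intro mult_right_mono) auto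
    also have "norm (\<delta> *\<^sub>R (?w - m ?w e)) \<le> \<delta> * ((1 + M) * norm ?w)"
      using \<delta> diff_le[OF e, of ?w] by simp
    also have "\<dots> = 1/2 * norm ?w" using \<delta>(3) by (simp only: mult.assoc[symmetric])
    finally show ?thesis by simp
  qed
  define ee where "ee F \<epsilon> =
    (SOME e. norm e \<le> M \<and> (\<forall>x\<in>F. norm (m e x - x) \<le> \<epsilon> \<and> norm (m x e - x) \<le> \<epsilon>))" for F \<epsilon>
  have ee: "norm (ee F \<epsilon>) \<le> M \<and> (\<forall>x\<in>F. norm (m (ee F \<epsilon>) x - x) \<le> \<epsilon> \<and> norm (m x (ee F \<epsilon>) - x) \<le> \<epsilon>)"
    if "finite F" "0 < \<epsilon>" for F \<epsilon>
    unfolding ee_def by (rule someI_ex) (rule unit[OF that])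
  \<comment> \<open>(1 - \<delta>)^n + z n is the product of the first n factors, split into its
    scalar part and its part in the algebra; the recursion for z is left multiplication by (1 -
    \<delta>) + \<delta> e. At stage n the element e acts as a unit, up to (1/2)^n, on z and on the
    finitely many Y k with k \<le> n.\<close>
  define st where
    "st = rec_nat (a, 0) (\<lambda>n (Y, z). let e = ee (insert z (Y ` {..n})) ((1/2) ^ n) in
       (\<lambda>k. sol (Y k) e, ((1 - \<delta>) ^ n * \<delta>) *\<^sub>R e + (1 - \<delta>) *\<^sub>R z + \<delta> *\<^sub>R m e z))"
  define Y z where "Y n = fst (st n)" and "z n = snd (st n)" for n
  define e where "e n = ee (insert (z n) (Y n ` {..n})) ((1/2) ^ n)" for n
  have Y0: "Y 0 = a" "z 0 = 0" by (simp_all add: Y_def z_def st_def)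
  have YSuc: "Y (Suc n) k = sol (Y n k) (e n)" for n k
    by (simp add: Y_def z_def e_def st_def case_prod_unfold Let_def)
  have zSuc: "z (Suc n) = ((1 - \<delta>) ^ n * \<delta>) *\<^sub>R e n + (1 - \<delta>) *\<^sub>R z n + \<delta> *\<^sub>R m (e n) (z n)" for n
    by (simp add: Y_def z_def e_def st_def case_prod_unfold Let_def)
  have eM: "norm (e n) \<le> M" and ez: "norm (m (e n) (z n) - z n) \<le> (1/2) ^ n" for n
    unfolding e_def using ee[of "insert (z n) (Y n ` {..n})" "(1/2) ^ n"] by auto
  have eY: "norm (m (Y n k) (e n) - Y n k) \<le> (1/2) ^ n" if "k \<le> n" for n k
    unfolding e_def using ee[of "insert (z n) (Y n ` {..n})" "(1/2) ^ n"] that by auto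
  have Y_step: "norm (Y (Suc n) k - Y n k) \<le> (1/2) ^ n" if "k \<le> n" for n k
    unfolding YSuc using sol_diff[OF eM] eY[OF that] by (meson order_trans)
  have factor: "a k = (1 - \<delta>) ^ n *\<^sub>R Y n k + m (Y n k) (z n)" for n k
  proof (induction n)
    case 0 then show ?case by (simp add: Y0 m.zero_right)
  next
    case (Suc n)
    let ?y = "Y (Suc n) k"
    have y: "Y n k = (1 - \<delta>) *\<^sub>R ?y + \<delta> *\<^sub>R m ?y (e n)" unfolding YSuc by (rule sol[OF eM])
    have "a k = (1 - \<delta>) ^ n *\<^sub>R ((1 - \<delta>) *\<^sub>R ?y + \<delta> *\<^sub>R m ?y (e n))
        + m ((1 - \<delta>) *\<^sub>R ?y + \<delta> *\<^sub>R m ?y (e n)) (z n)"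
      using Suc unfolding y[symmetric] .
    also have "\<dots> = (1 - \<delta>) ^ Suc n *\<^sub>R ?y + m ?y (z (Suc n))"
      unfolding zSuc
      by (simp only: m.add_left m.add_right m.scaleR_left m.scaleR_right assoc scaleR_add_right
          scaleR_scaleR power_Suc2 add.assoc)
    finally show ?case .
  qed
  have pre: "norm (Y n k) \<le> 2 ^ n * norm (a k)" for n k
  proof (induction n)
    case (Suc n)
    then show ?case unfolding YSuc using sol_norm[OF eM, of "Y n k" n] by simp
  qed (simp add: Y0)
  \<comment> \<open>During the first k steps the only control is that each step at most doubles the
    norm; the decay (1/4)^k absorbs these k doublings. From step k on the increments are at most
    (1/2)^n, with sum at most 2.\<close>
  have bnd: "norm (Y n k) \<le> 3" if "k \<le> n" for n k
  proof -
    have "norm (Y n k) \<le> 1 + 2 * ((1/2) ^ k - (1/2) ^ n)"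
      using that
    proof (induction n rule: dec_induct)
      case base
      have "norm (Y k k) \<le> 2 ^ k * norm (a k)" by (rule pre)
      also have "\<dots> \<le> 2 ^ k * (1/4) ^ k" using a by (intro mult_left_mono) auto
      also have "\<dots> = (1/2) ^ k" by (simp add: power_mult_distrib[symmetric])
      also have "\<dots> \<le> 1" by (simp add: power_le_one)
      finally show ?case by simp
    next
      case (step n)
      then show ?case using Y_step[of k n] norm_triangle_sub[of "Y (Suc n) k" "Y n k"] by simp
    qed
    moreover have "(1/2::real) ^ k \<le> 1" "0 \<le> (1/2::real) ^ n" by (auto simp: power_le_one)
    ultimately show ?thesis by argo
  qed
  have "convergent (\<lambda>n. Y n k)" for k
    by (rule convergent_if_summable_steps[of k _ "\<lambda>n. (1/2) ^ n"])
      (auto intro: Y_step summable_geometric)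
  then obtain y where y: "\<And>k. (\<lambda>n. Y n k) \<longlonglongrightarrow> y k" unfolding convergent_def by metis
  have "convergent z"
  proof (rule convergent_if_summable_steps[of 0 _ "\<lambda>n. M * (1 - \<delta>) ^ n + (1/2) ^ n"])
    show "summable (\<lambda>n. M * (1 - \<delta>) ^ n + (1/2) ^ n)"
      using \<delta> by (intro summable_add summable_mult summable_geometric) auto
    fix n
    have "z (Suc n) - z n = \<delta> *\<^sub>R ((1 - \<delta>) ^ n *\<^sub>R e n + (m (e n) (z n) - z n))"
      by (simp add: zSuc algebra_simps)
    then have "norm (z (Suc n) - z n) = \<delta> * norm ((1 - \<delta>) ^ n *\<^sub>R e n + (m (e n) (z n) - z n))"
      using \<delta> by simp
    also have "\<dots> \<le> 1 * norm ((1 - \<delta>) ^ n *\<^sub>R e n + (m (e n) (z n) - z n))"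
      using \<delta> by (intro mult_right_mono) auto
    also have "\<dots> \<le> norm ((1 - \<delta>) ^ n *\<^sub>R e n) + norm (m (e n) (z n) - z n)"
      unfolding mult_1_left by (rule norm_triangle_ineq)
    also have "norm ((1 - \<delta>) ^ n *\<^sub>R e n) \<le> M * (1 - \<delta>) ^ n"
      using \<delta> eM[of n] by (simp add: norm_power mult.commute mult_right_mono)
    finally show "norm (z (Suc n) - z n) \<le> M * (1 - \<delta>) ^ n + (1/2) ^ n" using ez[of n] by simp
  qed
  then obtain z' where z': "z \<longlonglongrightarrow> z'" unfolding convergent_def by metis
  show thesis
  proof
    show "a k = m (y k) z'" for k
    proof -
      have "(\<lambda>n. (1 - \<delta>) ^ n *\<^sub>R Y n k + m (Y n k) (z n)) \<longlonglongrightarrow> 0 *\<^sub>R y k + m (y k) z'"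
        using \<delta> by (intro tendsto_add tendsto_scaleR LIMSEQ_realpow_zero m.tendsto y z') auto
      then have "(\<lambda>n::nat. a k) \<longlonglongrightarrow> m (y k) z'" by (simp flip: factor)
      then show ?thesis by (simp add: LIMSEQ_const_iff)
    qed
    show "norm (y k) \<le> 3" for k
      by (rule LIMSEQ_le_const2[OF tendsto_norm[OF y]]) (use bnd in blast)
  qed
qed

text \<open>If q were unbounded, there would be a n of norm at most (1/4)^n with q (a n) \<ge> n.
  Cohen's theorem gives them a common right factor z and bounded left factors, against the bound on
  multiples of z.\<close>

lemma bounded_if_bounded_on_multiples:
  fixes m :: "'a::banach \<Rightarrow> 'a \<Rightarrow> 'a" and q :: "'a \<Rightarrow> real"
  assumes bil: "bounded_bilinear m"
    and assoc: "\<And>x y z. m (m x y) z = m x (m y z)"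
    and norm_m: "\<And>x y. norm (m x y) \<le> norm x * norm y"
    and M: "0 \<le> M"
    and unit: "\<And>F \<epsilon>. \<lbrakk>finite F; 0 < \<epsilon>\<rbrakk> \<Longrightarrow>
      \<exists>e. norm e \<le> M \<and> (\<forall>x\<in>F. norm (m e x - x) \<le> \<epsilon> \<and> norm (m x e - x) \<le> \<epsilon>)"
    and hom: "\<And>r x. q (r *\<^sub>R x) = \<bar>r\<bar> * q x"
    and mult: "\<And>z. \<exists>C. \<forall>y. q (m y z) \<le> C * norm y"
  shows "\<exists>K. \<forall>x. q x \<le> K * norm x"
proof (rule ccontr)
  assume unb: "\<not> ?thesis"
  have "\<exists>x. norm x \<le> (1/4) ^ n \<and> real n \<le> q x" for n :: nat
    by (rule unbounded_homogeneous[of q "(1/4) ^ n" "real n", OF hom unb]) auto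
  then obtain a where a: "\<And>n. norm (a n) \<le> (1/4) ^ n" "\<And>n. real n \<le> q (a n)" by metis
  obtain y z where yz: "\<And>n. a n = m (y n) z" "\<And>n. norm (y n) \<le> 3"
    using cohen_factorization[OF bil assoc norm_m M unit a(1)] by metis
  obtain C where C: "\<And>y. q (m y z) \<le> C * norm y" using mult by metis
  have "real n \<le> \<bar>C\<bar> * 3" for n
  proof -
    have "real n \<le> C * norm (y n)" using a(2)[of n] C[of "y n"] yz(1)[of n] by simp
    also have "\<dots> \<le> \<bar>C\<bar> * 3" using yz(2)[of n] by (intro mult_mono) auto
    finally show ?thesis .
  qed
  then show False using reals_Archimedean2 by (meson not_le)
qed

section \<open>Square roots and positive functionals\<close>

lemma commutant_closed: "closed {w :: 'a::real_normed_algebra. \<forall>x. x * u = u * x \<longrightarrow> x * w = w * x}"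
proof -
  have "{w. \<forall>x. x * u = u * x \<longrightarrow> x * w = w * x} = (\<Inter>x\<in>{x. x * u = u * x}. {w. x * w = w * x})"
    by auto
  moreover have "closed {w. x * w = w * x}" for x :: 'a
    by (intro closed_Collect_eq continuous_intros)
  ultimately show ?thesis by auto
qed

text \<open>1 + w is the inverse of 1 - u, that is, w = u + u^2 + ... . The fixed point is sought in
  the closed set of elements that commute with everything commuting with u, so the last property
  comes with it.\<close>

lemma quasi_inverse:
  fixes u :: "'a::complex_banach_algebra"
  assumes "norm u < 1"
  obtains w where "u * w = w - u" "w * u = w - u" "\<And>x. x * u = u * x \<Longrightarrow> x * w = w * x"
proof -
  let ?S = "{w. \<forall>x. x * u = u * x \<longrightarrow> x * w = w * x}"
  have "\<exists>!w\<in>?S. u + u * w = w"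
  proof (rule Banach_fix)
    show "complete ?S" by (simp add: complete_eq_closed commutant_closed)
    show "?S \<noteq> {}" by (auto intro!: exI[of _ 0])
    show "(\<lambda>w. u + u * w) ` ?S \<subseteq> ?S"
    proof (rule image_subsetI, rule CollectI, intro allI impI)
      fix w x assume w: "w \<in> ?S" and x: "x * u = u * x"
      have "x * (u * w) = u * (w * x)"
        using w x by (metis (mono_tags, lifting) mem_Collect_eq mult.assoc)
      then show "x * (u + u * w) = (u + u * w) * x" using x by (simp add: algebra_simps)
    qed
    show "dist (u + u * w) (u + u * w') \<le> norm u * dist w w'" for w w'
      using norm_mult_ineq[of u "w - w'"] by (simp add: dist_norm right_diff_distrib)
  qed (use assms in auto)
  then obtain w where w: "w \<in> ?S" "u + u * w = w" by blast
  have "u * w = w * u" using w(1) by blast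
  then show thesis using that[of w] w by (auto simp: algebra_simps)
qed

lemma star_scaleR: "star (r *\<^sub>R x) = r *\<^sub>R star (x :: 'a::banach_star_algebra)"
  by (simp add: scaleR_scaleC star_scaleC)

text \<open>In the corner \<open>pAp\<close> the spectrum of \<open>p - pu\<close> lies in the open right half plane, and in
  the open left half plane since \<open>p - pu\<close> is skew.\<close>

lemma skew_corner_trivial:
  fixes p u :: "'a::banach_star_algebra"
  assumes pp: "p * p = p" and sp: "star p = p" and pu: "p * u = u * p" and nu: "norm u < 1"
    and skew: "star (p - p * u) = - (p - p * u)"
  shows "p = 0"
proof (rule ccontr)
  assume p0: "p \<noteq> 0"
  define \<sigma> where "\<sigma> = p - p * u"
  have p\<sigma>: "p * \<sigma> = \<sigma>" "\<sigma> * p = \<sigma>"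
    using pp pu by (simp_all add: \<sigma>_def algebra_simps) (metis mult.assoc)+
  have right: "\<exists>\<psi>. p * \<psi> = \<psi> \<and> \<psi> * p = \<psi> \<and> \<psi> * (l *\<^sub>C p + \<sigma>) = p \<and> (l *\<^sub>C p + \<sigma>) * \<psi> = p"
    if l: "0 \<le> Re l" for l
  proof -
    \<comment> \<open>l p + \<sigma> = \<mu> (p - p u / \<mu>), and Re l \<ge> 0 gives cmod \<mu>
      \<ge> 1. So u / \<mu> has norm below 1 and the quasi-inverse applies.\<close>
    define \<mu> where "\<mu> = l + 1"
    have "1 \<le> Re \<mu>" using l by (simp add: \<mu>_def)
    then have \<mu>: "1 \<le> cmod \<mu>" using complex_Re_le_cmod[of \<mu>] by linarith
    then have \<mu>0: "\<mu> \<noteq> 0" by auto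
    define v where "v = inverse \<mu> *\<^sub>C u"
    have "norm v \<le> 1 * norm u"
      unfolding v_def norm_scaleC using \<mu> by (intro mult_right_mono) (auto simp: norm_inverse inverse_le_1_iff)
    then have nv: "norm v < 1" using nu by simp
    obtain w where w: "v * w = w - v" "w * v = w - v" "\<And>x. x * v = v * x \<Longrightarrow> x * w = w * x"
      using quasi_inverse[OF nv] by metis
    have pv: "p * v = v * p" by (simp add: v_def mult_scaleC_left mult_scaleC_right pu)
    have pw: "w * p = p * w" using w(3)[OF pv] by simp
    have eq: "l *\<^sub>C p + \<sigma> = \<mu> *\<^sub>C (p - p * v)"
    proof -
      have "\<mu> *\<^sub>C (p - p * v) = \<mu> *\<^sub>C p - p * u"
        using \<mu>0 by (simp add: v_def complex_vector.scale_right_diff_distrib mult_scaleC_right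
            scaleC_scaleC scaleC_one)
      then show ?thesis by (simp add: \<mu>_def \<sigma>_def scaleC_add_left scaleC_one)
    qed
    have lft: "x * (p * y) = p * (x * y)" if "x * p = p * x" for x y
      using that by (metis mult.assoc)
    have ppl: "p * (p * y) = p * y" for y using pp by (metis mult.assoc)
    have 1: "(p + p * w) * (p - p * v) = p" "(p - p * v) * (p + p * w) = p"
      using pp pw pv[symmetric] w(1,2)
      by (simp_all add: distrib_left distrib_right left_diff_distrib right_diff_distrib mult.assoc
          lft ppl)
    show ?thesis
    proof (intro exI conjI)
      let ?\<psi> = "inverse \<mu> *\<^sub>C (p + p * w)"
      show "p * ?\<psi> = ?\<psi>" "?\<psi> * p = ?\<psi>"
        using pp pw ppl by (simp_all add: mult_scaleC_left mult_scaleC_right distrib_left distrib_right mult.assoc)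
      show "?\<psi> * (l *\<^sub>C p + \<sigma>) = p" "(l *\<^sub>C p + \<sigma>) * ?\<psi> = p"
        unfolding eq using \<mu>0 1
        by (simp_all add: mult_scaleC_left mult_scaleC_right scaleC_scaleC scaleC_one)
    qed
  qed
  \<comment> \<open>As \<sigma> is skew, star maps (- cnj l) p + \<sigma> to - (l p + \<sigma>),
    which transports inverses from the right half plane to the left one.\<close>
  have all: "\<exists>\<psi>. p * \<psi> = \<psi> \<and> \<psi> * p = \<psi> \<and> \<psi> * (l *\<^sub>C p + \<sigma>) = p \<and> (l *\<^sub>C p + \<sigma>) * \<psi> = p" for l
  proof (cases "0 \<le> Re l")
    case False
    then obtain \<psi> where \<psi>: "p * \<psi> = \<psi>" "\<psi> * p = \<psi>" "\<psi> * ((- cnj l) *\<^sub>C p + \<sigma>) = p" "((- cnj l) *\<^sub>C p + \<sigma>) * \<psi> = p"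
      using right[of "- cnj l"] by auto
    have st: "star ((- cnj l) *\<^sub>C p + \<sigma>) = - (l *\<^sub>C p + \<sigma>)"
    proof -
      have "star \<sigma> = - \<sigma>" using skew by (simp only: \<sigma>_def)
      then show ?thesis using sp by (simp add: star_add star_scaleC star_minus star_diff complex_vector.scale_minus_left)
    qed
    show ?thesis
    proof (intro exI conjI)
      let ?\<psi> = "- star \<psi>"
      show "p * ?\<psi> = ?\<psi>" "?\<psi> * p = ?\<psi>"
        using \<psi>(1,2) sp star_mult[of \<psi> p] star_mult[of p \<psi>] by simp_all
      show "?\<psi> * (l *\<^sub>C p + \<sigma>) = p" "(l *\<^sub>C p + \<sigma>) * ?\<psi> = p"
        using arg_cong[OF \<psi>(4), of star] arg_cong[OF \<psi>(3), of star]
        by (simp_all only: star_mult st sp mult_minus_right mult_minus_left)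
    qed
  qed (rule right)
  \<comment> \<open>The choice l = 0 inverts \<sigma> itself, and l = - 1/z inverts p - z \<sigma>
    up to the scalar - z. So \<sigma> would be an invertible element of the corner with empty
    spectrum.\<close>
  obtain \<rho> where \<rho>: "\<rho> * p = \<rho>" "\<rho> * \<sigma> = p" using all[of 0] by auto
  have "\<exists>\<phi>. corner_inverse p (z *\<^sub>C \<sigma>) \<phi>" for z
  proof (cases "z = 0")
    case True
    then show ?thesis using pp by (auto simp: corner_inverse_def)
  next
    case False
    obtain \<psi> where \<psi>: "p * \<psi> = \<psi>" "\<psi> * p = \<psi>"
      "\<psi> * ((- inverse z) *\<^sub>C p + \<sigma>) = p" "((- inverse z) *\<^sub>C p + \<sigma>) * \<psi> = p"
      using all by blast
    have eq: "p - z *\<^sub>C \<sigma> = (- z) *\<^sub>C ((- inverse z) *\<^sub>C p + \<sigma>)"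
      using False by (simp add: scaleC_add_right scaleC_scaleC scaleC_one complex_vector.scale_minus_left
          complex_vector.scale_right_diff_distrib)
    have "corner_inverse p (z *\<^sub>C \<sigma>) ((- inverse z) *\<^sub>C \<psi>)"
      unfolding corner_inverse_def eq using False \<psi>
      by (simp add: mult_scaleC_left mult_scaleC_right scaleC_scaleC scaleC_one del: complex_vector.scale_minus_left)
    then show ?thesis by blast
  qed
  then show False using corner_spectrum_nonempty[OF pp p0 p\<sigma> \<rho>(2,1)] by blast
qed

text \<open>Ford's square root lemma: \<open>(1 - u)\<^sup>2 = 1 - h\<close>. As the involution may be discontinuous,
  \<open>star u = u\<close> does not follow from a power series; instead, \<open>1 - star u\<close> is another root that commutes with
  \<open>1 - u\<close>, hence equal to \<open>(1 - u) (1 - 2p)\<close> for an idempotent \<open>p\<close>, which vanishes by the previous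
  lemma.\<close>

lemma ford_square_root:
  fixes h :: "'a::banach_star_algebra"
  assumes sh: "star h = h" and nh: "norm h < 1"
  obtains u where "star u = u" "u + u - u * u = h"
proof -
  \<comment> \<open>The smaller root of \<kappa> = (norm h + \<kappa>^2) / 2. The ball of this
    radius is mapped into itself by u -> (h + u^2) / 2, with Lipschitz constant \<kappa> <
    1.\<close>
  define \<kappa> where "\<kappa> = 1 - sqrt (1 - norm h)"
  have \<kappa>: "0 \<le> \<kappa>" "\<kappa> < 1" using nh by (auto simp: \<kappa>_def)
  have "(sqrt (1 - norm h))\<^sup>2 = 1 - norm h" using nh by simp
  then have \<kappa>2: "norm h + \<kappa> * \<kappa> = 2 * \<kappa>" by (simp add: \<kappa>_def power2_eq_square algebra_simps)
  let ?S = "cball 0 \<kappa> \<inter> {w. \<forall>x. x * h = h * x \<longrightarrow> x * w = w * x}"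
  have "\<exists>!u\<in>?S. (1/2) *\<^sub>R (h + u * u) = u"
  proof (rule Banach_fix)
    show "complete ?S" by (auto simp: complete_eq_closed intro!: closed_Int commutant_closed)
    have "0 \<in> ?S" using \<kappa> by simp
    then show "?S \<noteq> {}" by blast
    show "(\<lambda>u. (1/2) *\<^sub>R (h + u * u)) ` ?S \<subseteq> ?S"
    proof (rule image_subsetI, rule IntI)
      fix u assume u: "u \<in> ?S"
      have "norm (h + u * u) \<le> norm h + norm u * norm u"
        using norm_triangle_ineq[of h "u * u"] norm_mult_ineq[of u u] by linarith
      also have "norm u * norm u \<le> \<kappa> * \<kappa>" using u \<kappa> by (intro mult_mono) auto
      finally show "(1/2) *\<^sub>R (h + u * u) \<in> cball 0 \<kappa>" using \<kappa>2 by simp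
      show "(1/2) *\<^sub>R (h + u * u) \<in> {w. \<forall>x. x * h = h * x \<longrightarrow> x * w = w * x}"
      proof (rule CollectI, intro allI impI)
        fix x assume x: "x * h = h * x"
        then have "x * u = u * x" using u by blast
        then have "x * (u * u) = u * (u * x)" by (metis mult.assoc)
        then show "x * ((1/2) *\<^sub>R (h + u * u)) = ((1/2) *\<^sub>R (h + u * u)) * x"
          using x by (simp add: distrib_left distrib_right mult.assoc)
      qed
    qed
    show "dist ((1/2) *\<^sub>R (h + u * u)) ((1/2) *\<^sub>R (h + v * v)) \<le> \<kappa> * dist u v"
      if "u \<in> ?S" "v \<in> ?S" for u v
    proof -
      have "(1/2) *\<^sub>R (h + u * u) - (1/2) *\<^sub>R (h + v * v) = (1/2) *\<^sub>R (u * (u - v) + (u - v) * v)"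
        by (simp add: algebra_simps)
      then have "dist ((1/2) *\<^sub>R (h + u * u)) ((1/2) *\<^sub>R (h + v * v))
          \<le> 1/2 * (norm (u * (u - v)) + norm ((u - v) * v))"
        unfolding dist_norm using norm_triangle_ineq[of "u * (u - v)" "(u - v) * v"] by simp
      also have "\<dots> \<le> 1/2 * (norm u * norm (u - v) + norm (u - v) * norm v)"
        by (intro mult_left_mono add_mono norm_mult_ineq) auto
      also have "\<dots> \<le> 1/2 * (\<kappa> * norm (u - v) + norm (u - v) * \<kappa>)"
        using that \<kappa> by (intro mult_left_mono add_mono mult_mono) auto
      finally show ?thesis by (simp add: dist_norm mult.commute)
    qed
  qed (use \<kappa> in auto)
  then obtain u where uS: "u \<in> ?S" and fix_u: "(1/2) *\<^sub>R (h + u * u) = u" by blast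
  have u: "norm u \<le> \<kappa>" "\<And>x. x * h = h * x \<Longrightarrow> x * u = u * x" using uS by auto
  have "2 *\<^sub>R ((1/2) *\<^sub>R (h + u * u)) = 2 *\<^sub>R u" by (simp only: fix_u)
  then have "h + u * u = 2 *\<^sub>R u" by simp
  then have hu: "h = u + u - u * u" by (simp add: scaleR_2 eq_diff_eq)
  have nu: "norm u < 1" using u(1) \<kappa> by simp
  define v where "v = star u"
  have hv: "h = v + v - v * v"
    using arg_cong[OF hu, of star] sh by (simp add: v_def star_add star_diff star_mult)
  have hu_comm: "h * u = u * h" using u(2)[of h] by simp
  have "v * h = h * v" using arg_cong[OF hu_comm, of star] sh by (simp add: star_mult v_def)
  then have vu: "v * u = u * v" by (rule u(2))
  obtain w where w: "u * w = w - u" "w * u = w - u" "\<And>x. x * u = u * x \<Longrightarrow> x * w = w * x"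
    using quasi_inverse[OF nu] by metis
  have vw: "v * w = w * v" by (rule w(3)) (rule vu)
  define d where "d = v - u"
  have vv: "v * v = v + v - u - u + u * u" using hu hv by (simp add: algebra_simps)
  have sd: "star d = - d" by (simp add: d_def v_def star_diff star_star)
  define w' where "w' = star w"
  have w': "w' * v = w' - v" "v * w' = w' - v"
    using arg_cong[OF w(1), of star] arg_cong[OF w(2), of star]
    by (simp_all add: star_mult star_diff w'_def v_def)
  \<comment> \<open>As 1 + w inverts 1 - u, X is d / (1 - u), and 1 - v = (1 - u) (1 - X). The
    equation (1 - u)^2 = (1 - v)^2 means d^2 = 2 d (1 - u), whence X^2 = 2 X: the idempotent is p =
    X / 2.\<close>
  define X where "X = d + d * w"
  have uw: "u * w = w * u" using w(1,2) by simp
  have du: "d * u = u * d" "d * v = v * d" "d * w = w * d"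
    using vu vw uw by (simp_all add: d_def left_diff_distrib right_diff_distrib)
  have dd: "d * d = 2 *\<^sub>R (d - u * d)"
    using vv vu by (simp add: d_def algebra_simps scaleR_2)
  have d2: "d * u + d * v = 2 *\<^sub>R d"
    using vv vu by (simp add: d_def algebra_simps scaleR_2)
  have ddX: "d * X = 2 *\<^sub>R d"
  proof -
    have "d * X = d * d + d * d * w" by (simp add: X_def distrib_left mult.assoc)
    also have "\<dots> = 2 *\<^sub>R (d - d * u + d * w - d * (u * w))"
      by (simp add: dd du(1)[symmetric] left_diff_distrib mult.assoc scaleR_diff_right scaleR_add_right algebra_simps)
    also have "\<dots> = 2 *\<^sub>R d" by (simp add: w(1) right_diff_distrib)
    finally show ?thesis .
  qed
  have wX: "w * X = X * w"
    by (simp add: X_def distrib_left distrib_right mult.assoc du(3))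
  have XX: "X * X = 2 *\<^sub>R X"
  proof -
    have "X * X = d * X + d * (w * X)" by (simp add: X_def distrib_right mult.assoc)
    also have "\<dots> = d * X + d * X * w" by (simp add: wX mult.assoc)
    also have "\<dots> = 2 *\<^sub>R (d + d * w)" by (simp only: ddX mult_scaleR_left scaleR_add_right)
    finally show ?thesis unfolding X_def[symmetric] .
  qed
  have Xu: "X * u = X - d" "u * X = X - d"
  proof -
    have "X * u = d * u + d * (w * u)" by (simp only: X_def distrib_right mult.assoc)
    then show Xu: "X * u = X - d" by (simp only: w(2) right_diff_distrib) (simp add: X_def)
    have "u * X = d * u + d * (u * w)"
      by (simp only: X_def distrib_left mult.assoc[symmetric] du(1))
    then show "u * X = X - d" by (simp only: w(1) right_diff_distrib) (simp add: X_def)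
  qed
  have sX: "star X = X"
  proof -
    have sX: "star X = - (d + d * w')"
      using arg_cong[OF du(3), of star] by (simp add: X_def star_add star_mult sd w'_def)
    \<comment> \<open>Z is X - star X. The identity Z v = Z says Z (1 - v) = 0, and 1 - v has the
      inverse 1 + star w, so Z = 0.\<close>
    define Z where "Z = X + (d + d * w')"
    have "X * v = X + d"
    proof -
      have dv: "d * v = 2 *\<^sub>R d - d * u" using d2 by (simp add: algebra_simps)
      have "X * v = d * v + d * v * w" using vw by (simp add: X_def distrib_right mult.assoc)
      also have "\<dots> = 2 *\<^sub>R X - (d * u + d * (u * w))"
        by (simp add: dv X_def left_diff_distrib scaleR_add_right mult.assoc)
      also have "d * u + d * (u * w) = X * u"
        by (simp only: X_def distrib_right mult.assoc uw)
      finally show ?thesis by (simp add: Xu scaleR_2)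
    qed
    moreover have "(d + d * w') * v = d * w'"
      using w'(1) by (simp add: distrib_right mult.assoc right_diff_distrib)
    ultimately have Zv: "Z * v = Z" by (simp add: Z_def distrib_right)
    have "Z * w' = Z * v * w'" by (simp add: Zv)
    also have "\<dots> = Z * w' - Z * v" by (simp add: mult.assoc w'(2) right_diff_distrib)
    finally have "Z = 0" by (simp add: Zv)
    then show ?thesis unfolding sX Z_def by (simp add: eq_neg_iff_add_eq_0 neg_eq_iff_add_eq_0 add_eq_0_iff)
  qed
  \<comment> \<open>For p = X / 2 the element p - p u equals d / 2, which is skew because d = star u
    - u.\<close>
  have "(1/2) *\<^sub>R X = 0"
  proof (rule skew_corner_trivial)
    show "(1/2) *\<^sub>R X * (1/2) *\<^sub>R X = (1/2) *\<^sub>R X" by (simp add: XX)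
    show "star ((1/2) *\<^sub>R X) = (1/2) *\<^sub>R X" by (simp add: star_scaleR sX)
    show "(1/2) *\<^sub>R X * u = u * (1/2) *\<^sub>R X" by (simp add: Xu)
    show "star ((1/2) *\<^sub>R X - (1/2) *\<^sub>R X * u) = - ((1/2) *\<^sub>R X - (1/2) *\<^sub>R X * u)"
      by (simp add: Xu star_diff star_scaleR sX sd scaleR_diff_right)
  qed (rule nu)
  then have "d = 0" using Xu by simp
  then have "star u = u" by (simp add: d_def v_def)
  then show thesis using that hu by simp
qed

text \<open>For c > norm h, \<open>ford_square_root\<close> writes 1 - h / c as (1 - u)^2 with u
  selfadjoint, so star x (1 - h / c) x is the product of star (x - u x) and x - u x, and f is
  nonnegative there. Then c decreases to norm h.\<close>

lemma positive_functional_le: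
  fixes f :: "'a::banach_star_algebra \<Rightarrow> complex"
  assumes f: "positive_functional f" and sh: "star h = h"
  shows "Re (f (star x * (h * x))) \<le> norm h * Re (f (star x * x))"
proof -
  interpret f: Vector_Spaces.linear scaleC scaleC f using f by (simp add: positive_functional_def)
  have pos: "0 \<le> Re (f (star a * a))" for a
    using f by (auto simp: positive_functional_def complex_nonneg_Reals_iff)
  let ?B = "Re (f (star x * x))"
  have *: "Re (f (star x * (h * x))) \<le> c * ?B" if c: "norm h < c" for c
  proof -
    have c0: "0 < c" using c norm_ge_zero[of h] by linarith
    have "norm ((1/c) *\<^sub>R h) < 1" using c c0 by simp
    then obtain u where u: "star u = u" "u + u - u * u = (1/c) *\<^sub>R h"
      using ford_square_root[of "(1/c) *\<^sub>R h"] sh by (metis star_scaleR)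
    have "star (x - u * x) * (x - u * x) = star x * x - star x * ((u + u - u * u) * x)"
      by (simp add: star_diff star_mult u(1) algebra_simps)
    also have "\<dots> = star x * x - complex_of_real (1/c) *\<^sub>C (star x * (h * x))"
      unfolding u(2) by (simp add: scaleR_scaleC mult_scaleC_left mult_scaleC_right)
    finally have "f (star (x - u * x) * (x - u * x)) = f (star x * x) - of_real (1/c) * f (star x * (h * x))"
      by (simp add: f.diff f.scale scaleC_complex_def)
    then have "0 \<le> ?B - 1/c * Re (f (star x * (h * x)))" using pos[of "x - u * x"] by simp
    then show ?thesis using c0 by (simp add: field_simps)
  qed
  show ?thesis
  proof (rule field_le_epsilon)
    fix \<epsilon> :: real assume \<epsilon>: "0 < \<epsilon>"
    define c where "c = norm h + \<epsilon> / (?B + 1)"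
    have "Re (f (star x * (h * x))) \<le> c * ?B" using \<epsilon> pos[of x] by (intro *) (simp add: c_def)
    also have "c * ?B = norm h * ?B + \<epsilon> * (?B / (?B + 1))" by (simp add: c_def algebra_simps)
    also have "\<epsilon> * (?B / (?B + 1)) \<le> \<epsilon> * 1" using \<epsilon> pos[of x] by (intro mult_left_mono) auto
    finally show "Re (f (star x * (h * x))) \<le> norm h * ?B + \<epsilon>" by simp
  qed
qed

section \<open>The seminorm of a positive functional\<close>

lemma assoc_op_semi_inner:
  assumes "positive_functional f"
  shows "semi_inner UNIV (assoc_op f)"
proof -
  interpret f: Vector_Spaces.linear scaleC scaleC f using assms by (simp add: positive_functional_def)
  show ?thesis
    by (rule positive_sesquilinear_semi_inner)
      (use assms in \<open>auto simp: assoc_op_def f.add f.scale distrib_left distrib_right star_add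
        star_scaleC mult_scaleC_left mult_scaleC_right scaleC_complex_def positive_functional_def\<close>)
qed

definition gns_seminorm :: "('a::banach_star_algebra \<Rightarrow> complex) \<Rightarrow> 'a \<Rightarrow> real"
  where "gns_seminorm f = semi_inner.snorm (assoc_op f)"

lemma gns_seminorm_mult_power2:
  assumes f: "positive_functional f"
  shows "(gns_seminorm f (a * x))\<^sup>2 \<le> norm (star a * a) * (gns_seminorm f x)\<^sup>2"
proof -
  interpret semi_inner UNIV "assoc_op f" by (rule assoc_op_semi_inner[OF f])
  have sq: "(gns_seminorm f y)\<^sup>2 = Re (f (star y * y))" for y
    unfolding gns_seminorm_def using snorm_power2[of y] by (simp only: UNIV_I assoc_op_def)
  have "(gns_seminorm f (a * x))\<^sup>2 = Re (f (star x * ((star a * a) * x)))"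
    by (simp add: sq star_mult mult.assoc)
  also have "\<dots> \<le> norm (star a * a) * Re (f (star x * x))"
    by (rule positive_functional_le[OF f]) (simp add: star_mult star_star)
  finally show ?thesis by (simp only: sq)
qed

text \<open>If N a is the norm of left multiplication by a for the seminorm, then (N a)^2 \<le> norm
  (star a * a) \<le> norm (star a) norm a. This is the hypothesis of the gliding hump argument,
  which returns a bound free of the star.\<close>

lemma gns_seminorm_mult_bounded:
  fixes f :: "'a::banach_star_algebra \<Rightarrow> complex"
  assumes f: "positive_functional f"
  obtains K where "0 \<le> K" "\<And>a x. gns_seminorm f (a * x) \<le> K * norm a * gns_seminorm f x"
proof -
  interpret semi_inner UNIV "assoc_op f" by (rule assoc_op_semi_inner[OF f])
  have q: "gns_seminorm f = snorm" by (simp add: gns_seminorm_def)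
  have le: "snorm (a * x) \<le> sqrt (norm (star a * a)) * snorm x" for a x
  proof (rule power2_le_imp_le)
    show "(snorm (a * x))\<^sup>2 \<le> (sqrt (norm (star a * a)) * snorm x)\<^sup>2"
      using gns_seminorm_mult_power2[OF f, of a x] by (simp add: q power_mult_distrib)
  qed simp
  \<comment> \<open>Division by 0 yields 0, so null vectors x leave the supremum unchanged; for them
    \<open>le\<close> already gives snorm (a * x) = 0.\<close>
  define N where "N a = (SUP x. snorm (a * x) / snorm x)" for a
  have quot_le: "snorm (a * x) / snorm x \<le> sqrt (norm (star a * a))" for a x
    using le[of a x] by (cases "snorm x = 0") (auto simp: pos_divide_le_eq less_le)
  have bdd: "bdd_above (range (\<lambda>x. snorm (a * x) / snorm x))" for a
    using quot_le by (intro bdd_aboveI2)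
  have N_upper: "snorm (a * x) / snorm x \<le> N a" for a x
    unfolding N_def by (rule cSUP_upper[OF _ bdd]) simp
  have N_least: "N a \<le> C" if "\<And>x. snorm (a * x) / snorm x \<le> C" for a C
    unfolding N_def by (rule cSUP_least) (use that in auto)
  have N0: "0 \<le> N a" for a using N_upper[of a 0] by simp
  have mult_le: "snorm (a * x) \<le> N a * snorm x" for a x
  proof (cases "snorm x = 0")
    case True then show ?thesis using le[of a x] by simp
  next
    case False then show ?thesis using N_upper[of a x] by (simp add: pos_divide_le_eq less_le)
  qed
  have "\<exists>K. \<forall>a. N a \<le> K * norm a"
  proof (rule involution_seminorm_bounded)
    show "0 \<le> N a" for a by (rule N0)
    show "N (a + b) \<le> N a + N b" for a b
    proof (rule N_least)
      fix x
      have "snorm ((a + b) * x) / snorm x \<le> (snorm (a * x) + snorm (b * x)) / snorm x"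
        by (intro divide_right_mono) (auto simp: distrib_right snorm_triangle)
      then show "snorm ((a + b) * x) / snorm x \<le> N a + N b"
        using N_upper[of a x] N_upper[of b x] by (simp add: add_divide_distrib)
    qed
    have scale_le: "N (c *\<^sub>C a) \<le> cmod c * N a" for c a
      by (rule N_least) (simp add: mult_scaleC_left snorm_scale mult_left_mono N_upper flip: times_divide_eq_right)
    show "N (c *\<^sub>C a) = cmod c * N a" for c a
    proof (cases "c = 0")
      case True then show ?thesis using scale_le[of 0 a] N0[of 0] by simp
    next
      case False
      have "cmod c * N a \<le> cmod c * (cmod (inverse c) * N (c *\<^sub>C a))"
        using scale_le[of "inverse c" "c *\<^sub>C a"] False
        by (intro mult_left_mono) (auto simp: scaleC_scaleC scaleC_one)
      also have "\<dots> = N (c *\<^sub>C a)" using False by (simp add: norm_inverse)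
      finally show ?thesis using scale_le[of c a] by simp
    qed
    show "(N a)\<^sup>2 \<le> norm (star a) * norm a" for a
    proof -
      have "(N a)\<^sup>2 \<le> (sqrt (norm (star a * a)))\<^sup>2"
        by (intro power_mono N_least quot_le N0)
      also have "\<dots> \<le> norm (star a) * norm a" by (simp add: norm_mult_ineq)
      finally show ?thesis .
    qed
  qed
  then obtain K where K: "\<And>a. N a \<le> K * norm a" by blast
  show thesis
  proof (rule that[of "\<bar>K\<bar>"])
    show "gns_seminorm f (a * x) \<le> \<bar>K\<bar> * norm a * gns_seminorm f x" for a x
    proof -
      have "N a \<le> \<bar>K\<bar> * norm a" using K[of a] by (meson abs_ge_self mult_right_mono norm_ge_zero order_trans)
      then have "N a * snorm x \<le> \<bar>K\<bar> * norm a * snorm x" by (intro mult_right_mono) auto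
      then show ?thesis using mult_le[of a x] by (simp add: q)
    qed
  qed simp
qed

section \<open>Approximate units and the GNS construction\<close>

lemma eventually_net_filter:
  assumes "directed_set I le"
  shows "eventually P (net_filter I le) \<longleftrightarrow> (\<exists>i\<in>I. \<forall>j\<in>I. le i j \<longrightarrow> P j)"
proof -
  have "\<exists>k\<in>I. principal {l\<in>I. le k l} \<le> inf (principal {l\<in>I. le i l}) (principal {l\<in>I. le j l})"
    if ij: "i \<in> I" "j \<in> I" for i j
  proof -
    obtain k where k: "k \<in> I" "le i k" "le j k" using assms ij unfolding directed_set_def by blast
    then have "{l\<in>I. le k l} \<subseteq> {l\<in>I. le i l} \<inter> {l\<in>I. le j l}"
      using assms ij unfolding directed_set_def by blast
    then show ?thesis using k(1) by (intro bexI[of _ k]) simp_all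
  qed
  moreover have "I \<noteq> {}" using assms by (simp add: directed_set_def)
  ultimately show ?thesis
    unfolding net_filter_def by (subst eventually_INF_base) (auto simp: eventually_principal)
qed

lemma net_filter_neq_bot:
  assumes dir: "directed_set I le"
  shows "net_filter I le \<noteq> bot"
proof -
  have "le i i" if "i \<in> I" for i using dir that unfolding directed_set_def by blast
  then show ?thesis unfolding trivial_limit_def eventually_net_filter[OF dir] by blast
qed

lemma eventually_net_filter_mem:
  assumes dir: "directed_set I le"
  shows "eventually (\<lambda>i. i \<in> I) (net_filter I le)"
proof -
  have "I \<noteq> {}" using dir unfolding directed_set_def by blast
  then show ?thesis unfolding eventually_net_filter[OF dir] by blast
qed

text \<open>Tails of the net form a proper filter, so a single index serves finitely many elements
  on both sides. This is the form of an approximate unit that Cohen's theorem takes as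
  input.\<close>

lemma approximate_unit_finite:
  fixes e :: "'i \<Rightarrow> 'a::banach_star_algebra"
  assumes "approximate_unit I le e"
  obtains M where "0 \<le> M" "\<And>i. i \<in> I \<Longrightarrow> norm (e i) \<le> M"
    "\<And>(F :: 'a set) \<epsilon>. \<lbrakk>finite F; 0 < \<epsilon>\<rbrakk> \<Longrightarrow>
      \<exists>x. norm x \<le> M \<and> (\<forall>y\<in>F. norm (x * y - y) \<le> \<epsilon> \<and> norm (y * x - y) \<le> \<epsilon>)"
proof -
  have dir: "directed_set I le"
    and l: "\<And>a. ((\<lambda>i. e i * a) \<longlongrightarrow> a) (net_filter I le)"
    and r: "\<And>a. ((\<lambda>i. a * e i) \<longlongrightarrow> a) (net_filter I le)"
    using assms by (auto simp: approximate_unit_def)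
  obtain M where M: "\<And>i. i \<in> I \<Longrightarrow> norm (e i) \<le> M" using assms by (auto simp: approximate_unit_def)
  have "\<exists>x. norm x \<le> \<bar>M\<bar> \<and> (\<forall>y\<in>F. norm (x * y - y) \<le> \<epsilon> \<and> norm (y * x - y) \<le> \<epsilon>)"
    if F: "finite F" and \<epsilon>: "0 < \<epsilon>" for F :: "'a set" and \<epsilon>
  proof -
    have "\<forall>\<^sub>F i in net_filter I le. norm (e i * y - y) \<le> \<epsilon> \<and> norm (y * e i - y) \<le> \<epsilon>" for y
      using tendstoD[OF l \<epsilon>, of y] tendstoD[OF r \<epsilon>, of y]
      by eventually_elim (simp add: dist_norm less_imp_le)
    then have "\<forall>\<^sub>F i in net_filter I le. i \<in> I \<and> (\<forall>y\<in>F. norm (e i * y - y) \<le> \<epsilon> \<and> norm (y * e i - y) \<le> \<epsilon>)"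
      using F by (intro eventually_conj eventually_net_filter_mem dir eventually_ball_finite) auto
    then obtain i where "i \<in> I" "\<forall>y\<in>F. norm (e i * y - y) \<le> \<epsilon> \<and> norm (y * e i - y) \<le> \<epsilon>"
      using eventually_happens'[OF net_filter_neq_bot[OF dir]] by blast
    then show ?thesis using M[of i] by (intro exI[of _ "e i"]) auto
  qed
  then show thesis using that[of "\<bar>M\<bar>"] M by fastforce
qed

lemma gns_seminorm_nonneg: "positive_functional f \<Longrightarrow> 0 \<le> gns_seminorm f a"
  using semi_inner.snorm_nonneg[OF assoc_op_semi_inner] by (simp add: gns_seminorm_def)

lemma assoc_op_cauchy_schwarz:
  "positive_functional f \<Longrightarrow> cmod (f (star b * a)) \<le> gns_seminorm f a * gns_seminorm f b"
  using semi_inner.cauchy_schwarz[OF assoc_op_semi_inner, of f a b]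
  by (simp add: gns_seminorm_def assoc_op_def)

text \<open>As in Varopoulos' theorem, Cohen factorization passes from the continuity of
  \<open>a \<mapsto> f (x\<^sup>* a x)\<close> to that of \<open>f\<close>.\<close>

lemma gns_seminorm_bounded:
  fixes e :: "'i \<Rightarrow> 'a::banach_star_algebra" and f :: "'a \<Rightarrow> complex"
  assumes e: "approximate_unit I le e" and f: "positive_functional f"
  obtains K where "0 \<le> K" "\<And>a. gns_seminorm f a \<le> K * norm a"
proof -
  interpret semi_inner UNIV "assoc_op f" by (rule assoc_op_semi_inner[OF f])
  obtain M where M: "0 \<le> M" "\<And>(F :: 'a set) \<epsilon>. \<lbrakk>finite F; 0 < \<epsilon>\<rbrakk> \<Longrightarrow>
      \<exists>x. norm x \<le> M \<and> (\<forall>y\<in>F. norm (x * y - y) \<le> \<epsilon> \<and> norm (y * x - y) \<le> \<epsilon>)"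
    using approximate_unit_finite[OF e] by metis
  obtain L where L: "\<And>a x. gns_seminorm f (a * x) \<le> L * norm a * gns_seminorm f x"
    using gns_seminorm_mult_bounded[OF f] by metis
  have "\<exists>K. \<forall>a. gns_seminorm f a \<le> K * norm a"
  proof (rule bounded_if_bounded_on_multiples[OF bounded_bilinear_mult _ norm_mult_ineq M(1) M(2)])
    show "gns_seminorm f (r *\<^sub>R x) = \<bar>r\<bar> * gns_seminorm f x" for r x
      by (simp add: gns_seminorm_def scaleR_scaleC snorm_scale)
    show "\<exists>C. \<forall>y. gns_seminorm f (y * z) \<le> C * norm y" for z
      using L by (intro exI[of _ "L * gns_seminorm f z"]) (simp add: mult_ac)
  qed (auto simp: mult.assoc)
  then obtain K where K: "\<And>a. gns_seminorm f a \<le> K * norm a" by blast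
  have "gns_seminorm f a \<le> \<bar>K\<bar> * norm a" for a
    using K[of a] by (meson abs_ge_self mult_right_mono norm_ge_zero order_trans)
  then show thesis using that[of "\<bar>K\<bar>"] by simp
qed

text \<open>On the elements z * y with z fixed, f is bounded by Cauchy-Schwarz: cmod (f (z * y))
  \<le> q y q (star z) \<le> K norm y q (star z). Passing to all elements requires common left
  factors, hence Cohen's theorem for the flipped product.\<close>

lemma positive_functional_bounded:
  fixes e :: "'i \<Rightarrow> 'a::banach_star_algebra" and f :: "'a \<Rightarrow> complex"
  assumes e: "approximate_unit I le e" and f: "positive_functional f"
  obtains L where "\<And>a. cmod (f a) \<le> L * norm a"
proof -
  interpret f: Vector_Spaces.linear scaleC scaleC f using f by (simp add: positive_functional_def)
  obtain M where M: "0 \<le> M" "\<And>(F :: 'a set) \<epsilon>. \<lbrakk>finite F; 0 < \<epsilon>\<rbrakk> \<Longrightarrow>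
      \<exists>x. norm x \<le> M \<and> (\<forall>y\<in>F. norm (x * y - y) \<le> \<epsilon> \<and> norm (y * x - y) \<le> \<epsilon>)"
    using approximate_unit_finite[OF e] by metis
  obtain K where K: "0 \<le> K" "\<And>a. gns_seminorm f a \<le> K * norm a"
    using gns_seminorm_bounded[OF e f] by metis
  have "\<exists>L. \<forall>a. cmod (f a) \<le> L * norm a"
  proof (rule bounded_if_bounded_on_multiples[OF bounded_bilinear.flip[OF bounded_bilinear_mult] _ _ M(1)])
    show "norm (y * x) \<le> norm x * norm y" for x y :: 'a
      using norm_mult_ineq[of y x] by (simp add: mult.commute)
    show "\<exists>x. norm x \<le> M \<and> (\<forall>y\<in>F. norm (y * x - y) \<le> \<epsilon> \<and> norm (x * y - y) \<le> \<epsilon>)"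
      if "finite F" "0 < \<epsilon>" for F :: "'a set" and \<epsilon> using M(2)[OF that] by blast
    show "cmod (f (r *\<^sub>R x)) = \<bar>r\<bar> * cmod (f x)" for r x
      by (simp add: scaleR_scaleC f.scale scaleC_complex_def norm_mult)
    show "\<exists>C. \<forall>y. cmod (f (z * y)) \<le> C * norm y" for z
    proof (intro exI allI)
      fix y
      have "cmod (f (z * y)) \<le> gns_seminorm f y * gns_seminorm f (star z)"
        using assoc_op_cauchy_schwarz[OF f, of "star z" y] by (simp add: star_star)
      also have "\<dots> \<le> K * norm y * gns_seminorm f (star z)"
        by (intro mult_right_mono K gns_seminorm_nonneg f)
      finally show "cmod (f (z * y)) \<le> K * gns_seminorm f (star z) * norm y" by (simp add: mult_ac)
    qed
  qed (auto simp: mult.assoc)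
  then show thesis using that by blast
qed

text \<open>Since f is continuous, f (star a) is the limit of f (star a * e i), and Cauchy-Schwarz
  bounds these values by q (e i) q a; the elements star (e i), possibly unbounded, do not occur. The
  bound admits b -> f (star b) as a vector of the GNS space.\<close>

lemma positive_functional_star_bound:
  fixes e :: "'i \<Rightarrow> 'a::banach_star_algebra" and f :: "'a \<Rightarrow> complex"
  assumes e: "approximate_unit I le e" and f: "positive_functional f"
  obtains C where "\<And>a. cmod (f (star a)) \<le> C * gns_seminorm f a"
proof -
  interpret f: Vector_Spaces.linear scaleC scaleC f using f by (simp add: positive_functional_def)
  have dir: "directed_set I le" and r: "\<And>a. ((\<lambda>i. a * e i) \<longlongrightarrow> a) (net_filter I le)"
    using e by (auto simp: approximate_unit_def)
  obtain M where M: "0 \<le> M" "\<And>i. i \<in> I \<Longrightarrow> norm (e i) \<le> M"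
    using approximate_unit_finite[OF e] by metis
  obtain K where K: "0 \<le> K" "\<And>a. gns_seminorm f a \<le> K * norm a"
    using gns_seminorm_bounded[OF e f] by metis
  obtain L where L: "\<And>a. cmod (f a) \<le> L * norm a" using positive_functional_bounded[OF e f] by metis
  have lin: "bounded_linear f"
    by (rule bounded_linear_intro[of _ L])
      (use L in \<open>auto simp: f.add f.scale scaleR_scaleC scaleC_complex_def scaleR_conv_of_real mult.commute\<close>)
  show thesis
  proof
    fix a
    have "((\<lambda>i. cmod (f (star a * e i))) \<longlongrightarrow> cmod (f (star a))) (net_filter I le)"
      by (intro tendsto_norm bounded_linear.tendsto[OF lin] r)
    moreover have "\<forall>\<^sub>F i in net_filter I le. cmod (f (star a * e i)) \<le> K * M * gns_seminorm f a"
      using eventually_net_filter_mem[OF dir]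
    proof eventually_elim
      case (elim i)
      have "cmod (f (star a * e i)) \<le> gns_seminorm f (e i) * gns_seminorm f a"
        by (rule assoc_op_cauchy_schwarz[OF f])
      also have "gns_seminorm f (e i) \<le> K * M"
        using K(2)[of "e i"] mult_left_mono[OF M(2)[OF elim] K(1)] by linarith
      finally show ?case by (simp add: mult_right_mono gns_seminorm_nonneg[OF f])
    qed
    ultimately show "cmod (f (star a)) \<le> (K * M) * gns_seminorm f a"
      by (rule tendsto_upperbound) (rule net_filter_neq_bot[OF dir])
  qed
qed

lemma positive_op_assoc_op:
  fixes e :: "'i \<Rightarrow> 'a::banach_star_algebra" and f :: "'a \<Rightarrow> complex"
  assumes e: "approximate_unit I le e" and f: "positive_functional f"
  shows "positive_op (assoc_op f)"
proof -
  interpret semi_inner UNIV "assoc_op f" by (rule assoc_op_semi_inner[OF f])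
  obtain K where K: "0 \<le> K" "\<And>a. gns_seminorm f a \<le> K * norm a"
    using gns_seminorm_bounded[OF e f] by metis
  have bound: "cmod (assoc_op f x y) \<le> (K * K * norm x) * norm y" for x y
  proof -
    have "cmod (assoc_op f x y) \<le> gns_seminorm f x * gns_seminorm f y"
      unfolding assoc_op_def by (rule assoc_op_cauchy_schwarz[OF f])
    also have "\<dots> \<le> (K * norm x) * (K * norm y)"
      using K by (intro mult_mono gns_seminorm_nonneg f) auto
    finally show ?thesis by (simp add: mult_ac)
  qed
  have "assoc_op f x \<in> antidual" for x
  proof -
    have "continuous_on UNIV (assoc_op f x)"
      by (rule antilinear_continuous[OF _ _ bound]) (simp_all add: ip_add_right ip_scale_right)
    then show ?thesis by (simp add: antidual_def ip_add_right ip_scale_right)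
  qed
  moreover have "clinear (assoc_op f)"
    by unfold_locales (simp_all add: fun_eq_iff ip_add_left ip_scale_left scaleC_fun_def scaleC_complex_def)
  moreover have "functional_norm (assoc_op f x) \<le> ereal (K * K * norm x)" for x
    by (rule functional_norm_le[OF bound]) (use K in simp)
  ultimately show ?thesis
    using ip_nonneg unfolding positive_op_def bounded_ops_def by blast
qed

lemma gns_triple_exists:
  fixes e :: "'i \<Rightarrow> 'a::banach_star_algebra" and f :: "'a \<Rightarrow> complex"
  assumes e: "approximate_unit I le e" and f: "positive_functional f"
  obtains H :: "('a \<Rightarrow> complex) hspace" and \<pi> \<zeta> where "gns_triple f H \<pi> \<zeta>"
proof -
  interpret semi_inner UNIV "assoc_op f" by (rule assoc_op_semi_inner[OF f])
  interpret semi_inner_space "assoc_op f" by unfold_locales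
  interpret C: semi_inner "hcarrier completion" "hinner completion" by (rule completion_semi_inner)
  interpret f: Vector_Spaces.linear scaleC scaleC f using f by (simp add: positive_functional_def)
  have q: "gns_seminorm f x = snorm x" for x by (simp add: gns_seminorm_def)
  obtain K where K: "0 \<le> K" "\<And>a x. snorm (a * x) \<le> K * norm a * snorm x"
    using gns_seminorm_mult_bounded[OF f] unfolding q by metis
  \<comment> \<open>On functionals, left multiplication of the representatives by a turns into
    composition with left multiplication by star a. This formula is free of choices and makes the
    algebraic laws pointwise identities.\<close>
  define \<pi> :: "'a \<Rightarrow> ('a \<Rightarrow> complex) \<Rightarrow> 'a \<Rightarrow> complex"
    where "\<pi> a \<phi> = (\<lambda>b. \<phi> (star a * b))" for a \<phi>
  have \<pi>_apply: "\<pi> a \<phi> b = \<phi> (star a * b)" for a \<phi> b by (simp add: \<pi>_def)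
  \<comment> \<open>The functional that a unit would induce: (1 | b) = f (star b).\<close>
  define \<zeta> where "\<zeta> = (\<lambda>b. f (star b))"
  have ip_mult: "assoc_op f (a * x) y = assoc_op f x (star a * y)" for a x y
    by (simp add: assoc_op_def star_mult star_star mult.assoc)
  have rep: "represents (\<lambda>n. a * x n) (\<pi> a \<phi>)" if x: "represents x \<phi>" for a x \<phi>
    unfolding represents_def
  proof
    show "snorm_Cauchy (\<lambda>n. a * x n)"
      by (rule snorm_Cauchy_map[OF represents_Cauchy[OF x] _ K(2)]) (simp add: right_diff_distrib)
    show "\<forall>b. (\<lambda>n. assoc_op f (a * x n) b) \<longlonglongrightarrow> \<pi> a \<phi> b"
      using x by (simp add: ip_mult \<pi>_def represents_def)
  qed
  have mem: "\<pi> a \<phi> \<in> hcarrier completion" if "\<phi> \<in> hcarrier completion" for a \<phi>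
    using that rep by (auto simp: mem_completion_iff)
  have antilin: "\<phi> (x + y) = \<phi> x + \<phi> y" "\<phi> (c *\<^sub>C x) = cnj c * \<phi> x"
    if \<phi>: "\<phi> \<in> hcarrier completion" for \<phi> x y c
  proof -
    have "assoc_op f (x + y) = assoc_op f x + assoc_op f y" "assoc_op f (c *\<^sub>C x) = c *\<^sub>C assoc_op f x"
      by (simp_all add: fun_eq_iff ip_add_left ip_scale_left scaleC_fun_def scaleC_complex_def)
    then show "\<phi> (x + y) = \<phi> x + \<phi> y" "\<phi> (c *\<^sub>C x) = cnj c * \<phi> x"
      using completion_inner_left[OF \<phi>] C.ip_add_right[OF ip_mem_completion ip_mem_completion \<phi>, of x y]
        C.ip_scale_right[OF \<phi> ip_mem_completion, of c x] by metis+
  qed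
  have bound: "hnorm completion (\<pi> a \<phi>) \<le> K * norm a * hnorm completion \<phi>"
    if \<phi>: "\<phi> \<in> hcarrier completion" for a \<phi>
  proof -
    obtain x where x: "represents x \<phi>" using \<phi> by (auto simp: mem_completion_iff)
    have "(\<lambda>n. K * norm a * snorm (x n)) \<longlonglongrightarrow> K * norm a * hnorm completion \<phi>"
      by (intro tendsto_mult tendsto_const represents_hnorm x)
    then show ?thesis by (rule LIMSEQ_le[OF represents_hnorm[OF rep[OF x]]]) (use K(2) in blast)
  qed
  have adj: "hinner completion (\<pi> a \<phi>) \<psi> = hinner completion \<phi> (\<pi> (star a) \<psi>)"
    if \<phi>: "\<phi> \<in> hcarrier completion" and \<psi>: "\<psi> \<in> hcarrier completion" for a \<phi> \<psi>
  proof -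
    obtain x where x: "represents x \<phi>" using \<phi> by (auto simp: mem_completion_iff)
    obtain y where y: "represents y \<psi>" using \<psi> by (auto simp: mem_completion_iff)
    have "(\<lambda>n. assoc_op f (a * x n) (y n)) \<longlonglongrightarrow> hinner completion (\<pi> a \<phi>) \<psi>"
      by (intro represents_inner rep x y)
    moreover have "(\<lambda>n. assoc_op f (a * x n) (y n)) \<longlonglongrightarrow> hinner completion \<phi> (\<pi> (star a) \<psi>)"
      unfolding ip_mult by (intro represents_inner rep x y)
    ultimately show ?thesis by (rule LIMSEQ_unique)
  qed
  have star_rep: "star_representation completion \<pi>"
    unfolding star_representation_def bounded_hop_def
  proof (intro conjI allI ballI)
    show "\<exists>L. \<forall>x\<in>hcarrier completion. hnorm completion (\<pi> a x) \<le> L * hnorm completion x" for a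
      using bound by blast
  qed (auto simp: mem adj completion_hilbert fun_eq_iff \<pi>_apply antilin star_add star_scaleC star_mult
      distrib_right mult_scaleC_left mult.assoc scaleC_fun_def scaleC_complex_def)
  obtain C where C: "\<And>a. cmod (f (star a)) \<le> C * snorm a"
    using positive_functional_star_bound[OF e f] unfolding q by metis
  have \<zeta>: "\<zeta> \<in> hcarrier completion"
    by (rule bounded_mem_completion[of _ C])
      (simp_all add: \<zeta>_def C star_add star_scaleC f.add f.scale scaleC_complex_def)
  have \<pi>\<zeta>: "\<pi> a \<zeta> = assoc_op f a" for a
    by (simp add: \<pi>_def \<zeta>_def assoc_op_def fun_eq_iff star_mult star_star)
  have "f a = hinner completion (\<pi> a \<zeta>) \<zeta>" for a
    unfolding adj[OF \<zeta> \<zeta>] unfolding \<pi>\<zeta> completion_inner_left[OF \<zeta>]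
    by (simp add: \<zeta>_def star_star)
  then have "gns_triple f completion \<pi> \<zeta>"
    unfolding gns_triple_def using star_rep \<zeta> completion_dense by (simp add: \<pi>\<zeta>)
  then show thesis by (rule that)
qed

lemma gns_triple_gns:
  fixes e :: "'i \<Rightarrow> 'a::banach_star_algebra" and f :: "'a \<Rightarrow> complex"
  assumes "approximate_unit I le e" and "positive_functional f"
  obtains H \<pi> \<zeta> where "gns f = (H, \<pi>, \<zeta>)" "gns_triple f H \<pi> \<zeta>"
proof -
  obtain H :: "('a \<Rightarrow> complex) hspace" and \<pi> \<zeta> where "gns_triple f H \<pi> \<zeta>"
    using gns_triple_exists[OF assms] by metis
  then have "case gns f of (H, \<pi>, \<zeta>) \<Rightarrow> gns_triple f H \<pi> \<zeta>"
    unfolding gns_def by (intro someI[of "\<lambda>(H, \<pi>, \<zeta>). gns_triple f H \<pi> \<zeta>" "(H, \<pi>, \<zeta>)"]) simp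
  then show thesis using that by (cases "gns f") auto
qed

section \<open>Properties shared by all GNS triples\<close>

lemma star_representationD:
  assumes "star_representation H \<pi>"
  shows "hilbert_space H"
    and "x \<in> hcarrier H \<Longrightarrow> \<pi> a x \<in> hcarrier H"
    and "\<lbrakk>x \<in> hcarrier H; y \<in> hcarrier H\<rbrakk> \<Longrightarrow> \<pi> a (x + y) = \<pi> a x + \<pi> a y"
    and "x \<in> hcarrier H \<Longrightarrow> \<pi> a (c *\<^sub>C x) = c *\<^sub>C \<pi> a x"
    and "\<exists>K. \<forall>x\<in>hcarrier H. hnorm H (\<pi> a x) \<le> K * hnorm H x"
    and "x \<in> hcarrier H \<Longrightarrow> \<pi> (a + b) x = \<pi> a x + \<pi> b x"
    and "x \<in> hcarrier H \<Longrightarrow> \<pi> (c *\<^sub>C a) x = c *\<^sub>C \<pi> a x"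
    and "x \<in> hcarrier H \<Longrightarrow> \<pi> (a * b) x = \<pi> a (\<pi> b x)"
    and "\<lbrakk>x \<in> hcarrier H; y \<in> hcarrier H\<rbrakk> \<Longrightarrow> hinner H (\<pi> a x) y = hinner H x (\<pi> (star a) y)"
  using assms unfolding star_representation_def bounded_hop_def by blast+

lemma star_representation_diff:
  assumes \<pi>: "star_representation H \<pi>"
  shows "\<lbrakk>x \<in> hcarrier H; y \<in> hcarrier H\<rbrakk> \<Longrightarrow> \<pi> a (x - y) = \<pi> a x - \<pi> a y"
    and "x \<in> hcarrier H \<Longrightarrow> \<pi> (a - b) x = \<pi> a x - \<pi> b x"
proof -
  interpret semi_inner "hcarrier H" "hinner H"
    by (rule hilbert_space_semi_inner[OF star_representationD(1)[OF \<pi>]])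
  show "\<pi> a (x - y) = \<pi> a x - \<pi> a y" if "x \<in> hcarrier H" "y \<in> hcarrier H"
    using star_representationD(3)[OF \<pi>, of "x - y" y a] that by simp
  show "\<pi> (a - b) x = \<pi> a x - \<pi> b x" if "x \<in> hcarrier H"
    using star_representationD(6)[OF \<pi>, of x "a - b" b] that by simp
qed

lemma gns_triple_inner:
  assumes "gns_triple f H \<pi> \<zeta>"
  shows "hinner H (\<pi> x \<zeta>) (\<pi> y \<zeta>) = assoc_op f x y"
proof -
  have \<pi>: "star_representation H \<pi>" and \<zeta>: "\<zeta> \<in> hcarrier H" and fa: "\<And>a. f a = hinner H (\<pi> a \<zeta>) \<zeta>"
    using assms by (auto simp: gns_triple_def)
  have "hinner H (\<pi> (star y) (\<pi> x \<zeta>)) \<zeta> = hinner H (\<pi> x \<zeta>) (\<pi> y \<zeta>)"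
    using star_representationD(9)[OF \<pi> star_representationD(2)[OF \<pi> \<zeta>] \<zeta>, of "star y" x]
    by (simp add: star_star)
  then show ?thesis by (simp add: assoc_op_def fa star_representationD(8)[OF \<pi> \<zeta>])
qed

lemma gns_triple_hnorm:
  assumes "gns_triple f H \<pi> \<zeta>" and "positive_functional f"
  shows "hnorm H (\<pi> x \<zeta>) = gns_seminorm f x"
  using semi_inner.snorm_def[OF assoc_op_semi_inner[OF assms(2)]]
  by (simp add: hnorm_def gns_triple_inner[OF assms(1)] gns_seminorm_def)

text \<open>A star representation supplies some bound L for each \<pi> a separately. The bound K
  norm a, with the same K for all a, holds on the dense set of vectors \<pi> x \<zeta> by
  \<open>gns_seminorm_mult_bounded\<close>, and L carries it over to the closure.\<close>

lemma gns_triple_bounded: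
  assumes gns: "gns_triple f H \<pi> \<zeta>" and f: "positive_functional f"
  obtains K where "0 \<le> K" "\<And>a v. v \<in> hcarrier H \<Longrightarrow> hnorm H (\<pi> a v) \<le> K * norm a * hnorm H v"
proof -
  have \<pi>: "star_representation H \<pi>" and \<zeta>: "\<zeta> \<in> hcarrier H" and dense: "hdense H (range (\<lambda>a. \<pi> a \<zeta>))"
    using gns by (auto simp: gns_triple_def)
  have H: "hilbert_space H" by (rule star_representationD(1)[OF \<pi>])
  interpret semi_inner "hcarrier H" "hinner H" by (rule hilbert_space_semi_inner[OF H])
  note hn = hnorm_eq_snorm[OF H]
  obtain K where K: "0 \<le> K" "\<And>a x. gns_seminorm f (a * x) \<le> K * norm a * gns_seminorm f x"
    using gns_seminorm_mult_bounded[OF f] by metis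
  have "snorm (\<pi> a v) \<le> K * norm a * snorm v" if v: "v \<in> hcarrier H" for a v
  proof (rule field_le_epsilon)
    fix \<epsilon> :: real assume \<epsilon>: "0 < \<epsilon>"
    obtain L where L: "\<And>x. x \<in> hcarrier H \<Longrightarrow> snorm (\<pi> a x) \<le> L * snorm x"
      using star_representationD(5)[OF \<pi>, of a] unfolding hn by blast
    define R where "R = \<bar>L\<bar> + K * norm a"
    have R: "0 \<le> R" using K by (simp add: R_def)
    then have "0 < \<epsilon> / (R + 1)" using \<epsilon> by simp
    then obtain x where x: "snorm (v - \<pi> x \<zeta>) < \<epsilon> / (R + 1)"
      using dense v unfolding hdense_def hn by blast
    have m: "\<pi> x \<zeta> \<in> hcarrier H" by (rule star_representationD(2)[OF \<pi> \<zeta>])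
    define \<delta> where "\<delta> = snorm (v - \<pi> x \<zeta>)"
    have \<delta>: "0 \<le> \<delta>" using v m by (simp add: \<delta>_def)
    have "snorm (\<pi> a v) \<le> snorm (\<pi> a (\<pi> x \<zeta>)) + snorm (\<pi> a v - \<pi> a (\<pi> x \<zeta>))"
      by (intro snorm_triangle_sub star_representationD(2)[OF \<pi>] v m)
    moreover have "snorm (\<pi> a v - \<pi> a (\<pi> x \<zeta>)) \<le> \<bar>L\<bar> * \<delta>"
    proof -
      have "snorm (\<pi> a (v - \<pi> x \<zeta>)) \<le> L * \<delta>" unfolding \<delta>_def by (intro L diff_mem v m)
      also have "\<dots> \<le> \<bar>L\<bar> * \<delta>" using \<delta> by (intro mult_right_mono) auto
      finally show ?thesis by (simp add: star_representation_diff(1)[OF \<pi> v m])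
    qed
    moreover have "snorm (\<pi> a (\<pi> x \<zeta>)) \<le> K * norm a * snorm (\<pi> x \<zeta>)"
      using K(2)[of a x] gns_triple_hnorm[OF gns f]
      by (simp add: hn flip: star_representationD(8)[OF \<pi> \<zeta>])
    moreover have "K * norm a * snorm (\<pi> x \<zeta>) \<le> K * norm a * (snorm v + \<delta>)"
      using snorm_triangle_sub[OF m v] snorm_minus_commute[OF m v] K by (intro mult_left_mono) (auto simp: \<delta>_def)
    ultimately have "snorm (\<pi> a v) \<le> K * norm a * snorm v + R * \<delta>"
      by (simp add: R_def algebra_simps)
    also have "R * \<delta> \<le> R * (\<epsilon> / (R + 1))" using x R by (intro mult_left_mono) (auto simp: \<delta>_def)
    also have "\<dots> \<le> \<epsilon>" using R \<epsilon> by (simp add: field_simps)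
    finally show "snorm (\<pi> a v) \<le> K * norm a * snorm v + \<epsilon>" by simp
  qed
  then show thesis using that K(1) by (simp add: hn)
qed

text \<open>For \<pi> x \<zeta> close to \<zeta>, the vectors \<pi> (e i * x - x) \<zeta> tend to 0
  with e i * x - x, and the operators \<pi> (e i) are bounded by K M uniformly in i, which controls
  the replacement of \<zeta> by \<pi> x \<zeta>.\<close>

lemma approximate_unit_cyclic_vector:
  fixes e :: "'i \<Rightarrow> 'a::banach_star_algebra" and f :: "'a \<Rightarrow> complex"
  assumes e: "approximate_unit I le e" and gns: "gns_triple f H \<pi> \<zeta>" and f: "positive_functional f"
  shows "((\<lambda>i. hnorm H (\<pi> (e i) \<zeta> - \<zeta>)) \<longlongrightarrow> 0) (net_filter I le)"
proof (rule tendstoI)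
  fix \<epsilon> :: real assume \<epsilon>: "0 < \<epsilon>"
  have dir: "directed_set I le" and l: "\<And>a. ((\<lambda>i. e i * a) \<longlongrightarrow> a) (net_filter I le)"
    using e by (auto simp: approximate_unit_def)
  have \<pi>: "star_representation H \<pi>" and \<zeta>: "\<zeta> \<in> hcarrier H" and dense: "hdense H (range (\<lambda>a. \<pi> a \<zeta>))"
    using gns by (auto simp: gns_triple_def)
  have H: "hilbert_space H" by (rule star_representationD(1)[OF \<pi>])
  interpret semi_inner "hcarrier H" "hinner H" by (rule hilbert_space_semi_inner[OF H])
  note hn = hnorm_eq_snorm[OF H]
  obtain M where M: "0 \<le> M" "\<And>i. i \<in> I \<Longrightarrow> norm (e i) \<le> M"
    using approximate_unit_finite[OF e] by metis
  obtain K where K: "0 \<le> K" "\<And>a v. v \<in> hcarrier H \<Longrightarrow> snorm (\<pi> a v) \<le> K * norm a * snorm v"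
    using gns_triple_bounded[OF gns f] unfolding hn by metis
  \<comment> \<open>K M for the error after applying \<pi> (e i) and 1 for the error itself;
    together they use up half of \<epsilon>.\<close>
  define R where "R = K * M + 1"
  have R: "0 < R" using K M by (simp add: R_def add_nonneg_pos)
  then have "0 < \<epsilon> / (2 * R)" using \<epsilon> by simp
  then obtain x where x: "snorm (\<zeta> - \<pi> x \<zeta>) < \<epsilon> / (2 * R)"
    using dense \<zeta> unfolding hdense_def hn by blast
  have m: "\<pi> a \<zeta> \<in> hcarrier H" for a by (rule star_representationD(2)[OF \<pi> \<zeta>])
  have mm: "\<pi> a (\<pi> b \<zeta>) \<in> hcarrier H" for a b by (rule star_representationD(2)[OF \<pi> m])
  have lim: "((\<lambda>i. K * norm (e i * x - x) * snorm \<zeta>) \<longlongrightarrow> K * norm (x - x) * snorm \<zeta>) (net_filter I le)"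
    by (intro tendsto_intros l)
  have "\<forall>\<^sub>F i in net_filter I le. K * norm (e i * x - x) * snorm \<zeta> < \<epsilon> / 2"
    using order_tendstoD(2)[OF lim, of "\<epsilon> / 2"] \<epsilon> by simp
  then show "\<forall>\<^sub>F i in net_filter I le. dist (hnorm H (\<pi> (e i) \<zeta> - \<zeta>)) 0 < \<epsilon>"
    using eventually_net_filter_mem[OF dir]
  proof eventually_elim
    case (elim i)
    have "snorm (\<pi> (e i) \<zeta> - \<zeta>) \<le> snorm (\<pi> (e i) \<zeta> - \<pi> (e i) (\<pi> x \<zeta>)) + snorm (\<pi> (e i) (\<pi> x \<zeta>) - \<zeta>)"
      by (intro snorm_triangle_diff m mm \<zeta>)
    moreover have "snorm (\<pi> (e i) (\<pi> x \<zeta>) - \<zeta>) \<le> snorm (\<pi> (e i) (\<pi> x \<zeta>) - \<pi> x \<zeta>) + snorm (\<pi> x \<zeta> - \<zeta>)"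
      by (intro snorm_triangle_diff m mm \<zeta>)
    moreover have "snorm (\<pi> x \<zeta> - \<zeta>) = snorm (\<zeta> - \<pi> x \<zeta>)" by (rule snorm_minus_commute[OF m \<zeta>])
    moreover have "snorm (\<pi> (e i) \<zeta> - \<pi> (e i) (\<pi> x \<zeta>)) \<le> K * M * snorm (\<zeta> - \<pi> x \<zeta>)"
    proof -
      have "snorm (\<pi> (e i) (\<zeta> - \<pi> x \<zeta>)) \<le> K * norm (e i) * snorm (\<zeta> - \<pi> x \<zeta>)"
        by (intro K diff_mem m \<zeta>)
      also have "\<dots> \<le> K * M * snorm (\<zeta> - \<pi> x \<zeta>)"
        using K M elim m \<zeta> by (intro mult_right_mono mult_left_mono) auto
      finally show ?thesis by (simp add: star_representation_diff(1)[OF \<pi> \<zeta> m])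
    qed
    moreover have "snorm (\<pi> (e i) (\<pi> x \<zeta>) - \<pi> x \<zeta>) < \<epsilon> / 2"
      using K(2)[OF \<zeta>, of "e i * x - x"] elim
      by (simp add: star_representation_diff(2)[OF \<pi> \<zeta>] star_representationD(8)[OF \<pi> \<zeta>])
    moreover have "K * M * snorm (\<zeta> - \<pi> x \<zeta>) + snorm (\<zeta> - \<pi> x \<zeta>) < \<epsilon> / 2"
    proof -
      have "R * snorm (\<zeta> - \<pi> x \<zeta>) < R * (\<epsilon> / (2 * R))" using x R by (rule mult_strict_left_mono)
      also have "\<dots> = \<epsilon> / 2" using R by simp
      finally show ?thesis by (simp add: R_def algebra_simps)
    qed
    ultimately have "snorm (\<pi> (e i) \<zeta> - \<zeta>) < \<epsilon>" by linarith
    then show ?case using m \<zeta> by (simp add: hn)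
  qed
qed

section \<open>The parallel sum of functionals\<close>

theorem theorem5p5:
  fixes f g :: "'a::banach_star_algebra \<Rightarrow> complex"
    and I :: "'i set" and le :: "'i \<Rightarrow> 'i \<Rightarrow> bool" and e :: "'i \<Rightarrow> 'a"
  assumes "approximate_unit I le e"
    and "positive_functional f" and "positive_functional g"
  shows "representable f \<and> representable g \<and>
    positive_op (assoc_op f) \<and> positive_op (assoc_op g) \<and>
    ((\<lambda>i. functional_norm (\<lambda>a.
          cnj (operator_parallel_sum (assoc_op f) (assoc_op g) (e i) a)
          - functional_parallel_sum f g a)) \<longlongrightarrow> 0) (net_filter I le)"
proof -
  note e = assms(1) and f = assms(2) and g = assms(3)
  obtain Hf \<pi>f \<zeta>f where gns_f: "gns f = (Hf, \<pi>f, \<zeta>f)" and tf: "gns_triple f Hf \<pi>f \<zeta>f"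
    using gns_triple_gns[OF e f] by metis
  obtain Hg \<pi>g \<zeta>g where gns_g: "gns g = (Hg, \<pi>g, \<zeta>g)" and tg: "gns_triple g Hg \<pi>g \<zeta>g"
    using gns_triple_gns[OF e g] by metis
  have \<pi>f: "star_representation Hf \<pi>f" and \<zeta>f: "\<zeta>f \<in> hcarrier Hf" using tf by (auto simp: gns_triple_def)
  have \<pi>g: "star_representation Hg \<pi>g" and \<zeta>g: "\<zeta>g \<in> hcarrier Hg" using tg by (auto simp: gns_triple_def)
  note hf = star_representationD(1)[OF \<pi>f] and hg = star_representationD(1)[OF \<pi>g]
  define H where "H = hsum Hf Hg"
  have H: "hilbert_space H" unfolding H_def by (rule hilbert_space_hsum[OF hf hg])
  interpret Hf: semi_inner "hcarrier Hf" "hinner Hf" by (rule hilbert_space_semi_inner[OF hf])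
  interpret Hg: semi_inner "hcarrier Hg" "hinner Hg" by (rule hilbert_space_semi_inner[OF hg])
  interpret semi_inner "hcarrier H" "hinner H" by (rule hilbert_space_semi_inner[OF H])
  note hn = hnorm_eq_snorm[OF H]
  have posf: "positive_op (assoc_op f)" and posg: "positive_op (assoc_op g)"
    using positive_op_assoc_op[OF e] f g by auto
  define T where "T a = (\<pi>f a \<zeta>f, \<pi>g a \<zeta>g)" for a
  define W where "W a = (\<pi>f a \<zeta>f, 0 :: 'a \<Rightarrow> complex)" for a
  define \<xi> where "\<xi> = (\<zeta>f, 0 :: 'a \<Rightarrow> complex)"
  define R where "R a = map_prod (\<pi>f a) (\<pi>g a)" for a
  define N where "N = orth_compl H (range T)"
  define Q where "Q = orth_proj H N"
  have mf: "\<pi>f a \<zeta>f \<in> hcarrier Hf" and mg: "\<pi>g a \<zeta>g \<in> hcarrier Hg" for a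
    using star_representationD(2)[OF \<pi>f \<zeta>f] star_representationD(2)[OF \<pi>g \<zeta>g] by auto
  have \<pi>g0: "\<pi>g a 0 = 0" for a using star_representationD(4)[OF \<pi>g Hg.zero_mem, of a 0] by simp
  have T: "T a \<in> hcarrier H" and W: "W a \<in> hcarrier H" and \<xi>: "\<xi> \<in> hcarrier H" for a
    using mf mg \<zeta>f by (auto simp: T_def W_def \<xi>_def H_def)
  have T_add: "T (a + b) = T a + T b" and T_scale: "T (c *\<^sub>C a) = c *\<^sub>C T a" for a b c
    using star_representationD(6,7)[OF \<pi>f \<zeta>f] star_representationD(6,7)[OF \<pi>g \<zeta>g]
    by (simp_all add: T_def scaleC_prod_def)
  have R\<xi>: "R a \<xi> = W a" for a by (simp add: R_def \<xi>_def W_def \<pi>g0)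
  have R: "R a x \<in> hcarrier H" if "x \<in> hcarrier H" for a x
    using that star_representationD(2)[OF \<pi>f] star_representationD(2)[OF \<pi>g] by (auto simp: R_def H_def)
  have R_diff: "R a (x - y) = R a x - R a y" if "x \<in> hcarrier H" "y \<in> hcarrier H" for a x y
    using that star_representation_diff(1)[OF \<pi>f] star_representation_diff(1)[OF \<pi>g]
    by (auto simp: R_def H_def)
  have R_adj: "hinner H (R a x) y = hinner H x (R (star a) y)"
    if "x \<in> hcarrier H" "y \<in> hcarrier H" for a x y
    using that star_representationD(9)[OF \<pi>f] star_representationD(9)[OF \<pi>g] by (auto simp: R_def H_def)
  have RT: "R a (T b) = T (a * b)" for a b
    using star_representationD(8)[OF \<pi>f \<zeta>f] star_representationD(8)[OF \<pi>g \<zeta>g] by (simp add: R_def T_def)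
  have NH: "x \<in> hcarrier H" if "x \<in> N" for x using that by (simp add: N_def orth_compl_def)
  have QN: "Q x \<in> N" and Q_orth: "y \<in> N \<Longrightarrow> hinner H (x - Q x) y = 0" if "x \<in> hcarrier H" for x y
    unfolding Q_def N_def using orth_proj_range_mem[OF H T T_add T_scale that] by auto
  \<comment> \<open>ran T is invariant under every R a by \<open>RT\<close>, and R (star a) is the
    adjoint of R a, so the complement N is invariant as well. This is why Q commutes with R
    a.\<close>
  have RN: "R a x \<in> N" if x: "x \<in> N" for a x
    using x R[OF NH[OF x]] R_adj[OF NH[OF x] T] unfolding N_def orth_compl_def by (auto simp: RT)
  have QR: "Q (R a x) = R a (Q x)" if x: "x \<in> hcarrier H" for a x
    unfolding Q_def N_def
  proof (rule orth_proj_eqI[OF H R[OF x]])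
    show "R a (orth_proj H (orth_compl H (range T)) x) \<in> orth_compl H (range T)"
      using RN[OF QN[OF x]] by (simp add: Q_def N_def)
    fix z assume "z \<in> orth_compl H (range T)"
    then have z: "z \<in> N" by (simp add: N_def)
    have "hinner H (R a x - R a (Q x)) z = hinner H (x - Q x) (R (star a) z)"
      using x NH[OF QN[OF x]] NH[OF z] by (simp add: R_adj flip: R_diff)
    also have "\<dots> = 0" by (rule Q_orth[OF x RN[OF z]])
    finally show "hinner H (R a x - R a (orth_proj H (orth_compl H (range T)) x)) z = 0"
      by (simp add: Q_def N_def)
  qed (use T in auto)
  have Q_right: "hinner H (Q x) (Q y) = hinner H (Q x) y" if x: "x \<in> hcarrier H" and y: "y \<in> hcarrier H" for x y
  proof -
    note Qx = NH[OF QN[OF x]] and Qy = NH[OF QN[OF y]]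
    have "hinner H (Q x) (y - Q y) = 0"
      using Q_orth[OF y QN[OF x]] ip_commute[OF diff_mem[OF y Qy] Qx] by simp
    then show ?thesis by (simp add: ip_diff_right[OF y Qy Qx])
  qed
  have Q_left: "hinner H (Q x) (Q y) = hinner H x (Q y)" if x: "x \<in> hcarrier H" and y: "y \<in> hcarrier H" for x y
    using Q_orth[OF x QN[OF y]] ip_diff_left[OF x NH[OF QN[OF x]] NH[OF QN[OF y]]] by simp
  have fps: "functional_parallel_sum f g a = hinner H (Q (W a)) \<xi>" for a
  proof -
    have "functional_parallel_sum f g a = hinner H (R a (Q \<xi>)) (Q \<xi>)"
      by (simp only: functional_parallel_sum_def gns_f gns_g Let_def case_prod_conv H_def R_def Q_def
          N_def T_def[abs_def] \<xi>_def)
    also have "\<dots> = hinner H (Q (W a)) (Q \<xi>)" by (simp add: QR[OF \<xi>, symmetric] R\<xi>)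
    finally show ?thesis by (simp add: Q_right W \<xi>)
  qed
  \<comment> \<open>Both direct sums carry the same Gram data: the inner products of T with T, of W
    with T and of W with W are values of \<open>assoc_op f\<close> and \<open>assoc_op g\<close>,
    whichever Hilbert spaces are chosen. The transfer lemma turns this into equality of the
    projected forms.\<close>
  have ops: "operator_parallel_sum (assoc_op f) (assoc_op g) x y = hinner H (Q (W x)) (W y)" for x y
  proof -
    let ?A = "assoc_op f" and ?B = "assoc_op g"
    let ?H = "hsum (hspace_of ?A) (hspace_of ?B)"
    have RA: "hilbert_space (hspace_of ?A)" "\<And>x. ?A x \<in> hcarrier (hspace_of ?A)"
      "\<And>x y. hinner (hspace_of ?A) (?A x) (?A y) = ?A x y"
      using range_completion_hspace_of[OF posf] by (auto simp: range_completion_def hdense_def)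
    have RB: "hilbert_space (hspace_of ?B)" "\<And>x. ?B x \<in> hcarrier (hspace_of ?B)"
      "\<And>x y. hinner (hspace_of ?B) (?B x) (?B y) = ?B x y"
      using range_completion_hspace_of[OF posg] by (auto simp: range_completion_def hdense_def)
    interpret A: semi_inner UNIV ?A by (rule assoc_op_semi_inner[OF f])
    interpret B: semi_inner UNIV ?B by (rule assoc_op_semi_inner[OF g])
    interpret HB: semi_inner "hcarrier (hspace_of ?B)" "hinner (hspace_of ?B)"
      by (rule hilbert_space_semi_inner[OF RB(1)])
    have lin: "(?A (x + y), ?B (x + y)) = (?A x, ?B x) + (?A y, ?B y)"
      "(?A (c *\<^sub>C x), ?B (c *\<^sub>C x)) = c *\<^sub>C (?A x, ?B x)" for x y c
      by (simp_all add: fun_eq_iff A.ip_add_left B.ip_add_left A.ip_scale_left B.ip_scale_left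
          scaleC_prod_def scaleC_fun_def scaleC_complex_def)
    have "hinner ?H (orth_proj ?H (orth_compl ?H (range (\<lambda>x. (?A x, ?B x)))) (?A x, 0)) (?A y, 0) =
        hinner H (orth_proj H (orth_compl H (range T)) (W x)) (W y)"
    proof (rule orth_proj_range_transfer[OF hilbert_space_hsum[OF RA(1) RB(1)] _ lin H T T_add T_scale])
    qed (simp_all add: RA RB W, simp_all add: H_def T_def W_def gns_triple_inner[OF tf] gns_triple_inner[OF tg] mf mg)
    then show ?thesis unfolding operator_parallel_sum_eq[OF posf posg] by (simp add: Q_def N_def)
  qed
  obtain K where K: "0 \<le> K" "\<And>a. gns_seminorm f a \<le> K * norm a"
    using gns_seminorm_bounded[OF e f] by metis
  have snorm_Q: "snorm (Q x) \<le> snorm x" if x: "x \<in> hcarrier H" for x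
  proof -
    note Qx = NH[OF QN[OF x]]
    have "snorm (Q x) * snorm (Q x) = Re (hinner H (Q x) x)"
      using snorm_power2[OF Qx] Q_right[OF x x] by (simp add: power2_eq_square)
    also have "\<dots> \<le> snorm (Q x) * snorm x"
      using cauchy_schwarz[OF Qx x] complex_Re_le_cmod[of "hinner H (Q x) x"] by linarith
    finally show ?thesis using snorm_nonneg[OF Qx] snorm_nonneg[OF x]
      by (cases "snorm (Q x) = 0") (auto simp: mult_le_cancel_left_pos less_le)
  qed
  have snorm_W: "snorm (W a) \<le> K * norm a" for a
  proof -
    have "snorm (W a) = hnorm Hf (\<pi>f a \<zeta>f)"
      unfolding snorm_def hnorm_def by (simp add: W_def H_def)
    then show ?thesis using K(2)[of a] by (simp add: gns_triple_hnorm[OF tf f])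
  qed
  have snorm_e: "snorm (W (e i) - \<xi>) = hnorm Hf (\<pi>f (e i) \<zeta>f - \<zeta>f)" for i
    unfolding snorm_def hnorm_def by (simp add: W_def H_def \<xi>_def)
  have bound: "functional_norm (\<lambda>a. cnj (operator_parallel_sum (assoc_op f) (assoc_op g) (e i) a)
      - functional_parallel_sum f g a) \<le> ereal (K * hnorm Hf (\<pi>f (e i) \<zeta>f - \<zeta>f))" for i
  proof (rule functional_norm_le)
    fix a
    note QWa = NH[OF QN[OF W[of a]]] and QWe = NH[OF QN[OF W[of "e i"]]]
    \<comment> \<open>Conjugation moves a into the first variable: the operator term becomes (Q (W
      a) | W (e i)), which differs from (Q (W a) | \<xi>) in the second variable only.\<close>
    have "cnj (hinner H (Q (W (e i))) (W a)) = hinner H (W a) (Q (W (e i)))"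
      using ip_commute[OF QWe W] by simp
    also have "\<dots> = hinner H (Q (W a)) (W (e i))" using Q_left[OF W W] Q_right[OF W W] by metis
    finally have "cnj (operator_parallel_sum (assoc_op f) (assoc_op g) (e i) a)
        - functional_parallel_sum f g a = hinner H (Q (W a)) (W (e i) - \<xi>)"
      by (simp add: ops fps ip_diff_right[OF W \<xi> QWa])
    then have "cmod (cnj (operator_parallel_sum (assoc_op f) (assoc_op g) (e i) a)
        - functional_parallel_sum f g a) \<le> snorm (Q (W a)) * snorm (W (e i) - \<xi>)"
      using cauchy_schwarz[OF QWa diff_mem[OF W \<xi>]] by simp
    also have "\<dots> \<le> (K * norm a) * snorm (W (e i) - \<xi>)"
      using order_trans[OF snorm_Q[OF W] snorm_W] W \<xi> by (intro mult_right_mono) auto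
    finally show "cmod (cnj (operator_parallel_sum (assoc_op f) (assoc_op g) (e i) a)
        - functional_parallel_sum f g a) \<le> K * hnorm Hf (\<pi>f (e i) \<zeta>f - \<zeta>f) * norm a"
      by (simp add: snorm_e mult_ac)
  next
    show "0 \<le> K * hnorm Hf (\<pi>f (e i) \<zeta>f - \<zeta>f)"
      using K(1) snorm_nonneg[OF diff_mem[OF W \<xi>], of "e i"] by (simp add: snorm_e)
  qed
  have nonneg: "0 \<le> functional_norm \<phi>" for \<phi> :: "'a \<Rightarrow> complex"
    unfolding functional_norm_def by (rule SUP_upper2[of 0]) auto
  have "((\<lambda>i. K * hnorm Hf (\<pi>f (e i) \<zeta>f - \<zeta>f)) \<longlongrightarrow> K * 0) (net_filter I le)"
    by (intro tendsto_mult tendsto_const approximate_unit_cyclic_vector[OF e tf f])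
  then have "((\<lambda>i. ereal (K * hnorm Hf (\<pi>f (e i) \<zeta>f - \<zeta>f))) \<longlongrightarrow> 0) (net_filter I le)"
    by (simp add: zero_ereal_def)
  then have "((\<lambda>i. functional_norm (\<lambda>a. cnj (operator_parallel_sum (assoc_op f) (assoc_op g) (e i) a)
      - functional_parallel_sum f g a)) \<longlongrightarrow> 0) (net_filter I le)"
    by (rule tendsto_sandwich[OF always_eventually always_eventually tendsto_const, rotated 2])
      (use nonneg bound in auto)
  moreover have "representable f" "representable g"
    using tf tg unfolding gns_triple_def representable_def by blast+
  ultimately show ?thesis using posf posg by blast
qed

end
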